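(* Let $\Omega=(a,b)$, let $u^\varepsilon$ be the solution of the regularized logarithmic Schrödinger equation described in the context, let $0<T<T_{\max}$ with $T_{\max}$ the maximal existence time of $u^\varepsilon$, and put $\Omega_T:=\Omega\times[0,T]$. Assume (A) $u^\varepsilon\in C([0,T];H^5(\Omega))\cap C^2([0,T];H^4(\Omega))\cap C^3([0,T];H^2(\Omega))$, and there exist $\varepsilon_0>0$ and $C_0>0$ independent of $\varepsilon$ such that $$\|u^\varepsilon\|_{L^\infty(0,T;H^5(\Omega))}+\|\partial_t^2u^\varepsilon\|_{L^\infty(0,T;H^4(\Omega))}+\|\partial_t^3u^\varepsilon\|_{L^\infty(0,T;H^2(\Omega))}\le C_0$$ uniformly in $0\le\varepsilon\le\varepsilon_0$. Then, for all sufficiently small $\varepsilon\in(0,\varepsilon_0]$, there exist $h_0>0$ and $\tau_0>0$ sufficiently small with $h_0\sim\sqrt{\varepsilon}\,e^{-CT|\ln(\varepsilon)|^2}$ and $\tau_0\sim\sqrt{\varepsilon}\,e^{-CT|\ln(\varepsilon)|^2}$ such that, when $0<h\le h_0$ and $0<\tau\le\tau_0$ satisfy the stability condition $$0<\tau\le\frac{1}{2\max\{|\ln\varepsilon|,\ \ln(\varepsilon+\max_{1\le j\le M-1}|u_j^{\varepsilon,k}|)\}},\qquad 0\le k\le\frac T\tau,$$ the numerical solution $u^{\varepsilon,k}$ of the semi-implicit finite difference scheme (see context) and its error $e^{\varepsilon,k}_j:=u^\varepsilon(x_j,t_k)-u_j^{\varepsilon,k}$, $0\le j\le M$, satisfy,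 for $0\le k\le T/\tau$, $$\|e^{\varepsilon,k}\|\le C_1(\varepsilon,T)(h^2+\tau^2),\qquad \|e^{\varepsilon,k}\|_{H^1}\le C_2(\varepsilon,T)(h^2+\tau^2),\qquad \|u^{\varepsilon,k}\|_\infty\le\Lambda+1,$$ where $\Lambda=\|u^\varepsilon\|_{L^\infty(\Omega_T)}$, $C_1(\varepsilon,T)\sim e^{CT|\ln(\varepsilon)|^2}$, $C_2(\varepsilon,T)\sim\frac1\varepsilon e^{CT|\ln(\varepsilon)|^2}$, and $C$ depends on $C_0$.
   Context: **Equation.** With $\lambda=1$, $u^\varepsilon$ solves $$i\partial_tu^\varepsilon+\partial_{xx}u^\varepsilon=u^\varepsilon\ln\big((\varepsilon+|u^\varepsilon|)^2\big),\ x\in\Omega=(a,b),\ t>0;\quad u^\varepsilon(x,0)=u_0(x),\ x\in\overline\Omega;\quad u^\varepsilon(a,t)=u^\varepsilon(b,t)=0,\ t\ge0,$$ where $0\le\varepsilon\ll1$ (for $\varepsilon=0$ the nonlinearity is $u\ln(|u|^2)$). **Grid.** $h=(b-a)/M$ with $M$ a positive integer, time step $\tau>0$, $x_j=a+jh$ ($0\le j\le M$), $t_k=k\tau$ ($k\ge0$); $T/\tau$ is taken to be an integer. Finite differences: $$\delta_t^cu_j^k=\frac{u_j^{k+1}-u_j^{k-1}}{2\tau},\quad \delta_x^+u_j^k=\frac{u_{j+1}^k-u_j^k}{h},\quad \delta_x^2u_j^k=\frac{u_{j+1}^k-2u_j^k+u_{j-1}^k}{h^2}.$$ **Scheme.**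 $u^{\varepsilon,k}=(u_0^{\varepsilon,k},\dots,u_M^{\varepsilon,k})^T\in\mathbb{C}^{M+1}$ is defined by $$i\delta_t^cu_j^{\varepsilon,k}=-\tfrac12\delta_x^2\big(u_j^{\varepsilon,k+1}+u_j^{\varepsilon,k-1}\big)+u_j^{\varepsilon,k}\ln\big((\varepsilon+|u_j^{\varepsilon,k}|)^2\big),\quad 1\le j\le M-1,\ k\ge1,$$ with $u_0^{\varepsilon,k}=u_M^{\varepsilon,k}=0$ for $k\ge0$, $u_j^{\varepsilon,0}=u_0(x_j)$, and first step $u_j^{\varepsilon,1}=u_j^{\varepsilon,0}+\tau u_1(x_j)$ for $0\le j\le M$, where $u_1(x):=\partial_tu^\varepsilon(x,0)=i\big[u_0''(x)-u_0(x)\ln\big((\varepsilon+|u_0(x)|)^2\big)\big]$. **Discrete norms.** For $v=(v_0,\dots,v_M)^T\in\mathbb{C}^{M+1}$ with $v_0=v_M=0$: $\|v\|^2=h\sum_{j=1}^{M-1}|v_j|^2$, $|v|_{H^1}^2=h\sum_{j=0}^{M-1}|\delta_x^+v_j|^2$, $\|v\|_{H^1}^2=\|v\|^2+|v|_{H^1}^2$, $\|v\|_\infty=\sup_{0\le j\le M}|v_j|$. **Notation.** $A\sim B$ means that $A$ and $B$ are comparable up to positive multiplicative constants independent of $\varepsilon$, $h$, $\tau$. *)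

theory Defs
  imports "HOL-Probability.Essential_Supremum"
begin

section \<open>Sobolev spaces on a bounded interval\<close>

definition test_function :: "real \<Rightarrow> real \<Rightarrow> (real \<Rightarrow> real) \<Rightarrow> bool" where
  "test_function a b \<phi> \<longleftrightarrow>
     (\<forall>k x. (deriv ^^ k) \<phi> field_differentiable (at x)) \<and>
     (\<exists>c d. a < c \<and> c \<le> d \<and> d < b \<and> (\<forall>x. x \<notin> {c..d} \<longrightarrow> \<phi> x = 0))"

definition L2_space :: "real \<Rightarrow> real \<Rightarrow> (real \<Rightarrow> complex) set" where
  "L2_space a b = {f. f \<in> borel_measurable (lebesgue_on {a<..<b}) \<and>
                      integrable (lebesgue_on {a<..<b}) (\<lambda>x. (cmod (f x))\<^sup>2)}"

definition is_weak_deriv ::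
  "real \<Rightarrow> real \<Rightarrow> nat \<Rightarrow> (real \<Rightarrow> complex) \<Rightarrow> (real \<Rightarrow> complex) \<Rightarrow> bool" where
  "is_weak_deriv a b k f g \<longleftrightarrow>
     (\<forall>\<phi>. test_function a b \<phi> \<longrightarrow>
        (LINT x|lebesgue_on {a<..<b}. complex_of_real ((deriv ^^ k) \<phi> x) * f x) =
        (-1) ^ k * (LINT x|lebesgue_on {a<..<b}. complex_of_real (\<phi> x) * g x))"

text \<open>Elements of the spaces are functions rather than a.e.-classes; values outside
  \<open>{a<..<b}\<close> are irrelevant.\<close>

definition sobolev :: "real \<Rightarrow> real \<Rightarrow> nat \<Rightarrow> (real \<Rightarrow> complex) set" where
  "sobolev a b m = {f \<in> L2_space a b. \<forall>k\<le>m. \<exists>g \<in> L2_space a b. is_weak_deriv a b k f g}"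

text \<open>Weak derivatives are unique up to null sets, so the norm below does not depend on the
  choice; it is only meaningful on \<open>sobolev a b m\<close>.\<close>

definition weak_deriv :: "real \<Rightarrow> real \<Rightarrow> nat \<Rightarrow> (real \<Rightarrow> complex) \<Rightarrow> real \<Rightarrow> complex" where
  "weak_deriv a b k f = (SOME g. g \<in> L2_space a b \<and> is_weak_deriv a b k f g)"

definition sobolev_norm :: "real \<Rightarrow> real \<Rightarrow> nat \<Rightarrow> (real \<Rightarrow> complex) \<Rightarrow> real" where
  "sobolev_norm a b m f =
     sqrt (\<Sum>k\<le>m. LINT x|lebesgue_on {a<..<b}. (cmod (weak_deriv a b k f x))\<^sup>2)"


section \<open>Sobolev-valued functions of time\<close>

text \<open>A function \<open>v\<close> of time and space is written \<open>v t x\<close>.\<close>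

definition sobolev_continuous ::
  "real \<Rightarrow> real \<Rightarrow> nat \<Rightarrow> real set \<Rightarrow> (real \<Rightarrow> real \<Rightarrow> complex) \<Rightarrow> bool" where
  "sobolev_continuous a b m I v \<longleftrightarrow>
     (\<forall>t\<in>I. v t \<in> sobolev a b m \<and>
        ((\<lambda>s. sobolev_norm a b m (\<lambda>x. v s x - v t x)) \<longlongrightarrow> 0) (at t within I))"

definition sobolev_time_deriv ::
  "real \<Rightarrow> real \<Rightarrow> nat \<Rightarrow> real set \<Rightarrow> (real \<Rightarrow> real \<Rightarrow> complex) \<Rightarrow>
   (real \<Rightarrow> real \<Rightarrow> complex) \<Rightarrow> bool" where
  "sobolev_time_deriv a b m I v w \<longleftrightarrow>
     (\<forall>t\<in>I. ((\<lambda>s. sobolev_norm a b m (\<lambda>x. (v s x - v t x) / complex_of_real (s - t) - w t x))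
        \<longlongrightarrow> 0) (at t within I))"

text \<open>\<open>D 0\<close> belongs to \<open>C\<^sup>n(I; H\<^sup>m)\<close> and \<open>D j\<close> is its \<open>j\<close>-th time derivative, \<open>j \<le> n\<close>.\<close>

definition sobolev_Cn ::
  "real \<Rightarrow> real \<Rightarrow> nat \<Rightarrow> nat \<Rightarrow> real set \<Rightarrow> (nat \<Rightarrow> real \<Rightarrow> real \<Rightarrow> complex) \<Rightarrow> bool" where
  "sobolev_Cn a b n m I D \<longleftrightarrow>
     (\<forall>j\<le>n. sobolev_continuous a b m I (D j)) \<and>
     (\<forall>j<n. sobolev_time_deriv a b m I (D j) (D (Suc j)))"

definition Linf_sobolev_norm ::
  "real \<Rightarrow> real \<Rightarrow> nat \<Rightarrow> real \<Rightarrow> (real \<Rightarrow> real \<Rightarrow> complex) \<Rightarrow> ereal" where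
  "Linf_sobolev_norm a b m T v =
     esssup (lebesgue_on {0<..<T}) (\<lambda>t. ereal (sobolev_norm a b m (v t)))"

definition Linf_norm :: "real \<Rightarrow> real \<Rightarrow> real \<Rightarrow> (real \<Rightarrow> real \<Rightarrow> complex) \<Rightarrow> ereal" where
  "Linf_norm a b T v =
     esssup (lebesgue_on ({a<..<b} \<times> {0..T})) (\<lambda>(x, t). ereal (cmod (v t x)))"


section \<open>The regularized logarithmic Schroedinger equation\<close>

text \<open>Since \<open>ln 0 = 0\<close>, the case \<open>\<epsilon> = 0\<close> gives the continuous extension of
  \<open>z ln |z|\<^sup>2\<close> by \<open>0\<close> at \<open>z = 0\<close>.\<close>

definition log_nonlin :: "real \<Rightarrow> complex \<Rightarrow> complex" where
  "log_nonlin \<epsilon> z = z * complex_of_real (ln ((\<epsilon> + cmod z)\<^sup>2))"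

text \<open>\<open>u\<close> is an \<open>H\<^sup>1\<^sub>0\<close>-solution on \<open>[0, S)\<close>: \<open>u \<in> C([0, S); H\<^sup>1)\<close>, each \<open>u t\<close> is the continuous
  representative on \<open>{a..b}\<close> and vanishes at the end points, and the equation holds in the sense
  of distributions on \<open>{a<..<b}\<close> for every \<open>t > 0\<close>.\<close>

definition RLogSE_solution ::
  "real \<Rightarrow> real \<Rightarrow> real \<Rightarrow> (real \<Rightarrow> complex) \<Rightarrow> ereal \<Rightarrow> (real \<Rightarrow> real \<Rightarrow> complex) \<Rightarrow> bool" where
  "RLogSE_solution a b \<epsilon> u0 S u \<longleftrightarrow>
     0 < S \<and>
     sobolev_continuous a b 1 {t. 0 \<le> t \<and> ereal t < S} u \<and>
     (\<forall>t. 0 \<le> t \<and> ereal t < S \<longrightarrow> continuous_on {a..b} (u t) \<and> u t a = 0 \<and> u t b = 0) \<and>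
     (\<forall>x\<in>{a..b}. u 0 x = u0 x) \<and>
     (\<forall>\<phi> t. test_function a b \<phi> \<and> 0 < t \<and> ereal t < S \<longrightarrow>
        (\<exists>d. ((\<lambda>s. LINT x|lebesgue_on {a<..<b}. complex_of_real (\<phi> x) * u s x)
                has_vector_derivative d) (at t) \<and>
             \<i> * d + (LINT x|lebesgue_on {a<..<b}. complex_of_real ((deriv ^^ 2) \<phi> x) * u t x) =
             (LINT x|lebesgue_on {a<..<b}. complex_of_real (\<phi> x) * log_nonlin \<epsilon> (u t x))))"

definition max_existence_time :: "real \<Rightarrow> real \<Rightarrow> real \<Rightarrow> (real \<Rightarrow> complex) \<Rightarrow> ereal" where
  "max_existence_time a b \<epsilon> u0 = Sup {S. \<exists>v. RLogSE_solution a b \<epsilon> u0 S v}"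

definition assumption_A ::
  "real \<Rightarrow> real \<Rightarrow> real \<Rightarrow> real \<Rightarrow> (real \<Rightarrow> real \<Rightarrow> complex) \<Rightarrow> bool" where
  "assumption_A a b T C0 u \<longleftrightarrow>
     (\<exists>D. D 0 = u \<and>
        sobolev_Cn a b 0 5 {0..T} D \<and> sobolev_Cn a b 2 4 {0..T} D \<and> sobolev_Cn a b 3 2 {0..T} D \<and>
        Linf_sobolev_norm a b 5 T (D 0) + Linf_sobolev_norm a b 4 T (D 2)
          + Linf_sobolev_norm a b 2 T (D 3) \<le> ereal C0)"


section \<open>The semi-implicit finite difference scheme\<close>

text \<open>A grid function \<open>U\<close> has the time index first: \<open>U k j\<close> approximates \<open>u (k \<tau>) (a + j h)\<close>.\<close>

definition grid_width :: "real \<Rightarrow> real \<Rightarrow> nat \<Rightarrow> real" where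
  "grid_width a b M = (b - a) / real M"

definition grid_point :: "real \<Rightarrow> real \<Rightarrow> nat \<Rightarrow> nat \<Rightarrow> real" where
  "grid_point a b M j = a + real j * grid_width a b M"

definition delta_tc :: "real \<Rightarrow> (nat \<Rightarrow> nat \<Rightarrow> complex) \<Rightarrow> nat \<Rightarrow> nat \<Rightarrow> complex" where
  "delta_tc \<tau> U k j = (U (k + 1) j - U (k - 1) j) / complex_of_real (2 * \<tau>)"

definition delta_xp :: "real \<Rightarrow> (nat \<Rightarrow> complex) \<Rightarrow> nat \<Rightarrow> complex" where
  "delta_xp h v j = (v (j + 1) - v j) / complex_of_real h"

definition delta_xx :: "real \<Rightarrow> (nat \<Rightarrow> complex) \<Rightarrow> nat \<Rightarrow> complex" where
  "delta_xx h v j = (v (j + 1) - 2 * v j + v (j - 1)) / complex_of_real (h\<^sup>2)"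

text \<open>The initial time derivative; derivatives at the end points of \<open>{a..b}\<close> are one-sided.\<close>

definition initial_velocity ::
  "real \<Rightarrow> real \<Rightarrow> real \<Rightarrow> (real \<Rightarrow> complex) \<Rightarrow> real \<Rightarrow> complex" where
  "initial_velocity a b \<epsilon> u0 x =
     \<i> * (vector_derivative (\<lambda>y. vector_derivative u0 (at y within {a..b})) (at x within {a..b})
           - log_nonlin \<epsilon> (u0 x))"

definition SIFD_solution ::
  "real \<Rightarrow> real \<Rightarrow> nat \<Rightarrow> real \<Rightarrow> real \<Rightarrow> (real \<Rightarrow> complex) \<Rightarrow> (nat \<Rightarrow> nat \<Rightarrow> complex) \<Rightarrow> bool" where
  "SIFD_solution a b M \<tau> \<epsilon> u0 U \<longleftrightarrow>
     (\<forall>k\<ge>1. \<forall>j\<in>{1..M-1}.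
        \<i> * delta_tc \<tau> U k j =
        - (1/2) * delta_xx (grid_width a b M) (\<lambda>l. U (k + 1) l + U (k - 1) l) j
          + log_nonlin \<epsilon> (U k j)) \<and>
     (\<forall>k. U k 0 = 0 \<and> U k M = 0) \<and>
     (\<forall>j\<le>M. U 0 j = u0 (grid_point a b M j)) \<and>
     (\<forall>j\<le>M. U 1 j = U 0 j + complex_of_real \<tau> * initial_velocity a b \<epsilon> u0 (grid_point a b M j))"

text \<open>Inserting \<open>0\<close> changes the maximum only for \<open>M = 1\<close>, where there are no interior points.\<close>

definition stability_condition ::
  "nat \<Rightarrow> real \<Rightarrow> real \<Rightarrow> real \<Rightarrow> (nat \<Rightarrow> nat \<Rightarrow> complex) \<Rightarrow> bool" where
  "stability_condition M \<tau> \<epsilon> T U \<longleftrightarrow>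
     (\<forall>k. real k \<le> T / \<tau> \<longrightarrow>
        \<tau> \<le> 1 / (2 * max \<bar>ln \<epsilon>\<bar> (ln (\<epsilon> + Max (insert 0 ((\<lambda>j. cmod (U k j)) ` {1..M-1}))))))"

definition disc_L2_norm :: "real \<Rightarrow> nat \<Rightarrow> (nat \<Rightarrow> complex) \<Rightarrow> real" where
  "disc_L2_norm h M v = sqrt (h * (\<Sum>j=1..M-1. (cmod (v j))\<^sup>2))"

definition disc_H1_seminorm :: "real \<Rightarrow> nat \<Rightarrow> (nat \<Rightarrow> complex) \<Rightarrow> real" where
  "disc_H1_seminorm h M v = sqrt (h * (\<Sum>j<M. (cmod (delta_xp h v j))\<^sup>2))"

definition disc_H1_norm :: "real \<Rightarrow> nat \<Rightarrow> (nat \<Rightarrow> complex) \<Rightarrow> real" where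
  "disc_H1_norm h M v = sqrt ((disc_L2_norm h M v)\<^sup>2 + (disc_H1_seminorm h M v)\<^sup>2)"

definition disc_sup_norm :: "nat \<Rightarrow> (nat \<Rightarrow> complex) \<Rightarrow> real" where
  "disc_sup_norm M v = Max ((\<lambda>j. cmod (v j)) ` {0..M})"

definition comparable_on :: "real set \<Rightarrow> (real \<Rightarrow> real) \<Rightarrow> (real \<Rightarrow> real) \<Rightarrow> bool" where
  "comparable_on E A B \<longleftrightarrow> (\<exists>c>0. \<exists>c'>0. \<forall>\<epsilon>\<in>E. c * B \<epsilon> \<le> A \<epsilon> \<and> A \<epsilon> \<le> c' * B \<epsilon>)"

end

theory Submission
  imports Defs
begin

text \<open>
  Why the theorem holds. On a logarithmic scale in \<open>\<epsilon>\<close> there is a lot of room: every power of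
  \<open>1 / \<epsilon>\<close> and every factor \<open>exp (K T \<bar>ln \<epsilon>\<bar>)\<close> is eventually dominated by \<open>exp (T \<bar>ln \<epsilon>\<bar>\<^sup>2)\<close>, so the
  constant \<open>C = 1\<close> serves for all \<open>C0\<close>, and the thresholds for \<open>h\<close> and \<open>\<tau>\<close> are smaller than any power
  of \<open>\<epsilon>\<close>. It therefore suffices to bound the error by \<open>h\<^sup>2 + \<tau>\<^sup>2\<close> times such factors. The one thing
  that must be avoided is a growth rate \<open>1 / \<epsilon>\<close> in the exponent of the Gronwall argument.

  Regularity. A function in \<open>H\<^sup>m\<close> on an interval has continuous weak derivatives of every order below
  \<open>m\<close> (\<open>du_Bois_Reymond\<close>, \<open>cd_diff_eq_integral\<close>), and each is bounded by \<open>L\<^sup>1\<close> norms of weak derivatives.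
  Applied to difference quotients in time, this turns the time derivatives in Sobolev spaces
  into pointwise ones. The solution then has classical mixed derivatives with bounds depending only on
  \<open>a\<close>, \<open>b\<close>, \<open>C0\<close> and \<open>T\<close>; the bound on the first time derivative comes from those on
  the solution and its second time derivative (\<open>weak_L1_D1_bound\<close>). The equation, given in the sense of
  distributions, holds pointwise up to the end points and at time \<open>0\<close> (\<open>pde\<close>).

  Consistency. The spatial truncation error \<open>\<delta>\<^sub>x\<^sup>2 u - u\<^sub>x\<^sub>x\<close> is of size \<open>h\<^sup>2\<close>, but in general it does
  not vanish at the end points, because the fourth derivative of the solution may be non-zero there.
  As a source term its discrete \<open>H\<^sup>1\<close> seminorm would only be of size \<open>h\<close> to the power \<open>3/2\<close>.
  It is removed beforehand: \<open>\<eta>\<close> is the grid function with \<open>\<delta>\<^sub>x\<^sup>2 \<eta> = \<delta>\<^sub>x\<^sup>2 u - u\<^sub>x\<^sub>x\<close> and zero boundary values.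
  Both \<open>\<eta>\<close> and its time differences are of size \<open>h\<^sup>2\<close> in \<open>H\<^sup>1\<close>, and \<open>\<theta> = u - U - \<eta>\<close> solves the linear
  scheme with a residual that vanishes at the end points (\<open>theta_scheme\<close>, \<open>res_boundary\<close>).

  Stability. The implicit linear part of the scheme is conservative, so that a residual \<open>R\<close> increases the
  norm by at most \<open>2 \<tau> \<parallel>R\<parallel>\<close> in one leapfrog step, in \<open>L\<^sup>2\<close> and, if \<open>R\<close> vanishes at the end
  points, in the \<open>H\<^sup>1\<close> seminorm. The nonlinearity has the Lipschitz constant \<open>2 \<bar>ln \<epsilon>\<bar> + O(1)\<close>, and its derivative
  has a Lipschitz constant of order \<open>1 / \<epsilon>\<close>, which enters the \<open>H\<^sup>1\<close> estimate only as a factor of the \<open>L\<^sup>2\<close>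
  norm of the error. In the norm \<open>\<bar>z\<bar>\<^sub>H\<^sub>1 + \<parallel>z\<parallel> / \<epsilon>\<close> both estimates combine to one recursion whose growth
  rate is \<open>2 \<bar>ln \<epsilon>\<bar> + O(1)\<close> (\<open>wnorm_res_nonlin\<close>, \<open>two_step_Gronwall\<close>, \<open>err_estimate\<close>). The Lipschitz
  constants presuppose a bound on the numerical solution at the same time level, which the induction
  supplies: there the error is at most \<open>1\<close> since \<open>h\<close> and \<open>\<tau>\<close> are so small.
\<close>

section \<open>Smooth bump functions\<close>

text \<open>The functions \<open>P (1 / x) exp (- 1 / x)\<close>, extended by \<open>0\<close> to \<open>x \<le> 0\<close>, form a class that is closed under
  differentiation, which gives smoothness at \<open>0\<close> without computing higher derivatives.\<close>

definition flat_exp :: "real poly \<Rightarrow> real \<Rightarrow> real" where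
  "flat_exp P x = (if x > 0 then poly P (1 / x) * exp (- (1 / x)) else 0)"

lemma poly_times_exp_minus_tendsto_0:
  fixes P :: "real poly"
  shows "((\<lambda>t. poly P t * exp (- t)) \<longlongrightarrow> 0) at_top"
proof -
  have eq: "(\<lambda>t. poly P t * exp (- t)) = (\<lambda>t. \<Sum>i\<le>degree P. coeff P i * (t ^ i / exp t))"
    by (simp add: poly_altdef sum_distrib_right exp_minus divide_inverse mult.assoc)
  have "((\<lambda>t. \<Sum>i\<le>degree P. coeff P i * (t ^ i / exp t)) \<longlongrightarrow> (\<Sum>i\<le>degree P. coeff P i * 0)) at_top"
    by (intro tendsto_sum tendsto_mult tendsto_const tendsto_power_div_exp_0)
  then show ?thesis unfolding eq by simp
qed

lemma flat_exp_has_derivative: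
  "(flat_exp P has_real_derivative flat_exp (monom 1 2 * (P - pderiv P)) x) (at x)"
proof -
  consider "x < 0" | "x > 0" | "x = 0" by linarith
  then show ?thesis
  proof cases
    case 1
    have "((\<lambda>x. 0) has_real_derivative 0) (at x)" by simp
    moreover have "eventually (\<lambda>y. flat_exp P y = 0) (nhds x)"
      using eventually_nhds_in_open[of "{..<0}" x] 1
      by (auto elim!: eventually_mono simp: flat_exp_def)
    ultimately have "(flat_exp P has_real_derivative 0) (at x)"
      by (subst DERIV_cong_ev[OF refl _ refl, of _ "\<lambda>x. 0"]) auto
    then show ?thesis using 1 by (simp add: flat_exp_def)
  next
    case 2
    have "((\<lambda>y. poly P (1 / y) * exp (- (1 / y))) has_real_derivative
        (poly (pderiv P) (1 / x) * (- (1 / x^2)) * exp (- (1 / x)) + poly P (1 / x) * (exp (- (1 / x)) * (1 / x^2)))) (at x)"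
      using 2 by (auto intro!: derivative_eq_intros DERIV_chain2[OF poly_DERIV] simp: power2_eq_square field_simps)
    moreover have "eventually (\<lambda>y. flat_exp P y = poly P (1 / y) * exp (- (1 / y))) (nhds x)"
      using eventually_nhds_in_open[of "{0<..}" x] 2
      by (auto elim!: eventually_mono simp: flat_exp_def)
    ultimately have "(flat_exp P has_real_derivative
       (poly (pderiv P) (1 / x) * (- (1 / x^2)) * exp (- (1 / x)) + poly P (1 / x) * (exp (- (1 / x)) * (1 / x^2)))) (at x)"
      by (subst DERIV_cong_ev[OF refl _ refl]) auto
    then show ?thesis using 2
      by (simp add: flat_exp_def poly_monom field_simps power2_eq_square)
  next
    case 3
    have "((\<lambda>t. poly (pCons 0 P) t * exp (- t)) \<longlongrightarrow> 0) at_top"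
      by (rule poly_times_exp_minus_tendsto_0)
    then have "((\<lambda>y. poly (pCons 0 P) (inverse y) * exp (- (inverse y))) \<longlongrightarrow> 0) (at_right 0)"
      by (rule filterlim_compose[OF _ filterlim_inverse_at_top_right])
    then have R: "((\<lambda>y. (flat_exp P y - flat_exp P 0) / (y - 0)) \<longlongrightarrow> 0) (at_right 0)"
      by (rule Lim_transform_eventually)
        (auto simp: eventually_at_right_field flat_exp_def field_simps intro!: exI[of _ 1])
    have L: "((\<lambda>y. (flat_exp P y - flat_exp P 0) / (y - 0)) \<longlongrightarrow> 0) (at_left 0)"
      by (rule Lim_transform_eventually[OF tendsto_const])
        (auto simp: eventually_at_left_field flat_exp_def field_simps intro!: exI[of _ "-1"])
    have "((\<lambda>y. (flat_exp P y - flat_exp P 0) / (y - 0)) \<longlongrightarrow> 0) (at 0)"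
      using L R by (simp add: filterlim_split_at)
    then have "(flat_exp P has_real_derivative 0) (at 0)"
      by (simp add: has_field_derivative_iff)
    then show ?thesis using 3 by (simp add: flat_exp_def)
  qed
qed

text \<open>A family of functions in which every member has its derivative in the family again, so that all members
  are infinitely differentiable. It is large enough to contain the bumps below.\<close>

inductive smooth_expr :: "(real \<Rightarrow> real) \<Rightarrow> bool" where
  flat: "smooth_expr (\<lambda>x. flat_exp P (s * x + t))"
| const: "smooth_expr (\<lambda>x. c)"
| add: "smooth_expr f \<Longrightarrow> smooth_expr g \<Longrightarrow> smooth_expr (\<lambda>x. f x + g x)"
| mult: "smooth_expr f \<Longrightarrow> smooth_expr g \<Longrightarrow> smooth_expr (\<lambda>x. f x * g x)"
| exp: "smooth_expr f \<Longrightarrow> smooth_expr (\<lambda>x. exp (f x))"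

lemma smooth_expr_derivative:
  "smooth_expr f \<Longrightarrow> \<exists>f'. smooth_expr f' \<and> (\<forall>x. (f has_real_derivative f' x) (at x))"
proof (induction rule: smooth_expr.induct)
  case (flat P s t)
  let ?Q = "monom 1 2 * (P - pderiv P)"
  have "((\<lambda>x. flat_exp P (s * x + t)) has_real_derivative flat_exp ?Q (s * x + t) * s) (at x)" for x
    by (rule DERIV_chain2[OF flat_exp_has_derivative]) (auto intro!: derivative_eq_intros)
  then show ?case by (intro exI[of _ "\<lambda>x. flat_exp ?Q (s * x + t) * s"] conjI smooth_expr.intros) auto
next
  case (const c)
  show ?case by (intro exI[of _ "\<lambda>x. 0"] conjI smooth_expr.intros) auto
next
  case (add f g)
  then obtain f' g' where "smooth_expr f'" "smooth_expr g'"
    "\<forall>x. (f has_real_derivative f' x) (at x)" "\<forall>x. (g has_real_derivative g' x) (at x)" by blast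
  then show ?case by (intro exI[of _ "\<lambda>x. f' x + g' x"] conjI smooth_expr.intros) (auto intro!: derivative_eq_intros)
next
  case (mult f g)
  then obtain f' g' where "smooth_expr f'" "smooth_expr g'"
    "\<forall>x. (f has_real_derivative f' x) (at x)" "\<forall>x. (g has_real_derivative g' x) (at x)" by blast
  then show ?case using mult
    by (intro exI[of _ "\<lambda>x. f' x * g x + f x * g' x"] conjI smooth_expr.intros) (auto intro!: derivative_eq_intros)
next
  case (exp f)
  then obtain f' where "smooth_expr f'"
    "\<forall>x. (f has_real_derivative f' x) (at x)" by blast
  then show ?case using exp
    by (intro exI[of _ "\<lambda>x. exp (f x) * f' x"] conjI smooth_expr.intros) (auto intro!: derivative_eq_intros)
qed

lemma smooth_expr_iterated_deriv: "smooth_expr f \<Longrightarrow> smooth_expr ((deriv ^^ k) f)"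
proof (induction k)
  case (Suc k)
  then obtain f' where f': "smooth_expr f'" "\<forall>x. ((deriv ^^ k) f has_real_derivative f' x) (at x)"
    using smooth_expr_derivative by blast
  have "deriv ((deriv ^^ k) f) = f'" using f'(2) by (auto intro!: ext DERIV_imp_deriv)
  then show ?case using f'(1) by simp
qed simp

lemma smooth_expr_differentiable:
  assumes "smooth_expr f" shows "(deriv ^^ k) f field_differentiable (at x)"
  using smooth_expr_derivative[OF smooth_expr_iterated_deriv[OF assms, of k]]
  by (auto simp: field_differentiable_def)

text \<open>Since \<open>1 - exp (- n s)\<close> tends to \<open>1\<close> for \<open>s > 0\<close> and is \<open>0\<close> for \<open>s = 0\<close>, these functions with values in
  \<open>[0, 1]\<close> converge pointwise to the indicator of \<open>{p<..<q}\<close>. The term is written so that it has the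
  form of the introduction rules of \<open>smooth_expr\<close>.\<close>

definition bump :: "real \<Rightarrow> real \<Rightarrow> nat \<Rightarrow> real \<Rightarrow> real" where
  "bump p q n x = 1 + (-1) * exp ((- real n) * (flat_exp 1 (1 * x + - p) * flat_exp 1 ((-1) * x + q)))"

lemma flat_exp_1_pos: "flat_exp 1 x > 0 \<longleftrightarrow> x > 0" and flat_exp_1_nonneg: "flat_exp 1 x \<ge> 0"
  by (auto simp: flat_exp_def)

lemma bump_bounds: "0 \<le> bump p q n x" "bump p q n x \<le> 1"
  by (auto simp: bump_def flat_exp_1_nonneg)

lemma bump_eq_0: "x \<notin> {p<..<q} \<Longrightarrow> bump p q n x = 0"
  by (auto simp: bump_def flat_exp_def)

lemma bump_pos: "x \<in> {p<..<q} \<Longrightarrow> n > 0 \<Longrightarrow> bump p q n x > 0"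
  by (auto simp: bump_def flat_exp_def)

lemma bump_tendsto: "(\<lambda>n. bump p q n x) \<longlonglongrightarrow> indicator {p<..<q} x"
proof (cases "x \<in> {p<..<q}")
  case True
  define c where "c = flat_exp 1 (x - p) * flat_exp 1 (q - x)"
  have "c > 0" using True by (auto simp: c_def flat_exp_1_pos)
  then have "(\<lambda>n. 1 + (-1) * exp (- real n * c)) \<longlonglongrightarrow> 1 + (-1) * 0" by real_asymp
  then show ?thesis using True by (simp add: bump_def c_def)
qed (auto simp: bump_eq_0)

lemma smooth_expr_bump: "smooth_expr (bump p q n)"
  unfolding bump_def[abs_def] by (intro smooth_expr.intros)

lemma test_function_bump:
  assumes "a < p" "p < q" "q < b" shows "test_function a b (bump p q n)"
  unfolding test_function_def
  using smooth_expr_differentiable[OF smooth_expr_bump] assms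
  by (intro conjI allI exI[of _ p] exI[of _ q] impI bump_eq_0) auto

lemma test_function_deriv: "test_function a b \<phi> \<Longrightarrow> test_function a b (deriv \<phi>)"
proof -
  assume t: "test_function a b \<phi>"
  then obtain c d where cd: "a < c" "c \<le> d" "d < b" "\<And>x. x \<notin> {c..d} \<Longrightarrow> \<phi> x = 0"
    unfolding test_function_def by blast
  have "deriv \<phi> x = 0" if "x \<notin> {c..d}" for x
  proof -
    have "eventually (\<lambda>y. \<phi> y = 0) (nhds x)"
      using eventually_nhds_in_open[OF open_Compl[OF closed_atLeastAtMost[of c d]], of x] that
      by (auto elim!: eventually_mono intro!: cd(4) simp del: atLeastAtMost_iff)
    then have "(\<phi> has_real_derivative 0) (at x)"
      by (subst DERIV_cong_ev[OF refl _ refl, of _ "\<lambda>x. 0"]) auto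
    then show ?thesis by (rule DERIV_imp_deriv)
  qed
  moreover have "(deriv ^^ k) (deriv \<phi>) field_differentiable at x" for k x
    using t unfolding test_function_def
    by (auto simp: funpow_Suc_right simp del: funpow.simps dest!: conjunct1 spec[of _ "Suc k"])
  ultimately show ?thesis using cd unfolding test_function_def by blast
qed

lemma test_function_iterated_deriv: "test_function a b \<phi> \<Longrightarrow> test_function a b ((deriv ^^ k) \<phi>)"
  by (induction k) (auto intro: test_function_deriv)

lemma test_function_has_derivative:
  "test_function a b \<phi> \<Longrightarrow> (\<phi> has_real_derivative deriv \<phi> x) (at x)"
  unfolding test_function_def DERIV_deriv_iff_field_differentiable
  by (elim conjE) (drule spec[of _ 0], simp)

lemma test_function_continuous: "test_function a b \<phi> \<Longrightarrow> continuous_on S \<phi>"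
  by (meson DERIV_isCont continuous_at_imp_continuous_on test_function_has_derivative)

lemma test_function_bounded:
  assumes "test_function a b \<phi>" obtains B where "B \<ge> 0" "\<And>x. \<bar>\<phi> x\<bar> \<le> B"
proof -
  obtain c d where cd: "a < c" "c \<le> d" "d < b" "\<And>x. x \<notin> {c..d} \<Longrightarrow> \<phi> x = 0"
    using assms unfolding test_function_def by blast
  have "bounded (\<phi> ` {c..d})"
    by (intro compact_imp_bounded compact_continuous_image test_function_continuous[OF assms]) auto
  then obtain B where B: "\<And>x. x \<in> {c..d} \<Longrightarrow> \<bar>\<phi> x\<bar> \<le> B"
    unfolding bounded_iff by (auto simp del: atLeastAtMost_iff)
  show thesis
  proof (rule that[of "max B 0"])
    show "\<bar>\<phi> x\<bar> \<le> max B 0" for x using B[of x] cd(4)[of x] by (cases "x \<in> {c..d}") auto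
  qed auto
qed

text \<open>The primitive vanishes on both sides of the support because the integral is zero; this is how
  derivatives of test functions are recognized in the proof of \<open>du_Bois_Reymond\<close>.\<close>

lemma test_function_antideriv:
  assumes \<phi>: "test_function a b \<phi>" and zero: "integral {a..b} \<phi> = 0"
  obtains \<Phi> where "test_function a b \<Phi>" "deriv \<Phi> = \<phi>"
proof -
  obtain c d where cd: "a < c" "c \<le> d" "d < b" "\<And>x. x \<notin> {c..d} \<Longrightarrow> \<phi> x = 0"
    using \<phi> unfolding test_function_def by blast
  define \<Phi> where "\<Phi> x = integral {a..x} \<phi>" for x
  have int: "\<phi> integrable_on {x..y}" for x y
    by (intro integrable_continuous_interval test_function_continuous[OF \<phi>])
  have left0: "\<Phi> x = 0" if "x < c" for x
  proof -
    have "integral {a..x} \<phi> = integral {a..x} (\<lambda>x. 0)"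
      by (rule integral_cong) (use that cd in auto)
    then show ?thesis by (simp add: \<Phi>_def)
  qed
  have right0: "\<Phi> x = 0" if "x > d" for x
  proof (cases "x \<le> b")
    case True
    have "integral {x..b} \<phi> = integral {x..b} (\<lambda>x. 0)"
      by (rule integral_cong) (use that cd in auto)
    then show ?thesis using Henstock_Kurzweil_Integration.integral_combine[of a x b \<phi>] zero int that cd True
      by (auto simp: \<Phi>_def)
  next
    case False
    have "integral {b..x} \<phi> = integral {b..x} (\<lambda>x. 0)"
      by (rule integral_cong) (use that cd in auto)
    then show ?thesis using Henstock_Kurzweil_Integration.integral_combine[of a b x \<phi>] zero int that cd False
      by (auto simp: \<Phi>_def)
  qed
  have der: "(\<Phi> has_real_derivative \<phi> x) (at x)" for x
  proof (cases "x < c")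
    case True
    have "eventually (\<lambda>y. \<Phi> y = 0) (nhds x)"
      using eventually_nhds_in_open[of "{..<c}" x] True left0 by (auto elim!: eventually_mono)
    then have "(\<Phi> has_real_derivative 0) (at x)"
      by (subst DERIV_cong_ev[OF refl _ refl, of _ "\<lambda>x. 0"]) auto
    then show ?thesis using True cd(4)[of x] by auto
  next
    case False
    have "((\<lambda>u. integral {a..u} \<phi>) has_vector_derivative \<phi> x) (at x within {a..x+1})"
      by (rule integral_has_vector_derivative) (use False cd test_function_continuous[OF \<phi>] in auto)
    then have "(\<Phi> has_vector_derivative \<phi> x) (at x within {a<..<x+1})"
      unfolding \<Phi>_def by (rule has_vector_derivative_within_subset) auto
    moreover have "at x within {a<..<x+1} = at x"
      by (rule at_within_open) (use False cd in auto)
    ultimately show ?thesis by (simp add: has_real_derivative_iff_has_vector_derivative)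
  qed
  have dd: "deriv \<Phi> = \<phi>" by (intro ext DERIV_imp_deriv der)
  have "(deriv ^^ k) \<Phi> field_differentiable at x" for k x
  proof (cases k)
    case 0 then show ?thesis using der[of x] by (auto simp: field_differentiable_def)
  next
    case (Suc l)
    then have "(deriv ^^ k) \<Phi> = (deriv ^^ l) \<phi>" by (simp add: funpow_Suc_right dd del: funpow.simps)
    then show ?thesis using \<phi> by (simp add: test_function_def)
  qed
  then have "test_function a b \<Phi>" unfolding test_function_def
    using cd(1-3) left0 right0 by (intro conjI allI exI[of _ c] exI[of _ d] impI) (auto simp: not_le)
  then show thesis using dd that by blast
qed

lemma test_function_add_scale:
  assumes "test_function a b \<phi>" "test_function a b \<psi>"
  shows "test_function a b (\<lambda>x. \<phi> x + c * \<psi> x)"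
proof -
  have it: "(deriv ^^ k) (\<lambda>x. \<phi> x + c * \<psi> x) = (\<lambda>x. (deriv ^^ k) \<phi> x + c * (deriv ^^ k) \<psi> x)" for k
  proof (induction k)
    case (Suc k)
    have "deriv (\<lambda>x. (deriv ^^ k) \<phi> x + c * (deriv ^^ k) \<psi> x) y
       = deriv ((deriv ^^ k) \<phi>) y + c * deriv ((deriv ^^ k) \<psi>) y" for y
      by (rule DERIV_imp_deriv)
        (auto intro!: derivative_eq_intros test_function_has_derivative[OF test_function_iterated_deriv]
          assms)
    then show ?case using Suc by auto
  qed simp
  obtain c1 d1 where 1: "a < c1" "c1 \<le> d1" "d1 < b" "\<And>x. x \<notin> {c1..d1} \<Longrightarrow> \<phi> x = 0"
    using assms(1) unfolding test_function_def by blast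
  obtain c2 d2 where 2: "a < c2" "c2 \<le> d2" "d2 < b" "\<And>x. x \<notin> {c2..d2} \<Longrightarrow> \<psi> x = 0"
    using assms(2) unfolding test_function_def by blast
  have "(deriv ^^ k) (\<lambda>x. \<phi> x + c * \<psi> x) field_differentiable at x" for k x
    unfolding it using assms unfolding test_function_def
    by (intro field_differentiable_add field_differentiable_mult) auto
  moreover have "\<phi> x + c * \<psi> x = 0" if "x \<notin> {min c1 c2..max d1 d2}" for x
    using 1(4)[of x] 2(4)[of x] that by (auto simp: min_le_iff_disj le_max_iff_disj)
  moreover have "a < min c1 c2" "min c1 c2 \<le> max d1 d2" "max d1 d2 < b" using 1 2 by auto
  ultimately show ?thesis unfolding test_function_def by blast
qed

section \<open>The fundamental lemma of the calculus of variations\<close>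

lemma AE_lebesgue_on_iff_negligible:
  assumes "S \<in> sets lebesgue"
  shows "(AE x in lebesgue_on S. P x) \<longleftrightarrow> negligible {x \<in> S. \<not> P x}"
proof -
  have "(AE x in lebesgue_on S. P x) \<longleftrightarrow> (AE x in lebesgue. x \<in> S \<longrightarrow> P x)"
    using assms by (intro AE_restrict_space_iff) simp
  also have "\<dots> \<longleftrightarrow> {x \<in> space lebesgue. \<not> (x \<in> S \<longrightarrow> P x)} \<in> null_sets lebesgue"
    by (rule completion.AE_iff_null_sets)
  also have "{x \<in> space lebesgue. \<not> (x \<in> S \<longrightarrow> P x)} = {x \<in> S. \<not> P x}" by auto
  finally show ?thesis by (simp add: negligible_iff_null_sets)
qed

lemma absolutely_integrable_continuous_mult:
  fixes \<phi> :: "real \<Rightarrow> real" and g :: "real \<Rightarrow> complex"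
  assumes "continuous_on {a..b} \<phi>" "g absolutely_integrable_on {a..b}"
  shows "(\<lambda>x. complex_of_real (\<phi> x) * g x) absolutely_integrable_on {a..b}"
proof -
  have "(\<lambda>x. \<phi> x *\<^sub>R g x) absolutely_integrable_on {a..b}"
  proof (rule absolutely_integrable_bounded_measurable_product[where h = "\<lambda>c z. c *\<^sub>R z"])
    show "bilinear (\<lambda>c z. c *\<^sub>R (z::complex))"
      using bilinear_conv_bounded_bilinear bounded_bilinear_scaleR by blast
    show "\<phi> \<in> borel_measurable (lebesgue_on {a..b})"
      by (intro continuous_imp_measurable_on_sets_lebesgue assms) auto
    show "bounded (\<phi> ` {a..b})"
      by (intro compact_imp_bounded compact_continuous_image assms) auto
  qed (use assms in auto)
  then show ?thesis by (simp add: scaleR_conv_of_real)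
qed

lemma integral_mult_bump_tendsto:
  fixes w :: "real \<Rightarrow> complex"
  assumes w: "w absolutely_integrable_on {a..b}" and pq: "a < p" "p < q" "q < b"
  shows "(\<lambda>n. integral {a..b} (\<lambda>x. complex_of_real (bump p q n x) * w x)) \<longlonglongrightarrow> integral {p..q} w"
proof -
  have int: "(\<lambda>x. complex_of_real (bump p q n x) * w x) integrable_on {a..b}" for n
    using absolutely_integrable_continuous_mult[OF test_function_continuous[OF test_function_bump[OF pq]] w]
    by (simp add: absolutely_integrable_on_def)
  have "(\<lambda>n. integral {a..b} (\<lambda>x. complex_of_real (bump p q n x) * w x)) \<longlonglongrightarrow>
     integral {a..b} (\<lambda>x. complex_of_real (indicator {p<..<q} x) * w x)"
  proof (rule dominated_convergence(2)[OF int])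
    show "(\<lambda>x. norm (w x)) integrable_on {a..b}" using w by (simp add: absolutely_integrable_on_def)
    show "norm (complex_of_real (bump p q n x) * w x) \<le> norm (w x)" for n x
      by (simp add: norm_mult bump_bounds mult_left_le_one_le)
    show "(\<lambda>n. complex_of_real (bump p q n x) * w x) \<longlonglongrightarrow> complex_of_real (indicator {p<..<q} x) * w x" for x
      by (intro tendsto_intros tendsto_of_real bump_tendsto)
  qed
  also have "(\<lambda>x. complex_of_real (indicator {p<..<q} x) * w x) = (\<lambda>x. if x \<in> {p<..<q} then w x else 0)"
    by (auto simp: indicator_def)
  also have "integral {a..b} (\<lambda>x. if x \<in> {p<..<q} then w x else 0) = integral ({p<..<q} \<inter> {a..b}) w"
    by (rule Henstock_Kurzweil_Integration.integral_restrict_Int)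
  also have "{p<..<q} \<inter> {a..b} = {p<..<q}" using pq by auto
  also have "integral {p<..<q} w = integral {p..q} w"
    by (rule integral_open_interval_real[symmetric])
  finally show ?thesis .
qed

text \<open>Bumps converge boundedly to indicators, so all integrals over subintervals vanish; the Lebesgue
  differentiation theorem then gives \<open>w = 0\<close> almost everywhere.\<close>

lemma fundamental_lemma:
  fixes w :: "real \<Rightarrow> complex"
  assumes w: "w absolutely_integrable_on {a..b}"
    and zero: "\<And>\<psi>. test_function a b \<psi> \<Longrightarrow> integral {a..b} (\<lambda>x. complex_of_real (\<psi> x) * w x) = 0"
  shows "AE x in lebesgue_on {a<..<b}. w x = 0"
proof -
  have pq0: "integral {p..q} w = 0" if pq: "a < p" "p < q" "q < b" for p q
    using integral_mult_bump_tendsto[OF w pq] zero[OF test_function_bump[OF pq]]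
    by (simp add: LIMSEQ_const_iff)
  define f where "f x = (if x \<in> {a..b} then w x else 0)" for x
  have "f absolutely_integrable_on UNIV"
    unfolding f_def[abs_def] using w absolutely_integrable_restrict_UNIV by blast
  then have "f integrable_on cbox c d" for c d
    by (metis absolutely_integrable_on_def integrable_on_subcbox top_greatest)
  then obtain N where N: "negligible N"
    "\<And>x e. \<lbrakk>x \<notin> N; 0 < e\<rbrakk> \<Longrightarrow> \<exists>d>0. \<forall>h. 0 < h \<and> h < d \<longrightarrow>
        norm(integral (cbox x (x + h *\<^sub>R One)) f /\<^sub>R h ^ DIM(real) - f x) < e"
    using integrable_ccontinuous_explicit by blast
  have "w x = 0" if x: "x \<in> {a<..<b}" "x \<notin> N" for x
  proof (rule ccontr)
    assume "w x \<noteq> 0"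
    then obtain d where d: "d > 0" "\<And>h. 0 < h \<Longrightarrow> h < d \<Longrightarrow>
      norm(integral {x..x + h} f /\<^sub>R h - f x) < norm (w x)"
      using N(2)[OF x(2), of "norm (w x)"] by auto
    define h where "h = min (d/2) ((b - x)/2)"
    have h: "0 < h" "h < d" "x + h < b" using x d by (auto simp: h_def min_def field_simps)
    have "integral {x..x + h} f = integral {x..x+h} w"
      by (rule integral_cong) (use x h in \<open>auto simp: f_def\<close>)
    also have "\<dots> = 0" using pq0[of x "x + h"] x h by auto
    finally show False using d(2)[OF h(1,2)] x by (simp add: f_def)
  qed
  then have "{x \<in> {a<..<b}. w x \<noteq> 0} \<subseteq> N" by auto
  then show ?thesis using N(1) negligible_subset
    by (auto simp: AE_lebesgue_on_iff_negligible)
qed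

section \<open>The lemma of du Bois-Reymond\<close>

text \<open>Here \<open>G\<close> is only absolutely continuous, so the product \<open>\<phi> G\<close> need not be differentiable everywhere. Instead, the defect
  \<open>E s t\<close> of the formula is an additive interval function. Near a point \<open>x\<close>, replacing \<open>G\<close> and \<open>\<phi>\<close>
  by their values at \<open>x\<close> shows that \<open>\<bar>E s t\<bar>\<close> is at most \<open>e\<close> times \<open>t - s + \<integral> \<bar>g\<bar>\<close>; Bolzano bisection
  transfers the bound to the whole interval, for every \<open>e > 0\<close>.\<close>

lemma integral_by_parts_indefinite:
  fixes g :: "real \<Rightarrow> complex" and \<phi> \<phi>' :: "real \<Rightarrow> real"
  assumes ab: "a \<le> b" and g: "g absolutely_integrable_on {a..b}"
    and \<phi>: "\<And>x. (\<phi> has_real_derivative \<phi>' x) (at x)" and \<phi>'c: "continuous_on {a..b} \<phi>'"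
  defines "G \<equiv> \<lambda>x. integral {a..x} g"
  shows "integral {a..b} (\<lambda>x. complex_of_real (\<phi>' x) * G x) + integral {a..b} (\<lambda>x. complex_of_real (\<phi> x) * g x)
    = complex_of_real (\<phi> b) * G b"
proof -
  have gi: "g integrable_on {a..b}" and ngi: "(\<lambda>x. norm (g x)) integrable_on {a..b}"
    using g by (auto simp: absolutely_integrable_on_def)
  have \<phi>c: "continuous_on {a..b} \<phi>" by (meson \<phi> DERIV_isCont continuous_at_imp_continuous_on)
  have Gc: "continuous_on {a..b} G" unfolding G_def by (rule indefinite_integral_continuous_1[OF gi])
  have i1: "(\<lambda>x. complex_of_real (\<phi>' x) * G x) integrable_on {a..b}"
    by (intro integrable_continuous_interval continuous_intros \<phi>'c Gc)
  have i2: "(\<lambda>x. complex_of_real (\<phi> x) * g x) integrable_on {a..b}"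
    using absolutely_integrable_continuous_mult[OF \<phi>c g] by (simp add: absolutely_integrable_on_def)
  define F where "F = (\<lambda>x. complex_of_real (\<phi>' x) * G x + complex_of_real (\<phi> x) * g x)"
  have iF: "F integrable_on {a..b}" unfolding F_def by (intro integrable_add i1 i2)
  obtain B where B: "B > 0" "\<And>x. x \<in> {a..b} \<Longrightarrow> \<bar>\<phi>' x\<bar> \<le> B"
  proof -
    have "bounded (\<phi>' ` {a..b})"
      by (intro compact_imp_bounded compact_continuous_image \<phi>'c) auto
    then show thesis using that unfolding bounded_pos by (auto simp del: atLeastAtMost_iff)
  qed
  define E where "E s t = integral {s..t} F - (complex_of_real (\<phi> t) * G t - complex_of_real (\<phi> s) * G s)" for s t
  have main: "norm (E a b) \<le> e * ((b - a) + integral {a..b} (\<lambda>x. norm (g x)))" if e: "e > 0" for e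
  proof -
    define P where "P s t \<longleftrightarrow> (a \<le> s \<and> t \<le> b \<longrightarrow> norm (E s t) \<le> e * ((t - s) + integral {s..t} (\<lambda>x. norm (g x))))" for s t
    have "P a b"
      using ab
    proof (induction rule: Bolzano)
      case (trans s t u)
      show ?case
        unfolding P_def
      proof
        assume st: "a \<le> s \<and> u \<le> b"
        have sub: "F integrable_on {s..u}" "(\<lambda>x. norm (g x)) integrable_on {s..u}"
          using iF ngi st trans integrable_on_subinterval by (metis (no_types, lifting) atLeastatMost_subset_iff)+
        have "E s u = E s t + E t u"
          unfolding E_def using Henstock_Kurzweil_Integration.integral_combine[OF trans(3,4) sub(1)] by simp
        then have "norm (E s u) \<le> norm (E s t) + norm (E t u)" by (simp add: norm_triangle_ineq)
        also have "\<dots> \<le> e * ((t - s) + integral {s..t} (\<lambda>x. norm (g x))) + e * ((u - t) + integral {t..u} (\<lambda>x. norm (g x)))"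
          using trans st unfolding P_def by (intro add_mono) auto
        also have "\<dots> = e * ((u - s) + integral {s..u} (\<lambda>x. norm (g x)))"
          by (simp add: Henstock_Kurzweil_Integration.integral_combine[OF trans(3,4) sub(2), symmetric] algebra_simps)
        finally show "norm (E s u) \<le> e * ((u - s) + integral {s..u} (\<lambda>x. norm (g x)))" .
      qed
    next
      case (local x)
      then have x: "x \<in> {a..b}" by auto
      define e1 where "e1 = min e (e / (3 * B))"
      have e1: "e1 > 0" "e1 \<le> e" "3 * B * e1 \<le> e" using e B by (auto simp: e1_def min_def field_simps)
      obtain d1 where d1: "d1 > 0" "\<And>y. y \<in> {a..b} \<Longrightarrow> dist y x < d1 \<Longrightarrow> dist (G y) (G x) < e1"
        using Gc x e1(1) unfolding continuous_on_iff by metis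
      obtain d2 where d2: "d2 > 0" "\<And>y. y \<in> {a..b} \<Longrightarrow> dist y x < d2 \<Longrightarrow> dist (\<phi> y) (\<phi> x) < e1"
        using \<phi>c x e1(1) unfolding continuous_on_iff by metis
      show ?case
        unfolding P_def
      proof (intro exI[of _ "min d1 d2"] conjI allI impI)
        show "min d1 d2 > 0" using d1 d2 by auto
        fix s t assume st: "s \<le> x \<and> x \<le> t \<and> t - s < min d1 d2" and st': "a \<le> s \<and> t \<le> b"
        have near: "norm (G y - G x) \<le> e1" "\<bar>\<phi> y - \<phi> x\<bar> \<le> e1" if "y \<in> {s..t}" for y
          using d1(2)[of y] d2(2)[of y] that st st' by (auto simp: dist_norm dist_real_def intro: less_imp_le)
        have sub: "{s..t} \<subseteq> {a..b}" using st' by auto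
        have g_st: "g integrable_on {s..t}" "(\<lambda>x. norm (g x)) integrable_on {s..t}"
          using gi ngi integrable_on_subinterval[OF _ sub] by blast+
        have ga_st: "g absolutely_integrable_on {s..t}" using g_st by (simp add: absolutely_integrable_on_def)
        have cont_st: "continuous_on {s..t} \<phi>" "continuous_on {s..t} \<phi>'" "continuous_on {s..t} G"
          using \<phi>c \<phi>'c Gc sub continuous_on_subset by blast+
        define A1 where "A1 = integral {s..t} (\<lambda>y. complex_of_real (\<phi>' y) * (G y - G x))"
        define A2 where "A2 = integral {s..t} (\<lambda>y. complex_of_real (\<phi> y - \<phi> x) * g y)"
        have int1: "((\<lambda>y. complex_of_real (\<phi>' y)) has_integral complex_of_real (\<phi> t) - complex_of_real (\<phi> s)) {s..t}"
        proof (rule fundamental_theorem_of_calculus)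
          show "s \<le> t" using st by auto
          show "((\<lambda>y. complex_of_real (\<phi> y)) has_vector_derivative complex_of_real (\<phi>' y)) (at y within {s..t})" for y
            using has_vector_derivative_of_real[OF DERIV_subset[OF \<phi>[of y] subset_UNIV]] by (auto simp: o_def)
        qed
        have int2: "integral {s..t} g = G t - G s"
          using Henstock_Kurzweil_Integration.integral_combine[of a s t g] st st' g_st
            integrable_on_subinterval[OF gi, of a t] by (auto simp: G_def algebra_simps)
        \<comment> \<open>the integrand with \<open>G\<close> and \<open>\<phi>\<close> frozen at \<open>x\<close>, and two small remainders\<close>
        have Fsplit: "F y = complex_of_real (\<phi>' y) * (G y - G x) + complex_of_real (\<phi> y - \<phi> x) * g y
            + (G x * complex_of_real (\<phi>' y) + complex_of_real (\<phi> x) * g y)" for y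
          by (simp add: F_def algebra_simps)
        have iA1: "(\<lambda>y. complex_of_real (\<phi>' y) * (G y - G x)) integrable_on {s..t}"
          by (intro integrable_continuous_interval continuous_intros cont_st)
        have iA2: "(\<lambda>y. complex_of_real (\<phi> y - \<phi> x) * g y) absolutely_integrable_on {s..t}"
          by (intro absolutely_integrable_continuous_mult continuous_intros cont_st ga_st)
        then have iA2': "(\<lambda>y. complex_of_real (\<phi> y - \<phi> x) * g y) integrable_on {s..t}"
          by (simp add: absolutely_integrable_on_def)
        have "(F has_integral A1 + A2 + (G x * (complex_of_real (\<phi> t) - complex_of_real (\<phi> s)) + complex_of_real (\<phi> x) * (G t - G s))) {s..t}"
          unfolding Fsplit A1_def A2_def int2[symmetric]
          by (intro has_integral_add has_integral_mult_right int1 integrable_integral iA1 iA2' g_st(1))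
        then have "integral {s..t} F = A1 + A2 + (G x * (complex_of_real (\<phi> t) - complex_of_real (\<phi> s)) + complex_of_real (\<phi> x) * (G t - G s))"
          by (rule integral_unique)
        then have Eeq: "E s t = A1 + A2 - (complex_of_real (\<phi> t - \<phi> x) * (G t - G x)) + complex_of_real (\<phi> s - \<phi> x) * (G s - G x)"
          unfolding E_def by (simp add: algebra_simps)
        have n1: "norm A1 \<le> B * e1 * (t - s)"
          unfolding A1_def
        proof (rule integral_bound)
          show "s \<le> t" using st by auto
          show "continuous_on {s..t} (\<lambda>y. complex_of_real (\<phi>' y) * (G y - G x))"
            by (intro continuous_intros cont_st)
          show "norm (complex_of_real (\<phi>' y) * (G y - G x)) \<le> B * e1" if "y \<in> {s..t}" for y
            unfolding norm_mult norm_of_real using that sub B near e1 by (intro mult_mono) auto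
        qed
        have n2: "norm A2 \<le> e1 * integral {s..t} (\<lambda>x. norm (g x))"
        proof -
          have "norm A2 \<le> integral {s..t} (\<lambda>x. e1 * norm (g x))"
            unfolding A2_def
          proof (rule integral_norm_bound_integral[OF iA2'])
            show "(\<lambda>x. e1 * norm (g x)) integrable_on {s..t}"
              using g_st(2) by (rule integrable_on_mult_right)
            show "norm (complex_of_real (\<phi> y - \<phi> x) * g y) \<le> e1 * norm (g y)" if "y \<in> {s..t}" for y
              unfolding norm_mult norm_of_real using near[OF that] by (intro mult_right_mono) auto
          qed
          then show ?thesis by simp
        qed
        have lip: "\<bar>\<phi> y - \<phi> x\<bar> \<le> B * (t - s)" if "y \<in> {s..t}" for y
        proof -
          have "norm (\<phi> y - \<phi> x) \<le> B * norm (y - x)"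
          proof (rule field_differentiable_bound[of "{s..t}" \<phi> \<phi>'])
            show "(\<phi> has_field_derivative \<phi>' z) (at z within {s..t})" for z
              by (rule DERIV_subset[OF \<phi>]) auto
          qed (use that st sub B in auto)
          also have "\<dots> \<le> B * (t - s)" using that st B by (intro mult_left_mono) auto
          finally show ?thesis by simp
        qed
        have n34: "norm (complex_of_real (\<phi> y - \<phi> x) * (G y - G x)) \<le> B * (t - s) * e1" if "y \<in> {s..t}" for y
          unfolding norm_mult norm_of_real using lip[OF that] near[OF that] st B by (intro mult_mono) auto
        have "norm (E s t) \<le> norm A1 + norm A2 + norm (complex_of_real (\<phi> t - \<phi> x) * (G t - G x)) + norm (complex_of_real (\<phi> s - \<phi> x) * (G s - G x))"
          unfolding Eeq by (intro norm_triangle_le norm_triangle_le_diff add_mono order_refl)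
        also have "\<dots> \<le> B * e1 * (t - s) + e1 * integral {s..t} (\<lambda>x. norm (g x)) + B * (t - s) * e1 + B * (t - s) * e1"
          using n1 n2 n34 st by (intro add_mono) auto
        also have "\<dots> = 3 * B * e1 * (t - s) + e1 * integral {s..t} (\<lambda>x. norm (g x))" by (simp add: algebra_simps)
        also have "\<dots> \<le> e * (t - s) + e * integral {s..t} (\<lambda>x. norm (g x))"
          using e1 st by (intro add_mono mult_right_mono Henstock_Kurzweil_Integration.integral_nonneg g_st) auto
        finally show "norm (E s t) \<le> e * ((t - s) + integral {s..t} (\<lambda>x. norm (g x)))" by (simp add: algebra_simps)
      qed
    qed
    then show ?thesis by (simp add: P_def)
  qed
  define K where "K = (b - a) + integral {a..b} (\<lambda>x. norm (g x))"
  have K: "K \<ge> 0" unfolding K_def using ab by (intro add_nonneg_nonneg Henstock_Kurzweil_Integration.integral_nonneg ngi) auto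
  have "norm (E a b) \<le> 0"
  proof (rule field_le_epsilon)
    fix e :: real assume "e > 0"
    then have "norm (E a b) \<le> e / (K + 1) * K"
      using main[of "e / (K + 1)"] K unfolding K_def[symmetric] by simp
    also have "\<dots> \<le> e" using \<open>e > 0\<close> K by (simp add: field_simps)
    finally show "norm (E a b) \<le> 0 + e" by simp
  qed
  then have "integral {a..b} F = complex_of_real (\<phi> b) * G b"
    by (simp add: E_def G_def)
  moreover have "integral {a..b} F = integral {a..b} (\<lambda>x. complex_of_real (\<phi>' x) * G x) + integral {a..b} (\<lambda>x. complex_of_real (\<phi> x) * g x)"
    unfolding F_def by (rule Henstock_Kurzweil_Integration.integral_add[OF i1 i2])
  ultimately show ?thesis by simp
qed

text \<open>With \<open>r = w - \<integral> g\<close>, integration by parts leaves \<open>\<integral> \<phi>' r = 0\<close>. Every test function \<open>\<psi>\<close> differs from a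
  derivative of a test function by a multiple of a fixed bump \<open>\<rho>\<close>, hence \<open>\<integral> \<psi> (r - c) = 0\<close> for the constant \<open>c\<close> that
  makes this true for \<open>\<rho>\<close>.\<close>

lemma du_Bois_Reymond:
  fixes w g :: "real \<Rightarrow> complex"
  assumes ab: "a < b" and w: "w absolutely_integrable_on {a..b}" and g: "g absolutely_integrable_on {a..b}"
    and weak: "\<And>\<phi>. test_function a b \<phi> \<Longrightarrow> integral {a..b} (\<lambda>x. complex_of_real (deriv \<phi> x) * w x)
                 = - integral {a..b} (\<lambda>x. complex_of_real (\<phi> x) * g x)"
  shows "\<exists>c. AE x in lebesgue_on {a<..<b}. w x = c + integral {a..x} g"
proof -
  define G where "G = (\<lambda>x. integral {a..x} g)"
  define r where "r x = w x - G x" for x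
  have gi: "g integrable_on {a..b}" using g by (auto simp: absolutely_integrable_on_def)
  have Gc: "continuous_on {a..b} G" unfolding G_def by (rule indefinite_integral_continuous_1[OF gi])
  have Ga: "G absolutely_integrable_on {a..b}" by (rule absolutely_integrable_continuous_real[OF Gc])
  have ra: "r absolutely_integrable_on {a..b}" unfolding r_def using w Ga by (intro set_integral_diff) auto
  have r_weak: "integral {a..b} (\<lambda>x. complex_of_real (deriv \<phi> x) * r x) = 0" if \<phi>: "test_function a b \<phi>" for \<phi>
  proof -
    have dc: "continuous_on {a..b} (deriv \<phi>)" by (intro test_function_continuous[OF test_function_deriv[OF \<phi>]])
    have "\<phi> b = 0" using \<phi> unfolding test_function_def by (metis atLeastAtMost_iff not_less)
    then have "integral {a..b} (\<lambda>x. complex_of_real (deriv \<phi> x) * G x) = - integral {a..b} (\<lambda>x. complex_of_real (\<phi> x) * g x)"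
      using integral_by_parts_indefinite[OF less_imp_le[OF ab] g test_function_has_derivative[OF \<phi>] dc]
      by (simp add: G_def add_eq_0_iff)
    moreover have "integral {a..b} (\<lambda>x. complex_of_real (deriv \<phi> x) * r x) =
       integral {a..b} (\<lambda>x. complex_of_real (deriv \<phi> x) * w x) - integral {a..b} (\<lambda>x. complex_of_real (deriv \<phi> x) * G x)"
      unfolding r_def right_diff_distrib
      by (intro Henstock_Kurzweil_Integration.integral_diff)
         (use absolutely_integrable_continuous_mult[OF dc w] absolutely_integrable_continuous_mult[OF dc Ga] in
          \<open>auto simp: absolutely_integrable_on_def\<close>)
    ultimately show ?thesis using weak[OF \<phi>] by simp
  qed
  \<comment> \<open>the middle third carries the fixed bump \<open>\<rho>\<close>\<close>
  define p q where "p = (2 * a + b) / 3" and "q = (a + 2 * b) / 3"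
  have pq: "a < p" "p < q" "q < b" using ab by (auto simp: p_def q_def)
  define \<rho> where "\<rho> = bump p q 1"
  have \<rho>: "test_function a b \<rho>" unfolding \<rho>_def by (rule test_function_bump[OF pq])
  define J where "J = integral {a..b} \<rho>"
  have "J \<noteq> 0"
  proof
    assume "J = 0"
    then have "\<forall>x\<in>{a..b}. \<rho> x = 0"
      unfolding J_def
      by (subst (asm) integral_eq_0_iff) (use ab test_function_continuous[OF \<rho>] bump_bounds in \<open>auto simp: \<rho>_def\<close>)
    then show False using bump_pos[of "(p + q) / 2" p q 1] pq by (auto simp: \<rho>_def)
  qed
  define I where "I \<psi> = integral {a..b} (\<lambda>x. complex_of_real (\<psi> x) * r x)" for \<psi> :: "real \<Rightarrow> real"
  have I_lin: "I (\<lambda>x. \<phi> x + c * \<psi> x) = I \<phi> + complex_of_real c * I \<psi>"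
    if "test_function a b \<phi>" "test_function a b \<psi>" for \<phi> \<psi> c
  proof -
    have 1: "(\<lambda>x. complex_of_real (\<phi> x) * r x) integrable_on {a..b}" "(\<lambda>x. complex_of_real (\<psi> x) * r x) integrable_on {a..b}"
      using absolutely_integrable_continuous_mult[OF test_function_continuous ra] that
      by (auto simp: absolutely_integrable_on_def)
    have "I (\<lambda>x. \<phi> x + c * \<psi> x) = integral {a..b} (\<lambda>x. complex_of_real (\<phi> x) * r x + complex_of_real c * (complex_of_real (\<psi> x) * r x))"
      unfolding I_def by (simp add: algebra_simps)
    also have "\<dots> = I \<phi> + complex_of_real c * I \<psi>"
      unfolding I_def using 1 by (subst Henstock_Kurzweil_Integration.integral_add) (auto intro: integrable_on_mult_right)
    finally show ?thesis .
  qed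
  define c where "c = I \<rho> / complex_of_real J"
  have "AE x in lebesgue_on {a<..<b}. r x - c = 0"
  proof (rule fundamental_lemma)
    show "(\<lambda>x. r x - c) absolutely_integrable_on {a..b}"
      by (intro set_integral_diff ra absolutely_integrable_continuous_real continuous_intros)
    fix \<psi> assume \<psi>: "test_function a b \<psi>"
    have \<psi>i: "\<psi> integrable_on {a..b}" and \<rho>i: "\<rho> integrable_on {a..b}"
      by (auto intro!: integrable_continuous_interval test_function_continuous[OF \<psi>] test_function_continuous[OF \<rho>])
    define m where "m = integral {a..b} \<psi> / J"
    define \<psi>1 where "\<psi>1 x = \<psi> x + (- m) * \<rho> x" for x
    have t1: "test_function a b \<psi>1" unfolding \<psi>1_def by (rule test_function_add_scale[OF \<psi> \<rho>])
    have "integral {a..b} \<psi>1 = integral {a..b} \<psi> + (-m) * J"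
      unfolding \<psi>1_def J_def using \<psi>i integrable_on_mult_right[OF \<rho>i, of "- m"]
      by (subst Henstock_Kurzweil_Integration.integral_add) auto
    also have "\<dots> = 0" using \<open>J \<noteq> 0\<close> by (simp add: m_def)
    finally obtain \<Phi> where \<Phi>: "test_function a b \<Phi>" "deriv \<Phi> = \<psi>1" using test_function_antideriv[OF t1] by blast
    have "I \<psi>1 = 0" using r_weak[OF \<Phi>(1)] \<Phi>(2) by (simp add: I_def)
    then have "I \<psi> = complex_of_real m * I \<rho>" unfolding \<psi>1_def I_lin[OF \<psi> \<rho>] by (simp add: add_eq_0_iff)
    also have "\<dots> = c * complex_of_real (integral {a..b} \<psi>)" by (simp add: m_def c_def)
    finally have Iy: "I \<psi> = c * complex_of_real (integral {a..b} \<psi>)" .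
    have ri: "(\<lambda>x. complex_of_real (\<psi> x) * r x) integrable_on {a..b}"
      using absolutely_integrable_continuous_mult[OF test_function_continuous[OF \<psi>] ra]
      by (auto simp: absolutely_integrable_on_def)
    have "((\<lambda>x. complex_of_real (\<psi> x)) has_integral complex_of_real (integral {a..b} \<psi>)) {a..b}"
      using \<psi>i by (intro has_integral_of_real integrable_integral)
    then have "((\<lambda>x. complex_of_real (\<psi> x) * r x - c * complex_of_real (\<psi> x)) has_integral (I \<psi> - c * complex_of_real (integral {a..b} \<psi>))) {a..b}"
      unfolding I_def by (intro has_integral_diff has_integral_mult_right integrable_integral ri)
    then show "integral {a..b} (\<lambda>x. complex_of_real (\<psi> x) * (r x - c)) = 0"
      using Iy by (simp add: algebra_simps integral_unique)
  qed
  then have "AE x in lebesgue_on {a<..<b}. w x = c + integral {a..x} g"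
    by (auto elim!: eventually_mono simp: r_def G_def algebra_simps)
  then show ?thesis by blast
qed

section \<open>Continuous representatives of weak derivatives\<close>

locale bounded_interval =
  fixes a b :: real
  assumes ab: "a < b"
begin

abbreviation \<mu> where "\<mu> \<equiv> lebesgue_on {a<..<b}"
abbreviation H where "H \<equiv> sobolev a b"
abbreviation wd where "wd \<equiv> weak_deriv a b"

lemma AE_imp_ex_in_open:
  fixes S T :: "'a::euclidean_space set"
  assumes "AE x in lebesgue_on S. P x" "S \<in> sets lebesgue" "T \<subseteq> S" "open T" "T \<noteq> {}"
  shows "\<exists>x\<in>T. P x"
proof (rule ccontr)
  assume "\<not> ?thesis"
  then have "T \<subseteq> {x \<in> S. \<not> P x}" using assms(3) by auto
  moreover have "negligible {x \<in> S. \<not> P x}"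
    using assms AE_lebesgue_on_iff_negligible by auto
  ultimately have "negligible T" using negligible_subset by blast
  then show False using open_not_negligible assms by blast
qed

lemma continuous_AE_eq_imp_eq:
  fixes F G :: "real \<Rightarrow> complex"
  assumes "continuous_on {a..b} F" "continuous_on {a..b} G" and AE: "AE x in \<mu>. F x = G x"
    and x: "x \<in> {a..b}"
  shows "F x = G x"
proof (rule ccontr)
  assume ne: "F x \<noteq> G x"
  have "continuous_on {a..b} (\<lambda>x. F x - G x)" by (intro continuous_intros assms)
  then obtain d where d: "d > 0" "\<And>y. y \<in> {a..b} \<Longrightarrow> dist y x < d \<Longrightarrow> dist (F y - G y) (F x - G x) < dist (F x) (G x)"
    using x ne unfolding continuous_on_iff by (metis zero_less_dist_iff)
  let ?T = "{max a (x - d)<..<min b (x + d)}"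
  have "?T \<noteq> {}" using x d(1) ab by (auto simp: max_def min_def)
  then obtain y where y: "y \<in> ?T" "F y = G y"
    using AE_imp_ex_in_open[OF AE _ _ open_greaterThanLessThan, of "max a (x - d)" "min b (x + d)"]
    by (force simp: subset_iff)
  then have "y \<in> {a..b}" "dist y x < d" by (auto simp: dist_real_def abs_less_iff)
  then have "dist (F y - G y) (F x - G x) < dist (F x) (G x)" by (rule d(2))
  then show False using y by (simp add: dist_norm norm_minus_commute)
qed

lemma L2_space_absolutely_integrable:
  assumes "f \<in> L2_space a b" shows "f absolutely_integrable_on {a..b}"
proof -
  have m: "f \<in> borel_measurable \<mu>" and i: "integrable \<mu> (\<lambda>x. (cmod (f x))\<^sup>2)"
    using assms by (auto simp: L2_space_def)
  have "(\<lambda>x. 1 + (cmod (f x))\<^sup>2) integrable_on {a<..<b}"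
    by (intro integrable_add integrable_on_lebesgue_on[OF i]) (auto simp: integrable_on_open_interval_real)
  then have "f absolutely_integrable_on {a<..<b}"
  proof (rule measurable_bounded_by_integrable_imp_absolutely_integrable[OF m, rotated])
    show "norm (f x) \<le> 1 + (cmod (f x))\<^sup>2" for x
      using zero_le_power2[of "cmod (f x) - 1"] norm_ge_zero[of "f x"] unfolding power2_diff power_one mult_1_right by linarith
  qed auto
  then show ?thesis by (simp add: absolutely_integrable_on_Icc_iff_Ioo)
qed

text \<open>Cauchy-Schwarz from the inequalities of Young type: the optimal choice is \<open>c = sqrt (S / L)\<close>, and
  \<open>c\<close> tends to \<open>0\<close> in the degenerate case \<open>S = 0\<close>.\<close>

lemma le_sqrt_mult_sqrt_of_Young:
  fixes I L S :: real
  assumes "L > 0" "S \<ge> 0" and Young: "\<And>c. c > 0 \<Longrightarrow> 2 * I \<le> c * L + S / c"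
  shows "I \<le> sqrt L * sqrt S"
proof (cases "S = 0")
  case True
  have "I \<le> 0"
  proof (rule field_le_epsilon)
    fix e :: real assume "e > 0"
    then show "I \<le> 0 + e" using Young[of "2 * e / L"] assms True by simp
  qed
  then show ?thesis using True by simp
next
  case False
  define c where "c = sqrt S / sqrt L"
  have "c > 0" using False assms by (auto simp: c_def)
  have "c * L = sqrt L * sqrt S" using assms by (simp add: c_def field_simps)
  moreover have "S / c = sqrt L * sqrt S" using assms False by (simp add: c_def field_simps)
  ultimately show ?thesis using Young[OF \<open>c > 0\<close>] by simp
qed

lemma L1_norm_le_L2_norm:
  assumes f: "f \<in> L2_space a b"
  shows "integral {a..b} (\<lambda>x. norm (f x)) \<le> sqrt (b - a) * sqrt (LINT x|\<mu>. (cmod (f x))\<^sup>2)"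
proof (rule le_sqrt_mult_sqrt_of_Young)
  have i: "integrable \<mu> (\<lambda>x. (cmod (f x))\<^sup>2)" using f by (auto simp: L2_space_def)
  have S: "((\<lambda>x. (cmod (f x))\<^sup>2) has_integral (LINT x|\<mu>. (cmod (f x))\<^sup>2)) {a..b}"
    using has_integral_integral_lebesgue_on[OF i] by (simp add: has_integral_Icc_iff_Ioo)
  have ni: "(\<lambda>x. norm (f x)) integrable_on {a..b}"
    using L2_space_absolutely_integrable[OF f] by (simp add: absolutely_integrable_on_def)
  fix c :: real assume c: "c > 0"
  have "((\<lambda>x. c + (cmod (f x))\<^sup>2 / c) has_integral (c * (b - a) + (LINT x|\<mu>. (cmod (f x))\<^sup>2) / c)) {a..b}"
    using has_integral_add[OF has_integral_const_real[of c a b] has_integral_divide[OF S, of c]] ab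
    by (simp add: mult.commute)
  moreover have "((\<lambda>x. 2 * norm (f x)) has_integral (2 * integral {a..b} (\<lambda>x. norm (f x)))) {a..b}"
    by (intro has_integral_mult_right integrable_integral ni)
  moreover have "2 * norm (f x) \<le> c + (cmod (f x))\<^sup>2 / c" for x
  proof -
    have "0 \<le> (cmod (f x) - c)\<^sup>2 / c" using c by simp
    also have "\<dots> = c + (cmod (f x))\<^sup>2 / c - 2 * norm (f x)" using c by (simp add: power2_eq_square field_simps)
    finally show ?thesis by simp
  qed
  ultimately show "2 * integral {a..b} (\<lambda>x. norm (f x)) \<le> c * (b - a) + (LINT x|\<mu>. (cmod (f x))\<^sup>2) / c"
    using has_integral_le by blast
qed (use ab in \<open>auto intro: Bochner_Integration.integral_nonneg\<close>)

lemma L2_space_linear_combination: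
  assumes f: "f \<in> L2_space a b" and g: "g \<in> L2_space a b"
  shows "(\<lambda>x. \<alpha> * f x + \<beta> * g x) \<in> L2_space a b"
proof -
  have mf: "f \<in> borel_measurable \<mu>" and fi: "integrable \<mu> (\<lambda>x. (cmod (f x))\<^sup>2)"
    and mg: "g \<in> borel_measurable \<mu>" and gi: "integrable \<mu> (\<lambda>x. (cmod (g x))\<^sup>2)"
    using f g by (auto simp: L2_space_def)
  have m: "(\<lambda>x. \<alpha> * f x + \<beta> * g x) \<in> borel_measurable \<mu>" using mf mg by measurable
  have "integrable \<mu> (\<lambda>x. 2 * (cmod \<alpha>)\<^sup>2 * (cmod (f x))\<^sup>2 + 2 * (cmod \<beta>)\<^sup>2 * (cmod (g x))\<^sup>2)"
    using fi gi by auto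
  then have "integrable \<mu> (\<lambda>x. (cmod (\<alpha> * f x + \<beta> * g x))\<^sup>2)"
  proof (rule Bochner_Integration.integrable_bound)
    show "AE x in \<mu>. norm ((cmod (\<alpha> * f x + \<beta> * g x))\<^sup>2) \<le> norm (2 * (cmod \<alpha>)\<^sup>2 * (cmod (f x))\<^sup>2 + 2 * (cmod \<beta>)\<^sup>2 * (cmod (g x))\<^sup>2)"
    proof (intro AE_I2)
      fix x
      have "(cmod (\<alpha> * f x + \<beta> * g x))\<^sup>2 \<le> (cmod \<alpha> * cmod (f x) + cmod \<beta> * cmod (g x))\<^sup>2"
        by (intro power_mono norm_triangle_le) (auto simp: norm_mult)
      also have "\<dots> \<le> 2 * (cmod \<alpha> * cmod (f x))\<^sup>2 + 2 * (cmod \<beta> * cmod (g x))\<^sup>2"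
        using sum_squares_bound[of "cmod \<alpha> * cmod (f x)" "cmod \<beta> * cmod (g x)"] by (simp add: power2_sum)
      finally show "norm ((cmod (\<alpha> * f x + \<beta> * g x))\<^sup>2) \<le> norm (2 * (cmod \<alpha>)\<^sup>2 * (cmod (f x))\<^sup>2 + 2 * (cmod \<beta>)\<^sup>2 * (cmod (g x))\<^sup>2)"
        by (simp add: power_mult_distrib)
    qed
    show "(\<lambda>x. (cmod (\<alpha> * f x + \<beta> * g x))\<^sup>2) \<in> borel_measurable \<mu>" using m by measurable
  qed
  then show ?thesis using m by (simp add: L2_space_def)
qed

lemma test_mult_has_integral:
  assumes "f \<in> L2_space a b" "test_function a b \<phi>"
  shows "((\<lambda>x. complex_of_real (\<phi> x) * f x) has_integral (LINT x|\<mu>. complex_of_real (\<phi> x) * f x)) {a..b}"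
    and "integrable \<mu> (\<lambda>x. complex_of_real (\<phi> x) * f x)"
proof -
  have "(\<lambda>x. complex_of_real (\<phi> x) * f x) absolutely_integrable_on {a<..<b}"
    using absolutely_integrable_continuous_mult[OF test_function_continuous[OF assms(2)] L2_space_absolutely_integrable[OF assms(1)]]
    by (simp add: absolutely_integrable_on_Icc_iff_Ioo)
  then show i: "integrable \<mu> (\<lambda>x. complex_of_real (\<phi> x) * f x)"
    by (rule absolutely_integrable_imp_integrable) auto
  show "((\<lambda>x. complex_of_real (\<phi> x) * f x) has_integral (LINT x|\<mu>. complex_of_real (\<phi> x) * f x)) {a..b}"
    using has_integral_integral_lebesgue_on[OF i] by (simp add: has_integral_Icc_iff_Ioo)
qed

lemma AE_eqI_test_functions:
  assumes "f \<in> L2_space a b" "g \<in> L2_space a b"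
    and "\<And>\<phi>. test_function a b \<phi> \<Longrightarrow> (LINT x|\<mu>. complex_of_real (\<phi> x) * f x) = (LINT x|\<mu>. complex_of_real (\<phi> x) * g x)"
  shows "AE x in \<mu>. f x = g x"
proof -
  have "AE x in \<mu>. f x - g x = 0"
  proof (rule fundamental_lemma)
    show "(\<lambda>x. f x - g x) absolutely_integrable_on {a..b}"
      by (intro set_integral_diff L2_space_absolutely_integrable assms)
    show "integral {a..b} (\<lambda>x. complex_of_real (\<psi> x) * (f x - g x)) = 0" if "test_function a b \<psi>" for \<psi>
      using has_integral_diff[OF test_mult_has_integral(1)[OF assms(1) that] test_mult_has_integral(1)[OF assms(2) that]]
        assms(3)[OF that] by (auto simp: right_diff_distrib intro: integral_unique)
  qed
  then show ?thesis by auto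
qed

lemma weak_deriv_spec:
  assumes "f \<in> H m" "k \<le> m"
  shows "wd k f \<in> L2_space a b" "is_weak_deriv a b k f (wd k f)"
proof -
  have "\<exists>g. g \<in> L2_space a b \<and> is_weak_deriv a b k f g"
    using assms unfolding sobolev_def by auto
  then have "wd k f \<in> L2_space a b \<and> is_weak_deriv a b k f (wd k f)"
    unfolding weak_deriv_def by (rule someI_ex)
  then show "wd k f \<in> L2_space a b" "is_weak_deriv a b k f (wd k f)" by auto
qed

lemma sobolev_imp_L2: "f \<in> H m \<Longrightarrow> f \<in> L2_space a b"
  by (simp add: sobolev_def)

lemma is_weak_deriv_unique:
  assumes "is_weak_deriv a b k f g1" "is_weak_deriv a b k f g2" "g1 \<in> L2_space a b" "g2 \<in> L2_space a b"
  shows "AE x in \<mu>. g1 x = g2 x"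
proof (rule AE_eqI_test_functions[OF assms(3,4)])
  fix \<phi> assume "test_function a b \<phi>"
  then have "(- 1) ^ k * (LINT x|\<mu>. complex_of_real (\<phi> x) * g1 x) = (- 1) ^ k * (LINT x|\<mu>. complex_of_real (\<phi> x) * g2 x)"
    using assms(1)[unfolded is_weak_deriv_def, rule_format, of \<phi>] assms(2)[unfolded is_weak_deriv_def, rule_format, of \<phi>]
    by argo
  then show "(LINT x|\<mu>. complex_of_real (\<phi> x) * g1 x) = (LINT x|\<mu>. complex_of_real (\<phi> x) * g2 x)" by simp
qed

lemma is_weak_deriv_linear_combination:
  assumes "is_weak_deriv a b k f f'" "is_weak_deriv a b k g g'"
    and L2: "f \<in> L2_space a b" "f' \<in> L2_space a b" "g \<in> L2_space a b" "g' \<in> L2_space a b"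
  shows "is_weak_deriv a b k (\<lambda>x. \<alpha> * f x + \<beta> * g x) (\<lambda>x. \<alpha> * f' x + \<beta> * g' x)"
proof -
  have lin: "(LINT x|\<mu>. complex_of_real (\<phi> x) * (\<alpha> * f x + \<beta> * g x)) =
      \<alpha> * (LINT x|\<mu>. complex_of_real (\<phi> x) * f x) + \<beta> * (LINT x|\<mu>. complex_of_real (\<phi> x) * g x)"
    if "test_function a b \<phi>" "f \<in> L2_space a b" "g \<in> L2_space a b" for \<phi> f g
  proof -
    have "(LINT x|\<mu>. complex_of_real (\<phi> x) * (\<alpha> * f x + \<beta> * g x)) =
       (LINT x|\<mu>. \<alpha> * (complex_of_real (\<phi> x) * f x) + \<beta> * (complex_of_real (\<phi> x) * g x))"
      by (simp add: algebra_simps)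
    then show ?thesis using test_mult_has_integral(2)[OF that(2,1)] test_mult_has_integral(2)[OF that(3,1)] by simp
  qed
  show ?thesis unfolding is_weak_deriv_def
  proof (intro allI impI)
    fix \<phi> assume t: "test_function a b \<phi>"
    show "(LINT x|\<mu>. complex_of_real ((deriv ^^ k) \<phi> x) * (\<alpha> * f x + \<beta> * g x)) =
         (- 1) ^ k * (LINT x|\<mu>. complex_of_real (\<phi> x) * (\<alpha> * f' x + \<beta> * g' x))"
      unfolding lin[OF t L2(2,4)] lin[OF test_function_iterated_deriv[OF t] L2(1,3)]
      using assms(1,2) t unfolding is_weak_deriv_def by (simp add: algebra_simps)
  qed
qed

lemma sobolev_linear_combination:
  assumes "f \<in> H m" "g \<in> H m" shows "(\<lambda>x. \<alpha> * f x + \<beta> * g x) \<in> H m"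
  unfolding sobolev_def
proof (clarify, intro conjI allI impI)
  show "(\<lambda>x. \<alpha> * f x + \<beta> * g x) \<in> L2_space a b"
    by (intro L2_space_linear_combination sobolev_imp_L2[OF assms(1)] sobolev_imp_L2[OF assms(2)])
  show "\<exists>h\<in>L2_space a b. is_weak_deriv a b k (\<lambda>x. \<alpha> * f x + \<beta> * g x) h" if "k \<le> m" for k
    using is_weak_deriv_linear_combination[OF weak_deriv_spec(2)[OF assms(1) that] weak_deriv_spec(2)[OF assms(2) that]]
     L2_space_linear_combination weak_deriv_spec(1)[OF assms(1) that] weak_deriv_spec(1)[OF assms(2) that]
     sobolev_imp_L2[OF assms(1)] sobolev_imp_L2[OF assms(2)] by blast
qed

lemma weak_deriv_linear_combination:
  assumes "f \<in> H m" "g \<in> H m" "k \<le> m"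
  shows "AE x in \<mu>. wd k (\<lambda>x. \<alpha> * f x + \<beta> * g x) x = \<alpha> * wd k f x + \<beta> * wd k g x"
proof (rule is_weak_deriv_unique)
  note s = weak_deriv_spec[OF assms(1,3)] weak_deriv_spec[OF assms(2,3)]
  show "is_weak_deriv a b k (\<lambda>x. \<alpha> * f x + \<beta> * g x) (\<lambda>x. \<alpha> * wd k f x + \<beta> * wd k g x)"
    by (intro is_weak_deriv_linear_combination s sobolev_imp_L2[OF assms(1)] sobolev_imp_L2[OF assms(2)])
  show "(\<lambda>x. \<alpha> * wd k f x + \<beta> * wd k g x) \<in> L2_space a b"
    by (intro L2_space_linear_combination s)
qed (use weak_deriv_spec[OF sobolev_linear_combination[OF assms(1,2)] assms(3)] in auto)

lemma weak_deriv_absolutely_integrable: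
  "f \<in> H m \<Longrightarrow> k \<le> m \<Longrightarrow> wd k f absolutely_integrable_on {a..b}"
  by (intro L2_space_absolutely_integrable weak_deriv_spec)

text \<open>Sobolev functions are measured by these seminorms, whose triangle inequality is that of the absolute value.\<close>

definition weak_L1 :: "nat \<Rightarrow> (real \<Rightarrow> complex) \<Rightarrow> real" where
  "weak_L1 k f = integral {a..b} (\<lambda>x. norm (wd k f x))"

lemma weak_L1_le_sobolev_norm:
  assumes "f \<in> H m" "k \<le> m"
  shows "weak_L1 k f \<le> sqrt (b - a) * sobolev_norm a b m f"
proof -
  have "weak_L1 k f \<le> sqrt (b - a) * sqrt (LINT x|\<mu>. (cmod (wd k f x))\<^sup>2)"
    unfolding weak_L1_def by (intro L1_norm_le_L2_norm weak_deriv_spec[OF assms])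
  also have "\<dots> \<le> sqrt (b - a) * sobolev_norm a b m f"
    unfolding sobolev_norm_def
    by (intro mult_left_mono real_sqrt_le_mono member_le_sum[of k "{..m}" "\<lambda>k. LINT x|\<mu>. (cmod (wd k f x))\<^sup>2"])
       (use assms ab in \<open>auto intro: Bochner_Integration.integral_nonneg\<close>)
  finally show ?thesis .
qed

lemma HK_integral_cong_AE:
  fixes f g :: "real \<Rightarrow> 'c::euclidean_space"
  assumes "AE x in \<mu>. f x = g x" "{c..d} \<subseteq> {a..b}"
  shows "integral {c..d} f = integral {c..d} g" "f integrable_on {c..d} \<longleftrightarrow> g integrable_on {c..d}"
proof -
  have N: "negligible ({x \<in> {a<..<b}. f x \<noteq> g x} \<union> {a, b})"
    using assms by (auto simp: AE_lebesgue_on_iff_negligible)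
  have eq: "f x = g x" if "x \<in> {c..d} - ({x \<in> {a<..<b}. f x \<noteq> g x} \<union> {a, b})" for x
    using that assms(2) by force
  show "integral {c..d} f = integral {c..d} g" by (rule integral_spike[OF N]) (use eq in metis)
  show "f integrable_on {c..d} \<longleftrightarrow> g integrable_on {c..d}" using integrable_spike[OF _ N] eq by metis
qed

lemma weak_L1_linear_combination:
  assumes "f \<in> H m" "g \<in> H m" "k \<le> m"
  shows "weak_L1 k (\<lambda>x. \<alpha> * f x + \<beta> * g x) \<le> cmod \<alpha> * weak_L1 k f + cmod \<beta> * weak_L1 k g"
proof -
  have i: "(\<lambda>x. norm (wd k f x)) integrable_on {a..b}" "(\<lambda>x. norm (wd k g x)) integrable_on {a..b}"
    using weak_deriv_absolutely_integrable assms by (auto simp: absolutely_integrable_on_def)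
  have "AE x in \<mu>. norm (wd k (\<lambda>x. \<alpha> * f x + \<beta> * g x) x) = norm (\<alpha> * wd k f x + \<beta> * wd k g x)"
    using weak_deriv_linear_combination[OF assms, of \<alpha> \<beta>] by (auto elim!: eventually_mono)
  then have "weak_L1 k (\<lambda>x. \<alpha> * f x + \<beta> * g x) = integral {a..b} (\<lambda>x. norm (\<alpha> * wd k f x + \<beta> * wd k g x))"
    unfolding weak_L1_def by (rule HK_integral_cong_AE) auto
  also have "\<dots> \<le> integral {a..b} (\<lambda>x. cmod \<alpha> * norm (wd k f x) + cmod \<beta> * norm (wd k g x))"
  proof (rule integral_le)
    have "(\<lambda>x. \<alpha> * wd k f x + \<beta> * wd k g x) \<in> L2_space a b"
      by (intro L2_space_linear_combination weak_deriv_spec[OF assms(1,3)] weak_deriv_spec[OF assms(2,3)])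
    then show "(\<lambda>x. norm (\<alpha> * wd k f x + \<beta> * wd k g x)) integrable_on {a..b}"
      using L2_space_absolutely_integrable by (auto simp: absolutely_integrable_on_def)
    show "(\<lambda>x. cmod \<alpha> * norm (wd k f x) + cmod \<beta> * norm (wd k g x)) integrable_on {a..b}"
      by (intro integrable_add integrable_on_mult_right i)
  qed (auto intro!: norm_triangle_le simp: norm_mult)
  also have "\<dots> = cmod \<alpha> * weak_L1 k f + cmod \<beta> * weak_L1 k g"
    unfolding weak_L1_def using i
    by (subst Henstock_Kurzweil_Integration.integral_add) (auto intro!: integrable_on_mult_right)
  finally show ?thesis .
qed

text \<open>The continuous representative of the \<open>k\<close>-th weak derivative; on \<open>{a..b}\<close> it is determined uniquely.\<close>

definition cd :: "nat \<Rightarrow> (real \<Rightarrow> complex) \<Rightarrow> real \<Rightarrow> complex" where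
  "cd k f = (SOME F. continuous_on {a..b} F \<and> (AE x in \<mu>. F x = wd k f x))"

text \<open>Testing with \<open>\<phi>'\<close> instead of \<open>\<phi>\<close> shows that the weak derivative of order \<open>k + 1\<close> is the first weak
  derivative of the one of order \<open>k\<close>, so \<open>du_Bois_Reymond\<close> applies.\<close>

lemma weak_deriv_Suc_primitive:
  assumes f: "f \<in> H m" and k: "k < m"
  shows "\<exists>c. AE x in \<mu>. wd k f x = c + integral {a..x} (wd (Suc k) f)"
proof (rule du_Bois_Reymond[OF ab])
  have k': "k \<le> m" "Suc k \<le> m" using k by auto
  show "wd k f absolutely_integrable_on {a..b}" "wd (Suc k) f absolutely_integrable_on {a..b}"
    using weak_deriv_absolutely_integrable[OF f] k' by auto
  note s = weak_deriv_spec[OF f k'(1)] weak_deriv_spec[OF f k'(2)]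
  fix \<phi> assume t: "test_function a b \<phi>"
  have "(LINT x|\<mu>. complex_of_real ((deriv ^^ k) (deriv \<phi>) x) * f x) = (-1) ^ k * (LINT x|\<mu>. complex_of_real (deriv \<phi> x) * wd k f x)"
    using s(2) test_function_deriv[OF t] by (simp add: is_weak_deriv_def)
  moreover have "(LINT x|\<mu>. complex_of_real ((deriv ^^ Suc k) \<phi> x) * f x) = (-1) ^ Suc k * (LINT x|\<mu>. complex_of_real (\<phi> x) * wd (Suc k) f x)"
    using s(4) t unfolding is_weak_deriv_def by blast
  moreover have "(deriv ^^ Suc k) \<phi> = (deriv ^^ k) (deriv \<phi>)" by (simp add: funpow_Suc_right del: funpow.simps)
  ultimately have "(-1) ^ k * (LINT x|\<mu>. complex_of_real (deriv \<phi> x) * wd k f x) = (-1) ^ k * (- (LINT x|\<mu>. complex_of_real (\<phi> x) * wd (Suc k) f x))"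
    by simp
  then have "(LINT x|\<mu>. complex_of_real (deriv \<phi> x) * wd k f x) = - (LINT x|\<mu>. complex_of_real (\<phi> x) * wd (Suc k) f x)"
    by (metis mult_cancel_left power_not_zero zero_neq_neg_one)
  then show "integral {a..b} (\<lambda>x. complex_of_real (deriv \<phi> x) * wd k f x) = - integral {a..b} (\<lambda>x. complex_of_real (\<phi> x) * wd (Suc k) f x)"
    using test_mult_has_integral(1)[OF s(1) test_function_deriv[OF t]] test_mult_has_integral(1)[OF s(3) t]
    by (simp add: integral_unique)
qed

lemma weak_deriv_integrable:
  assumes "f \<in> H m" "k \<le> m" "{x..y} \<subseteq> {a..b}"
  shows "wd k f integrable_on {x..y}" "(\<lambda>x. norm (wd k f x)) integrable_on {x..y}"
  using weak_deriv_absolutely_integrable[OF assms(1,2)] assms(3) integrable_on_subinterval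
  unfolding absolutely_integrable_on_def by blast+

lemma cd_spec:
  assumes f: "f \<in> H m" and k: "k < m"
  shows "continuous_on {a..b} (cd k f)" "AE x in \<mu>. cd k f x = wd k f x"
proof -
  obtain c where c: "AE x in \<mu>. wd k f x = c + integral {a..x} (wd (Suc k) f)"
    using weak_deriv_Suc_primitive[OF assms] by blast
  have "continuous_on {a..b} (\<lambda>x. c + integral {a..x} (wd (Suc k) f))"
    by (intro continuous_intros indefinite_integral_continuous_1 weak_deriv_integrable[OF f]) (use k in auto)
  moreover have "AE x in \<mu>. c + integral {a..x} (wd (Suc k) f) = wd k f x" using c by (auto elim!: eventually_mono)
  ultimately have "\<exists>F. continuous_on {a..b} F \<and> (AE x in \<mu>. F x = wd k f x)" by (intro exI conjI)
  then have "continuous_on {a..b} (cd k f) \<and> (AE x in \<mu>. cd k f x = wd k f x)"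
    unfolding cd_def by (rule someI_ex)
  then show "continuous_on {a..b} (cd k f)" "AE x in \<mu>. cd k f x = wd k f x" by auto
qed

lemma cd_diff_eq_integral:
  assumes f: "f \<in> H m" and k: "k < m" and xy: "a \<le> x" "x \<le> y" "y \<le> b"
  shows "cd k f y - cd k f x = integral {x..y} (wd (Suc k) f)"
proof -
  obtain c where c: "AE x in \<mu>. wd k f x = c + integral {a..x} (wd (Suc k) f)"
    using weak_deriv_Suc_primitive[OF assms(1,2)] by blast
  have eq: "cd k f z = c + integral {a..z} (wd (Suc k) f)" if "z \<in> {a..b}" for z
  proof (rule continuous_AE_eq_imp_eq[OF cd_spec(1)[OF f k] _ _ that])
    show "continuous_on {a..b} (\<lambda>x. c + integral {a..x} (wd (Suc k) f))"
      by (intro continuous_intros indefinite_integral_continuous_1 weak_deriv_integrable[OF f]) (use k in auto)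
    show "AE x in \<mu>. cd k f x = c + integral {a..x} (wd (Suc k) f)"
      using c cd_spec(2)[OF f k] by eventually_elim simp
  qed
  have "integral {a..x} (wd (Suc k) f) + integral {x..y} (wd (Suc k) f) = integral {a..y} (wd (Suc k) f)"
    by (intro Henstock_Kurzweil_Integration.integral_combine weak_deriv_integrable[OF f]) (use xy k in auto)
  then show ?thesis using eq[of x] eq[of y] xy by (simp add: algebra_simps)
qed

lemma cd_has_vector_derivative:
  assumes f: "f \<in> H m" and k: "Suc k < m" and x: "x \<in> {a..b}"
  shows "(cd k f has_vector_derivative cd (Suc k) f x) (at x within {a..b})"
proof -
  have "((\<lambda>u. integral {a..u} (cd (Suc k) f)) has_vector_derivative cd (Suc k) f x) (at x within {a..b})"
    by (rule integral_has_vector_derivative[OF cd_spec(1)[OF f k] x])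
  then have "((\<lambda>u. cd k f a + integral {a..u} (cd (Suc k) f)) has_vector_derivative cd (Suc k) f x) (at x within {a..b})"
    using has_vector_derivative_add[OF has_vector_derivative_const] by fastforce
  then show ?thesis
  proof (rule has_vector_derivative_transform[OF x, rotated])
    show "cd k f u = cd k f a + integral {a..u} (cd (Suc k) f)" if "u \<in> {a..b}" for u
      using cd_diff_eq_integral[OF f, of k a u] HK_integral_cong_AE(1)[OF cd_spec(2)[OF f k], of a u] that k
      by (auto simp: algebra_simps)
  qed
qed

lemma cd_linear_combination:
  assumes f: "f \<in> H m" and g: "g \<in> H m" and k: "k < m" and x: "x \<in> {a..b}"
  shows "cd k (\<lambda>x. \<alpha> * f x + \<beta> * g x) x = \<alpha> * cd k f x + \<beta> * cd k g x"
proof (rule continuous_AE_eq_imp_eq[OF _ _ _ x])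
  note s = cd_spec[OF f k] cd_spec[OF g k] cd_spec[OF sobolev_linear_combination[OF f g, of \<alpha> \<beta>] k]
  show "continuous_on {a..b} (cd k (\<lambda>x. \<alpha> * f x + \<beta> * g x))" by (rule s)
  show "continuous_on {a..b} (\<lambda>x. \<alpha> * cd k f x + \<beta> * cd k g x)" by (intro continuous_intros s)
  show "AE x in \<mu>. cd k (\<lambda>x. \<alpha> * f x + \<beta> * g x) x = \<alpha> * cd k f x + \<beta> * cd k g x"
    using s(6) s(2) s(4) weak_deriv_linear_combination[OF f g less_imp_le[OF k], of \<alpha> \<beta>]
    by eventually_elim simp
qed

lemma cd_0_eq:
  assumes f: "f \<in> H m" and k: "0 < m" and c: "continuous_on {a..b} f" and x: "x \<in> {a..b}"
  shows "cd 0 f x = f x"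
proof (rule continuous_AE_eq_imp_eq[OF cd_spec(1)[OF f k] c _ x])
  have "is_weak_deriv a b 0 f f" by (simp add: is_weak_deriv_def)
  then have "AE x in \<mu>. wd 0 f x = f x"
    using is_weak_deriv_unique[OF weak_deriv_spec(2)[OF f] _ weak_deriv_spec(1)[OF f] sobolev_imp_L2[OF f]] by auto
  then show "AE x in \<mu>. cd 0 f x = f x" using cd_spec(2)[OF f k] by eventually_elim simp
qed

text \<open>The one-dimensional Sobolev embedding: compare \<open>cd k f x\<close> with \<open>cd k f y\<close> and average over \<open>y\<close>.\<close>

lemma cd_bound_weak_L1:
  assumes f: "f \<in> H m" and k: "k < m" and x: "x \<in> {a..b}"
  shows "norm (cd k f x) \<le> weak_L1 k f / (b - a) + weak_L1 (Suc k) f"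
proof -
  have nc: "continuous_on {a..b} (\<lambda>y. norm (cd k f y))" by (intro continuous_intros cd_spec[OF f k])
  have "norm (cd k f x) \<le> norm (cd k f y) + weak_L1 (Suc k) f" if y: "y \<in> {a..b}" for y
  proof -
    have bd: "norm (cd k f q - cd k f p) \<le> weak_L1 (Suc k) f" if "a \<le> p" "p \<le> q" "q \<le> b" for p q
    proof -
      have "norm (cd k f q - cd k f p) \<le> integral {p..q} (\<lambda>x. norm (wd (Suc k) f x))"
        unfolding cd_diff_eq_integral[OF f k that]
        by (rule integral_norm_bound_integral[OF weak_deriv_integrable[OF f]]) (use that k weak_deriv_integrable[OF f] in auto)
      also have "\<dots> \<le> weak_L1 (Suc k) f" unfolding weak_L1_def
        by (rule integral_subset_le) (use that k in \<open>auto intro!: weak_deriv_integrable[OF f]\<close>)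
      finally show ?thesis .
    qed
    have "norm (cd k f x - cd k f y) \<le> weak_L1 (Suc k) f"
      using bd[of x y] bd[of y x] x y by (cases "x \<le> y") (auto simp: norm_minus_commute)
    then show ?thesis using norm_triangle_sub[of "cd k f x" "cd k f y"] by simp
  qed
  then have "integral {a..b} (\<lambda>y. norm (cd k f x)) \<le> integral {a..b} (\<lambda>y. norm (cd k f y) + weak_L1 (Suc k) f)"
    by (intro integral_le integrable_continuous_interval continuous_intros nc)
  also have "\<dots> = integral {a..b} (\<lambda>y. norm (cd k f y)) + (b - a) * weak_L1 (Suc k) f"
    using ab by (subst Henstock_Kurzweil_Integration.integral_add) (auto intro!: integrable_continuous_interval nc)
  also have "integral {a..b} (\<lambda>y. norm (cd k f y)) = weak_L1 k f"
    unfolding weak_L1_def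
    by (rule HK_integral_cong_AE(1)) (use cd_spec(2)[OF f k] in \<open>auto elim!: eventually_mono\<close>)
  finally have "(b - a) * norm (cd k f x) \<le> weak_L1 k f + (b - a) * weak_L1 (Suc k) f" using ab by simp
  then show ?thesis using ab by (simp add: field_simps)
qed

definition emb_const :: real where "emb_const = (1 / (b - a) + 1) * sqrt (b - a)"

lemma emb_const_pos: "emb_const > 0"
  using ab by (auto simp: emb_const_def intro!: mult_pos_pos add_pos_pos)

lemma sobolev_norm_nonneg: "sobolev_norm a b m f \<ge> 0"
  unfolding sobolev_norm_def by (auto intro!: sum_nonneg Bochner_Integration.integral_nonneg)

lemma cd_bound_sobolev_norm:
  assumes f: "f \<in> H m" and k: "k < m" and x: "x \<in> {a..b}"
  shows "norm (cd k f x) \<le> emb_const * sobolev_norm a b m f"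
proof -
  have "weak_L1 k f / (b - a) + weak_L1 (Suc k) f \<le> (sqrt (b - a) * sobolev_norm a b m f) / (b - a) + sqrt (b - a) * sobolev_norm a b m f"
    using ab k by (intro add_mono divide_right_mono weak_L1_le_sobolev_norm[OF f]) auto
  also have "\<dots> = emb_const * sobolev_norm a b m f" by (simp add: emb_const_def algebra_simps)
  finally show ?thesis using cd_bound_weak_L1[OF assms] by linarith
qed

end

section \<open>Sobolev-valued functions of time\<close>

lemma has_vector_derivative_within_iff_quotient:
  fixes f :: "real \<Rightarrow> complex"
  shows "(f has_vector_derivative f') (at t within I) \<longleftrightarrow>
    ((\<lambda>s. (f s - f t) / complex_of_real (s - t) - f') \<longlongrightarrow> 0) (at t within I)"
proof -
  have "(f has_vector_derivative f') (at t within I) \<longleftrightarrow>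
      ((\<lambda>s. (1 / norm (s - t)) *\<^sub>R (f s - (f t + (s - t) *\<^sub>R f'))) \<longlongrightarrow> 0) (at t within I)"
    unfolding has_vector_derivative_def has_derivative_within
    by (simp add: bounded_linear_scaleR_left)
  also have "\<dots> \<longleftrightarrow> ((\<lambda>s. norm ((1 / norm (s - t)) *\<^sub>R (f s - (f t + (s - t) *\<^sub>R f')))) \<longlongrightarrow> 0) (at t within I)"
    by (rule tendsto_norm_zero_iff[symmetric])
  also have "\<dots> \<longleftrightarrow> ((\<lambda>s. norm ((f s - f t) / complex_of_real (s - t) - f')) \<longlongrightarrow> 0) (at t within I)"
  proof (rule tendsto_cong)
    have "norm ((1 / norm (s - t)) *\<^sub>R (f s - (f t + (s - t) *\<^sub>R f'))) = norm ((f s - f t) / complex_of_real (s - t) - f')" if "s \<noteq> t" for s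
    proof -
      have "(f s - f t) / complex_of_real (s - t) - f' = (f s - (f t + (s - t) *\<^sub>R f')) / complex_of_real (s - t)"
        using that by (simp add: field_simps scaleR_conv_of_real)
      then show ?thesis by (simp add: norm_divide del: of_real_diff)
    qed
    then show "\<forall>\<^sub>F s in at t within I. norm ((1 / norm (s - t)) *\<^sub>R (f s - (f t + (s - t) *\<^sub>R f'))) = norm ((f s - f t) / complex_of_real (s - t) - f')"
      by (auto simp: eventually_at_filter)
  qed
  also have "\<dots> \<longleftrightarrow> ((\<lambda>s. (f s - f t) / complex_of_real (s - t) - f') \<longlongrightarrow> 0) (at t within I)"
    by (rule tendsto_norm_zero_iff)
  finally show ?thesis .
qed

lemma vector_increment_le:
  fixes f :: "real \<Rightarrow> complex"
  assumes "c \<le> d" and der: "\<And>y. y \<in> {c..d} \<Longrightarrow> (f has_vector_derivative f' y) (at y within {c..d})"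
    and B: "\<And>y. y \<in> {c..d} \<Longrightarrow> norm (f' y) \<le> B"
  shows "norm (f d - f c) \<le> B * (d - c)"
proof -
  have "norm (f d - f c) \<le> B * norm (d - c)"
  proof (rule differentiable_bound[of "{c..d}" f "\<lambda>y h. h *\<^sub>R f' y"])
    show "(f has_derivative (\<lambda>h. h *\<^sub>R f' y)) (at y within {c..d})" if "y \<in> {c..d}" for y
      using der[OF that] by (simp add: has_vector_derivative_def)
    show "onorm (\<lambda>h. h *\<^sub>R f' y) \<le> B" if "y \<in> {c..d}" for y
      using B[OF that] by (intro onorm_bound) (auto intro: order_trans[OF norm_ge_zero] simp: mult.commute[of _ "norm (f' y)"] mult_right_mono)
  qed (use assms in auto)
  then show ?thesis using assms(1) by simp
qed

context bounded_interval
begin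

lemma sobolev_diff: "f \<in> H m \<Longrightarrow> g \<in> H m \<Longrightarrow> (\<lambda>x. f x - g x) \<in> H m"
  using sobolev_linear_combination[of f m g 1 "-1"] by simp

lemma sobolev_scale: "f \<in> H m \<Longrightarrow> (\<lambda>x. c * f x) \<in> H m"
  using sobolev_linear_combination[of f m f c 0] by simp

lemma sobolev_difference_quotient:
  "f \<in> H m \<Longrightarrow> g \<in> H m \<Longrightarrow> h \<in> H m \<Longrightarrow> (\<lambda>x. (f x - g x) / c - h x) \<in> H m"
  using sobolev_diff[OF sobolev_scale[OF sobolev_diff[of f m g], of "1 / c"], of h] by simp

lemma cd_diff: "f \<in> H m \<Longrightarrow> g \<in> H m \<Longrightarrow> k < m \<Longrightarrow> x \<in> {a..b} \<Longrightarrow> cd k (\<lambda>x. f x - g x) x = cd k f x - cd k g x"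
  using cd_linear_combination[of f m g k x 1 "-1"] by simp

lemma cd_difference_quotient:
  assumes "f \<in> H m" "g \<in> H m" "h \<in> H m" "k < m" "x \<in> {a..b}"
  shows "cd k (\<lambda>x. (f x - g x) / c - h x) x = (cd k f x - cd k g x) / c - cd k h x"
proof -
  have "(\<lambda>x. (1 / c) * f x + (- 1 / c) * g x) \<in> H m" by (rule sobolev_linear_combination[OF assms(1,2)])
  then have "cd k (\<lambda>x. 1 * ((1 / c) * f x + (- 1 / c) * g x) + (- 1) * h x) x =
      1 * cd k (\<lambda>x. (1 / c) * f x + (- 1 / c) * g x) x + (- 1) * cd k h x"
    by (rule cd_linear_combination[OF _ assms(3-5)])
  also have "cd k (\<lambda>x. (1 / c) * f x + (- 1 / c) * g x) x = (1 / c) * cd k f x + (- 1 / c) * cd k g x"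
    by (rule cd_linear_combination[OF assms(1,2,4,5)])
  finally show ?thesis by (simp add: diff_divide_distrib)
qed

lemma weak_L1_diff_le: "f \<in> H m \<Longrightarrow> g \<in> H m \<Longrightarrow> k \<le> m \<Longrightarrow> weak_L1 k (\<lambda>x. f x - g x) \<le> weak_L1 k f + weak_L1 k g"
  using weak_L1_linear_combination[of f m g k 1 "-1"] by simp

lemma weak_L1_add_le: "f \<in> H m \<Longrightarrow> g \<in> H m \<Longrightarrow> k \<le> m \<Longrightarrow> weak_L1 k (\<lambda>x. f x + g x) \<le> weak_L1 k f + weak_L1 k g"
  using weak_L1_linear_combination[of f m g k 1 1] by simp

lemma weak_L1_scale_le: "f \<in> H m \<Longrightarrow> k \<le> m \<Longrightarrow> weak_L1 k (\<lambda>x. c * f x) \<le> cmod c * weak_L1 k f"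
  using weak_L1_linear_combination[of f m f k c 0] by simp

text \<open>The mean value inequality for a function of time that is differentiable with respect to a Sobolev norm.
  The inequality with \<open>B + e\<close> is additive over adjacent time intervals and holds locally at each point by
  differentiability, so Bolzano bisection gives it globally.\<close>

lemma weak_L1_increment_le:
  assumes F: "\<And>t. t \<in> {0..T} \<Longrightarrow> F t \<in> H m" and G: "\<And>t. t \<in> {0..T} \<Longrightarrow> G t \<in> H m"
    and der: "sobolev_time_deriv a b m {0..T} F G" and k: "k \<le> m"
    and B: "\<And>t. t \<in> {0..T} \<Longrightarrow> weak_L1 k (G t) \<le> B"
    and st: "0 \<le> s" "s \<le> t" "t \<le> T"
  shows "weak_L1 k (\<lambda>x. F t x - F s x) \<le> B * (t - s)"
proof -
  have main: "weak_L1 k (\<lambda>x. F t x - F s x) \<le> (B + e) * (t - s)" if e: "e > 0" for e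
  proof -
    define P where "P p q \<longleftrightarrow> (0 \<le> p \<and> q \<le> T \<longrightarrow> weak_L1 k (\<lambda>x. F q x - F p x) \<le> (B + e) * (q - p))" for p q
    have "P s t"
      using st(2)
    proof (induction rule: Bolzano)
      case (trans p q r)
      show ?case unfolding P_def
      proof
        assume pr: "0 \<le> p \<and> r \<le> T"
        then have I: "p \<in> {0..T}" "q \<in> {0..T}" "r \<in> {0..T}" using trans by auto
        have "weak_L1 k (\<lambda>x. (F r x - F q x) + (F q x - F p x)) \<le> weak_L1 k (\<lambda>x. F r x - F q x) + weak_L1 k (\<lambda>x. F q x - F p x)"
          by (rule weak_L1_add_le[OF sobolev_diff sobolev_diff k]) (use F I in auto)
        also have "\<dots> \<le> (B + e) * (r - q) + (B + e) * (q - p)"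
          using trans pr unfolding P_def by (intro add_mono) auto
        also have "\<dots> = (B + e) * (r - p)" by (simp add: algebra_simps)
        finally show "weak_L1 k (\<lambda>x. F r x - F p x) \<le> (B + e) * (r - p)" by simp
      qed
    next
      case (local x)
      then have xI: "x \<in> {0..T}" using st by auto
      define e1 where "e1 = e / sqrt (b - a)"
      have "e1 > 0" using e ab by (simp add: e1_def)
      moreover have "((\<lambda>s. sobolev_norm a b m (\<lambda>y. (F s y - F x y) / complex_of_real (s - x) - G x y)) \<longlongrightarrow> 0) (at x within {0..T})"
        using der xI unfolding sobolev_time_deriv_def by blast
      ultimately obtain d where d: "d > 0"
        "\<And>s. s \<in> {0..T} \<Longrightarrow> s \<noteq> x \<Longrightarrow> dist s x < d \<Longrightarrow>
           sobolev_norm a b m (\<lambda>y. (F s y - F x y) / complex_of_real (s - x) - G x y) < e1"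
        unfolding tendsto_iff eventually_at by (force simp: dist_real_def abs_less_iff)
      have near: "weak_L1 k (\<lambda>y. F s y - F x y) \<le> (B + e) * \<bar>s - x\<bar>" if s: "s \<in> {0..T}" "dist s x < d" for s
      proof (cases "s = x")
        case True
        have "weak_L1 k (\<lambda>y. 0 * F x y) \<le> cmod 0 * weak_L1 k (F x)" by (rule weak_L1_scale_le[OF F[OF xI] k])
        then show ?thesis using True by simp
      next
        case False
        let ?q = "\<lambda>y. (F s y - F x y) / complex_of_real (s - x) - G x y"
        have q: "?q \<in> H m" by (intro sobolev_difference_quotient F G xI s)
        have "weak_L1 k ?q \<le> sqrt (b - a) * sobolev_norm a b m ?q" by (rule weak_L1_le_sobolev_norm[OF q k])
        also have "\<dots> \<le> sqrt (b - a) * e1" using d(2)[OF s(1) False s(2)] ab by (intro mult_left_mono) auto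
        also have "\<dots> = e" using ab by (simp add: e1_def)
        finally have qe: "weak_L1 k ?q \<le> e" .
        have "(\<lambda>y. F s y - F x y) = (\<lambda>y. complex_of_real (s - x) * ?q y + complex_of_real (s - x) * G x y)"
        proof -
          have "z = c * (z / c - w) + c * w" if "c \<noteq> 0" for z w c :: complex
            using that by (simp add: right_diff_distrib)
          then show ?thesis using False by (metis eq_iff_diff_eq_0 of_real_eq_0_iff)
        qed
        then have "weak_L1 k (\<lambda>y. F s y - F x y) \<le> cmod (complex_of_real (s - x)) * weak_L1 k ?q + cmod (complex_of_real (s - x)) * weak_L1 k (G x)"
          by (rule ssubst) (rule weak_L1_linear_combination[OF q G[OF xI] k])
        also have "\<dots> \<le> \<bar>s - x\<bar> * e + \<bar>s - x\<bar> * B"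
          unfolding norm_of_real using qe B[OF xI] by (intro add_mono mult_left_mono) auto
        finally show ?thesis by (simp add: algebra_simps)
      qed
      show ?case
      proof (intro exI[of _ d] conjI allI impI d(1))
        fix p q assume pq: "p \<le> x \<and> x \<le> q \<and> q - p < d"
        show "P p q" unfolding P_def
        proof
          assume I: "0 \<le> p \<and> q \<le> T"
          then have I': "p \<in> {0..T}" "q \<in> {0..T}" using pq by auto
          have "weak_L1 k (\<lambda>y. (F q y - F x y) - (F p y - F x y)) \<le> weak_L1 k (\<lambda>y. F q y - F x y) + weak_L1 k (\<lambda>y. F p y - F x y)"
            by (rule weak_L1_diff_le[OF sobolev_diff sobolev_diff k]) (use F I' xI in auto)
          also have "\<dots> \<le> (B + e) * \<bar>q - x\<bar> + (B + e) * \<bar>p - x\<bar>"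
            by (intro add_mono near I') (use pq in \<open>auto simp: dist_real_def\<close>)
          also have "\<dots> = (B + e) * (q - p)" using pq by (simp add: algebra_simps)
          finally show "weak_L1 k (\<lambda>y. F q y - F p y) \<le> (B + e) * (q - p)" by simp
        qed
      qed
    qed
    then show ?thesis using st by (simp add: P_def)
  qed
  show ?thesis
  proof (rule field_le_epsilon)
    fix e :: real assume e: "e > 0"
    have "e / (t - s + 1) * (t - s) \<le> e" using e st by (simp add: field_simps)
    moreover have "weak_L1 k (\<lambda>x. F t x - F s x) \<le> (B + e / (t - s + 1)) * (t - s)"
      by (rule main) (use e st in auto)
    ultimately show "weak_L1 k (\<lambda>x. F t x - F s x) \<le> B * (t - s) + e" by (simp add: algebra_simps)
  qed
qed

lemma cd_has_time_derivative:
  assumes F: "\<And>t. t \<in> I \<Longrightarrow> F t \<in> H m" and G: "\<And>t. t \<in> I \<Longrightarrow> G t \<in> H m"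
    and der: "sobolev_time_deriv a b m I F G" and k: "k < m" and t: "t \<in> I" and x: "x \<in> {a..b}"
  shows "((\<lambda>s. cd k (F s) x) has_vector_derivative cd k (G t) x) (at t within I)"
  unfolding has_vector_derivative_within_iff_quotient
proof (rule Lim_null_comparison)
  have "((\<lambda>s. sobolev_norm a b m (\<lambda>y. (F s y - F t y) / complex_of_real (s - t) - G t y)) \<longlongrightarrow> 0) (at t within I)"
    using der t unfolding sobolev_time_deriv_def by blast
  then show "((\<lambda>s. emb_const * sobolev_norm a b m (\<lambda>y. (F s y - F t y) / complex_of_real (s - t) - G t y)) \<longlongrightarrow> 0) (at t within I)"
    by (rule tendsto_mult_right_zero)
  show "\<forall>\<^sub>F s in at t within I. norm ((cd k (F s) x - cd k (F t) x) / complex_of_real (s - t) - cd k (G t) x)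
      \<le> emb_const * sobolev_norm a b m (\<lambda>y. (F s y - F t y) / complex_of_real (s - t) - G t y)"
    unfolding eventually_at_filter
  proof (intro always_eventually allI impI)
    fix s assume s: "s \<in> I"
    show "norm ((cd k (F s) x - cd k (F t) x) / complex_of_real (s - t) - cd k (G t) x)
      \<le> emb_const * sobolev_norm a b m (\<lambda>y. (F s y - F t y) / complex_of_real (s - t) - G t y)"
      using cd_bound_sobolev_norm[OF sobolev_difference_quotient[OF F[OF s] F[OF t] G[OF t]] k x]
        cd_difference_quotient[OF F[OF s] F[OF t] G[OF t] k x] by metis
  qed
qed

lemma cd_time_continuous_uniform:
  assumes F: "sobolev_continuous a b m I F" and k: "k < m" and t: "t \<in> I" and e: "e > 0"
  shows "\<exists>d>0. \<forall>s\<in>I. \<bar>s - t\<bar> < d \<longrightarrow> (\<forall>x\<in>{a..b}. norm (cd k (F s) x - cd k (F t) x) < e)"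
proof -
  have "((\<lambda>s. sobolev_norm a b m (\<lambda>x. F s x - F t x)) \<longlongrightarrow> 0) (at t within I)"
    using F t unfolding sobolev_continuous_def by blast
  then obtain d where d: "d > 0" "\<And>s. s \<in> I \<Longrightarrow> s \<noteq> t \<Longrightarrow> dist s t < d \<Longrightarrow> sobolev_norm a b m (\<lambda>x. F s x - F t x) < e / emb_const"
    using divide_pos_pos[OF e emb_const_pos] unfolding tendsto_iff eventually_at
    by (force simp: dist_real_def abs_less_iff)
  show ?thesis
  proof (intro exI[of _ d] conjI ballI impI d(1))
    fix s x assume s: "s \<in> I" "\<bar>s - t\<bar> < d" and x: "x \<in> {a..b}"
    show "norm (cd k (F s) x - cd k (F t) x) < e"
    proof (cases "s = t")
      case False
      have Hs: "F s \<in> H m" "F t \<in> H m" using F s t unfolding sobolev_continuous_def by auto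
      have "norm (cd k (F s) x - cd k (F t) x) \<le> emb_const * sobolev_norm a b m (\<lambda>x. F s x - F t x)"
        using cd_bound_sobolev_norm[OF sobolev_diff[OF Hs] k x] cd_diff[OF Hs k x] by simp
      also have "\<dots> < emb_const * (e / emb_const)"
        using d(2)[OF s(1) False] s emb_const_pos by (intro mult_strict_left_mono) (auto simp: dist_real_def)
      finally show ?thesis using emb_const_pos by simp
    qed (use e in auto)
  qed
qed

lemma Linf_sobolev_norm_nonneg:
  assumes "T > 0" shows "Linf_sobolev_norm a b m T v \<ge> 0"
proof -
  have "\<exists>s\<in>{0<..<T}. ereal (sobolev_norm a b m (v s)) \<le> Linf_sobolev_norm a b m T v"
    unfolding Linf_sobolev_norm_def
    by (rule AE_imp_ex_in_open[OF esssup_AE]) (use assms in auto)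
  then obtain s where "ereal (sobolev_norm a b m (v s)) \<le> Linf_sobolev_norm a b m T v" by blast
  then show ?thesis using sobolev_norm_nonneg order_trans[of 0 "ereal (sobolev_norm a b m (v s))"] by auto
qed

text \<open>The essential supremum bounds almost every time, hence a dense set of times; continuity in time gives all.\<close>

lemma weak_L1_le_Linf_sobolev_norm:
  assumes T: "T > 0" and v: "sobolev_continuous a b m {0..T} v" and C: "Linf_sobolev_norm a b m T v \<le> ereal C"
    and k: "k \<le> m" and t: "t \<in> {0..T}"
  shows "weak_L1 k (v t) \<le> sqrt (b - a) * C"
proof -
  have vH: "\<And>t. t \<in> {0..T} \<Longrightarrow> v t \<in> H m" using v unfolding sobolev_continuous_def by auto
  have "weak_L1 k (v t) \<le> sqrt (b - a) * C + e" if e: "e > 0" for e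
  proof -
    define e1 where "e1 = e / sqrt (b - a)"
    have e1: "e1 > 0" using e ab by (simp add: e1_def)
    have "((\<lambda>s. sobolev_norm a b m (\<lambda>x. v s x - v t x)) \<longlongrightarrow> 0) (at t within {0..T})"
      using v t unfolding sobolev_continuous_def by blast
    then obtain d where d: "d > 0" "\<And>s. s \<in> {0..T} \<Longrightarrow> s \<noteq> t \<Longrightarrow> dist s t < d \<Longrightarrow> sobolev_norm a b m (\<lambda>x. v s x - v t x) < e1"
      using e1 unfolding tendsto_iff eventually_at by (force simp: dist_real_def abs_less_iff)
    let ?S = "{max 0 (t - d)<..<min T (t + d)}"
    have "\<exists>s\<in>?S. ereal (sobolev_norm a b m (v s)) \<le> Linf_sobolev_norm a b m T v"
      unfolding Linf_sobolev_norm_def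
      by (rule AE_imp_ex_in_open[OF esssup_AE]) (use T t d in \<open>auto simp: max_def min_def\<close>)
    then obtain s where s: "s \<in> ?S" "ereal (sobolev_norm a b m (v s)) \<le> Linf_sobolev_norm a b m T v" by blast
    have sC: "sobolev_norm a b m (v s) \<le> C" using order_trans[OF s(2) C] by simp
    have sI: "s \<in> {0..T}" and sd: "dist s t < d" using s(1) by (auto simp: dist_real_def abs_less_iff)
    have ws: "weak_L1 k (v s) \<le> sqrt (b - a) * C"
      using weak_L1_le_sobolev_norm[OF vH[OF sI] k] sC ab by (meson mult_left_mono order_trans real_sqrt_ge_zero diff_ge_0_iff_ge less_imp_le)
    show ?thesis
    proof (cases "s = t")
      case False
      have "weak_L1 k (\<lambda>x. v s x - v t x) \<le> sqrt (b - a) * sobolev_norm a b m (\<lambda>x. v s x - v t x)"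
        by (rule weak_L1_le_sobolev_norm[OF sobolev_diff[OF vH[OF sI] vH[OF t]] k])
      also have "\<dots> \<le> sqrt (b - a) * e1" using d(2)[OF sI False sd] ab by (intro mult_left_mono) auto
      also have "\<dots> = e" using ab by (simp add: e1_def)
      finally have 1: "weak_L1 k (\<lambda>x. v s x - v t x) \<le> e" .
      have "weak_L1 k (\<lambda>x. v s x - (v s x - v t x)) \<le> weak_L1 k (v s) + weak_L1 k (\<lambda>x. v s x - v t x)"
        by (rule weak_L1_diff_le[OF vH[OF sI] sobolev_diff[OF vH[OF sI] vH[OF t]] k])
      then show ?thesis using ws 1 by simp
    qed (use ws e in auto)
  qed
  then show ?thesis by (rule field_le_epsilon)
qed

lemma continuous_imp_L2_space:
  assumes "continuous_on {a..b} g" shows "g \<in> L2_space a b"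
proof -
  have "g \<in> borel_measurable \<mu>"
    using assms by (intro continuous_imp_measurable_on_sets_lebesgue) (auto intro: continuous_on_subset)
  moreover have "(\<lambda>x. (cmod (g x))\<^sup>2) absolutely_integrable_on {a<..<b}"
    unfolding absolutely_integrable_on_Icc_iff_Ioo[symmetric]
    by (intro absolutely_integrable_continuous_real continuous_intros assms)
  then have "integrable \<mu> (\<lambda>x. (cmod (g x))\<^sup>2)" by (rule absolutely_integrable_imp_integrable) auto
  ultimately show ?thesis by (simp add: L2_space_def)
qed

lemma test_pairing_bound:
  assumes g: "g \<in> H m" and t: "test_function a b \<phi>" and B: "B \<ge> 0" "\<And>x. \<bar>\<phi> x\<bar> \<le> B"
  shows "norm (LINT x|\<mu>. complex_of_real (\<phi> x) * g x) \<le> B * weak_L1 0 g"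
proof -
  have gL: "g \<in> L2_space a b" by (rule sobolev_imp_L2[OF g])
  have ng: "(\<lambda>x. norm (g x)) integrable_on {a..b}"
    using L2_space_absolutely_integrable[OF gL] by (simp add: absolutely_integrable_on_def)
  have "is_weak_deriv a b 0 g g" by (simp add: is_weak_deriv_def)
  then have "AE x in \<mu>. wd 0 g x = g x"
    using is_weak_deriv_unique[OF weak_deriv_spec(2)[OF g] _ weak_deriv_spec(1)[OF g] gL] by auto
  then have w: "weak_L1 0 g = integral {a..b} (\<lambda>x. norm (g x))"
    unfolding weak_L1_def by (intro HK_integral_cong_AE) (auto elim!: eventually_mono)
  note i = test_mult_has_integral(1)[OF gL t]
  have "norm (integral {a..b} (\<lambda>x. complex_of_real (\<phi> x) * g x)) \<le> integral {a..b} (\<lambda>x. B * norm (g x))"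
    by (rule integral_norm_bound_integral[OF has_integral_integrable[OF i] integrable_on_mult_right[OF ng]])
      (auto simp: norm_mult intro!: mult_right_mono B)
  then show ?thesis using i w by (simp add: integral_unique)
qed

lemma test_pairing_has_time_derivative:
  assumes F: "\<And>t. t \<in> I \<Longrightarrow> F t \<in> H m" and G: "\<And>t. t \<in> I \<Longrightarrow> G t \<in> H m"
    and der: "sobolev_time_deriv a b m I F G" and t: "t \<in> I" and \<phi>: "test_function a b \<phi>"
  shows "((\<lambda>s. LINT x|\<mu>. complex_of_real (\<phi> x) * F s x) has_vector_derivative (LINT x|\<mu>. complex_of_real (\<phi> x) * G t x)) (at t within I)"
proof -
  obtain B where B: "B \<ge> 0" "\<And>x. \<bar>\<phi> x\<bar> \<le> B" using test_function_bounded[OF \<phi>] by blast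
  show ?thesis
  unfolding has_vector_derivative_within_iff_quotient
proof (rule Lim_null_comparison)
  have "((\<lambda>s. sobolev_norm a b m (\<lambda>y. (F s y - F t y) / complex_of_real (s - t) - G t y)) \<longlongrightarrow> 0) (at t within I)"
    using der t unfolding sobolev_time_deriv_def by blast
  then show "((\<lambda>s. B * sqrt (b - a) * sobolev_norm a b m (\<lambda>y. (F s y - F t y) / complex_of_real (s - t) - G t y)) \<longlongrightarrow> 0) (at t within I)"
    by (rule tendsto_mult_right_zero)
  show "\<forall>\<^sub>F s in at t within I. norm (((LINT x|\<mu>. complex_of_real (\<phi> x) * F s x) - (LINT x|\<mu>. complex_of_real (\<phi> x) * F t x)) / complex_of_real (s - t) - (LINT x|\<mu>. complex_of_real (\<phi> x) * G t x))
      \<le> B * sqrt (b - a) * sobolev_norm a b m (\<lambda>y. (F s y - F t y) / complex_of_real (s - t) - G t y)"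
    unfolding eventually_at_filter
  proof (intro always_eventually allI impI)
    fix s assume s: "s \<in> I"
    let ?q = "\<lambda>y. (F s y - F t y) / complex_of_real (s - t) - G t y"
    have q: "?q \<in> H m" by (intro sobolev_difference_quotient F G s t)
    have 1: "integrable \<mu> (\<lambda>x. complex_of_real (\<phi> x) * F s x)" "integrable \<mu> (\<lambda>x. complex_of_real (\<phi> x) * F t x)"
      "integrable \<mu> (\<lambda>x. complex_of_real (\<phi> x) * G t x)"
      using test_mult_has_integral(2)[OF sobolev_imp_L2 \<phi>] F G s t by auto
    have "((LINT x|\<mu>. complex_of_real (\<phi> x) * F s x) - (LINT x|\<mu>. complex_of_real (\<phi> x) * F t x)) / complex_of_real (s - t) - (LINT x|\<mu>. complex_of_real (\<phi> x) * G t x)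
      = (LINT x|\<mu>. (complex_of_real (\<phi> x) * F s x - complex_of_real (\<phi> x) * F t x) / complex_of_real (s - t) - complex_of_real (\<phi> x) * G t x)"
      using 1 by simp
    also have "\<dots> = (LINT x|\<mu>. complex_of_real (\<phi> x) * ?q x)"
      by (intro Bochner_Integration.integral_cong) (auto simp: algebra_simps diff_divide_distrib)
    also have "norm \<dots> \<le> B * weak_L1 0 ?q" by (rule test_pairing_bound[OF q \<phi> B])
    also have "\<dots> \<le> B * (sqrt (b - a) * sobolev_norm a b m ?q)"
      by (intro mult_left_mono weak_L1_le_sobolev_norm[OF q] B) auto
    finally show "norm (((LINT x|\<mu>. complex_of_real (\<phi> x) * F s x) - (LINT x|\<mu>. complex_of_real (\<phi> x) * F t x)) / complex_of_real (s - t) - (LINT x|\<mu>. complex_of_real (\<phi> x) * G t x))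
      \<le> B * sqrt (b - a) * sobolev_norm a b m ?q" by (simp add: mult.assoc)
  qed
qed
qed

lemma cd_time_continuous_on:
  assumes F: "sobolev_continuous a b m I F" and k: "k < m" and x: "x \<in> {a..b}"
  shows "continuous_on I (\<lambda>s. cd k (F s) x)"
  unfolding continuous_on_iff dist_norm
  using cd_time_continuous_uniform[OF F k] x by (metis real_norm_def)

end

section \<open>Classical regularity of the solution\<close>

text \<open>Bounds the \<open>L\<^sup>1\<close> norms of the weak derivatives of the solution and its first three time derivatives;
  the terms with \<open>T\<close> and \<open>1 / T\<close> come from the first time derivative. It does not depend on \<open>\<epsilon>\<close>.\<close>

definition weak_L1_const :: "real \<Rightarrow> real \<Rightarrow> real \<Rightarrow> real \<Rightarrow> real" where
  "weak_L1_const a b C0 T = sqrt (b - a) * (C0 + C0 * T + 2 * C0 / T)"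

definition sup_const :: "real \<Rightarrow> real \<Rightarrow> real \<Rightarrow> real \<Rightarrow> real" where
  "sup_const a b C0 T = weak_L1_const a b C0 T / (b - a) + weak_L1_const a b C0 T"

locale log_evolution = bounded_interval a b for a b :: real +
  fixes T C0 \<epsilon> :: real and S :: ereal and u0 :: "real \<Rightarrow> complex" and u :: "real \<Rightarrow> real \<Rightarrow> complex"
    and D :: "nat \<Rightarrow> real \<Rightarrow> real \<Rightarrow> complex"
  assumes T: "0 < T" and C0: "0 < C0" and eps: "0 < \<epsilon>"
    and sol: "RLogSE_solution a b \<epsilon> u0 S u" and TS: "ereal T < S" and D0: "D 0 = u"
    and Cn5: "sobolev_Cn a b 0 5 {0..T} D" and Cn4: "sobolev_Cn a b 2 4 {0..T} D" and Cn2: "sobolev_Cn a b 3 2 {0..T} D"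
    and bound: "Linf_sobolev_norm a b 5 T (D 0) + Linf_sobolev_norm a b 4 T (D 2) + Linf_sobolev_norm a b 2 T (D 3) \<le> ereal C0"
begin

lemma D_continuous:
  "sobolev_continuous a b 5 {0..T} (D 0)"
  "j \<le> 2 \<Longrightarrow> sobolev_continuous a b 4 {0..T} (D j)"
  "j \<le> 3 \<Longrightarrow> sobolev_continuous a b 2 {0..T} (D j)"
  using Cn5 Cn4 Cn2 by (auto simp: sobolev_Cn_def)

lemma D_time_deriv:
  "j < 2 \<Longrightarrow> sobolev_time_deriv a b 4 {0..T} (D j) (D (Suc j))"
  "j < 3 \<Longrightarrow> sobolev_time_deriv a b 2 {0..T} (D j) (D (Suc j))"
  using Cn4 Cn2 by (auto simp: sobolev_Cn_def)

lemma D_in_sobolev: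
  "t \<in> {0..T} \<Longrightarrow> D 0 t \<in> H 5"
  "j \<le> 2 \<Longrightarrow> t \<in> {0..T} \<Longrightarrow> D j t \<in> H 4"
  "j \<le> 3 \<Longrightarrow> t \<in> {0..T} \<Longrightarrow> D j t \<in> H 2"
  using D_continuous by (auto simp: sobolev_continuous_def)

abbreviation KB :: real where "KB \<equiv> weak_L1_const a b C0 T"

lemma KB_ge: "sqrt (b - a) * C0 \<le> KB" "0 < KB"
proof -
  have "0 \<le> C0 * T + 2 * C0 / T" using T C0 by simp
  then show "sqrt (b - a) * C0 \<le> KB" unfolding weak_L1_const_def using ab by (intro mult_left_mono) auto
  moreover have "0 < sqrt (b - a) * C0" using ab C0 by simp
  ultimately show "0 < KB" by linarith
qed

lemma Linf_le:
  "Linf_sobolev_norm a b 5 T (D 0) \<le> ereal C0" "Linf_sobolev_norm a b 4 T (D 2) \<le> ereal C0"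
  "Linf_sobolev_norm a b 2 T (D 3) \<le> ereal C0"
proof -
  let ?x = "Linf_sobolev_norm a b 5 T (D 0)" and ?y = "Linf_sobolev_norm a b 4 T (D 2)" and ?z = "Linf_sobolev_norm a b 2 T (D 3)"
  have nn: "0 \<le> ?x" "0 \<le> ?y" "0 \<le> ?z" using Linf_sobolev_norm_nonneg[OF T] by auto
  have "?x \<le> ?x + (?y + ?z)" "?y \<le> ?y + (?x + ?z)" "?z \<le> ?z + (?x + ?y)"
    using nn by (auto intro!: add_increasing2 add_nonneg_nonneg)
  then show "?x \<le> ereal C0" "?y \<le> ereal C0" "?z \<le> ereal C0"
    using bound by (simp_all add: ac_simps)
qed

lemma weak_L1_D_bounds:
  assumes t: "t \<in> {0..T}"
  shows "k \<le> 4 \<Longrightarrow> weak_L1 k (D 0 t) \<le> sqrt (b - a) * C0"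
    "k \<le> 4 \<Longrightarrow> weak_L1 k (D 2 t) \<le> sqrt (b - a) * C0"
    "k \<le> 2 \<Longrightarrow> weak_L1 k (D 3 t) \<le> sqrt (b - a) * C0"
  using weak_L1_le_Linf_sobolev_norm[OF T D_continuous(1) Linf_le(1), of k t]
    weak_L1_le_Linf_sobolev_norm[OF T D_continuous(2) Linf_le(2), of k t]
    weak_L1_le_Linf_sobolev_norm[OF T D_continuous(3) Linf_le(3), of k t] t by auto

text \<open>Interpolation in time: \<open>D 1\<close> varies by at most \<open>B T\<close>, because \<open>D 2\<close> is bounded by \<open>B\<close>. Hence \<open>T\<close> times \<open>D 1 t\<close> differs from
  \<open>D 0 T - D 0 0\<close> by at most \<open>B T\<^sup>2\<close>, and the latter is at most \<open>2 B\<close>.\<close>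

lemma weak_L1_D1_bound:
  assumes t: "t \<in> {0..T}" and k: "k \<le> 4"
  shows "weak_L1 k (D 1 t) \<le> KB"
proof -
  define B where "B = sqrt (b - a) * C0"
  have B: "B > 0" using ab C0 by (simp add: B_def)
  have D1: "D (Suc 0) r \<in> H 4" "D 0 r \<in> H 4" if "r \<in> {0..T}" for r using D_in_sobolev(2) that by auto
  have d2: "weak_L1 k (\<lambda>x. D 1 r x - D 1 t x) \<le> B * T" if r: "r \<in> {0..T}" for r
  proof -
    have inc: "weak_L1 k (\<lambda>x. D 1 q x - D 1 p x) \<le> B * (q - p)" if "0 \<le> p" "p \<le> q" "q \<le> T" for p q
    proof (rule weak_L1_increment_le[where G = "D 2" and m = 4 and T = T])
      show "sobolev_time_deriv a b 4 {0..T} (D 1) (D 2)" using D_time_deriv(1)[of 1] by (simp add: numeral_2_eq_2)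
    qed (use that k D_in_sobolev(2)[of 1] D_in_sobolev(2)[of 2] weak_L1_D_bounds(2) in \<open>auto simp: B_def\<close>)
    show ?thesis
    proof (cases "t \<le> r")
      case True
      then show ?thesis using order_trans[OF inc[of t r] mult_left_mono[of "r - t" T B]] B r t by auto
    next
      case False
      have "weak_L1 k (\<lambda>x. (-1) * (D 1 t x - D 1 r x)) \<le> cmod (-1) * weak_L1 k (\<lambda>x. D 1 t x - D 1 r x)"
        by (rule weak_L1_scale_le[OF sobolev_diff k]) (use D1 r t in auto)
      then show ?thesis using order_trans[OF inc[of r t] mult_left_mono[of "t - r" T B]] B r t False by auto
    qed
  qed
  \<comment> \<open>the time derivative of \<open>G\<close> is \<open>D 1 s - D 1 t\<close>, which is small\<close>
  define G where "G s x = D 0 s x - complex_of_real s * D 1 t x" for s x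
  have GH: "G s \<in> H 4" if "s \<in> {0..T}" for s
    unfolding G_def by (intro sobolev_diff sobolev_scale) (use D1 t that in auto)
  have "weak_L1 k (\<lambda>x. G T x - G 0 x) \<le> B * T * (T - 0)"
  proof (rule weak_L1_increment_le[where G = "\<lambda>s x. D 1 s x - D 1 t x" and m = 4 and T = T])
    show "sobolev_time_deriv a b 4 {0..T} G (\<lambda>s x. D 1 s x - D 1 t x)"
      unfolding sobolev_time_deriv_def
    proof
      fix r assume r: "r \<in> {0..T}"
      have "((\<lambda>s. sobolev_norm a b 4 (\<lambda>x. (D 0 s x - D 0 r x) / complex_of_real (s - r) - D 1 r x)) \<longlongrightarrow> 0) (at r within {0..T})"
        using D_time_deriv(1)[of 0] r unfolding sobolev_time_deriv_def by auto
      moreover have "(\<lambda>x. (G s x - G r x) / complex_of_real (s - r) - (D 1 r x - D 1 t x)) = (\<lambda>x. (D 0 s x - D 0 r x) / complex_of_real (s - r) - D 1 r x)"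
        if "s \<noteq> r" for s
      proof
        fix x
        have "G s x - G r x = (D 0 s x - D 0 r x) - complex_of_real (s - r) * D 1 t x" by (simp add: G_def algebra_simps)
        then have "(G s x - G r x) / complex_of_real (s - r) = (D 0 s x - D 0 r x) / complex_of_real (s - r) - D 1 t x"
          using that by (simp add: diff_divide_distrib del: of_real_diff)
        then show "(G s x - G r x) / complex_of_real (s - r) - (D 1 r x - D 1 t x) = (D 0 s x - D 0 r x) / complex_of_real (s - r) - D 1 r x"
          by simp
      qed
      ultimately show "((\<lambda>s. sobolev_norm a b 4 (\<lambda>x. (G s x - G r x) / complex_of_real (s - r) - (D 1 r x - D 1 t x))) \<longlongrightarrow> 0) (at r within {0..T})"
        by (elim Lim_transform_eventually) (auto simp: eventually_at_filter)
    qed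
    show "(\<lambda>x. D 1 s x - D 1 t x) \<in> H 4" if "s \<in> {0..T}" for s
      by (intro sobolev_diff) (use D1 t that in auto)
  qed (use GH d2 k T in auto)
  then have GT: "weak_L1 k (\<lambda>x. G T x - G 0 x) \<le> B * T\<^sup>2" by (simp add: power2_eq_square)
  have "weak_L1 k (\<lambda>x. D 0 T x - D 0 0 x) \<le> weak_L1 k (D 0 T) + weak_L1 k (D 0 0)"
    by (rule weak_L1_diff_le[OF _ _ k]) (use D1 T in auto)
  also have "\<dots> \<le> B + B" using weak_L1_D_bounds(1)[of T k] weak_L1_D_bounds(1)[of 0 k] T k unfolding B_def by (intro add_mono) auto
  finally have D0T: "weak_L1 k (\<lambda>x. D 0 T x - D 0 0 x) \<le> 2 * B" by simp
  have "weak_L1 k (\<lambda>x. (D 0 T x - D 0 0 x) - (G T x - G 0 x)) \<le> 2 * B + B * T\<^sup>2"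
    by (rule order_trans[OF weak_L1_diff_le[OF sobolev_diff sobolev_diff k]]) (use D1 GH T D0T GT in auto)
  moreover have "(\<lambda>x. D 1 t x) = (\<lambda>x. complex_of_real (1 / T) * ((D 0 T x - D 0 0 x) - (G T x - G 0 x)))"
    using T by (auto simp: G_def)
  moreover have "weak_L1 k (\<lambda>x. complex_of_real (1 / T) * ((D 0 T x - D 0 0 x) - (G T x - G 0 x))) \<le>
      cmod (complex_of_real (1 / T)) * weak_L1 k (\<lambda>x. (D 0 T x - D 0 0 x) - (G T x - G 0 x))"
    by (rule weak_L1_scale_le[OF sobolev_diff[OF sobolev_diff sobolev_diff] k]) (use D1 GH T in auto)
  ultimately have "weak_L1 k (D 1 t) \<le> 1 / T * (2 * B + B * T\<^sup>2)"
    using T by (auto simp: norm_divide intro: order_trans[OF _ divide_right_mono])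
  also have "\<dots> = B * (C0 * T + 2 * C0 / T) / C0" using T C0 by (simp add: field_simps power2_eq_square)
  also have "\<dots> \<le> KB" using T C0 ab by (simp add: weak_L1_const_def B_def field_simps)
  finally show ?thesis .
qed

lemma weak_L1_bounds:
  assumes t: "t \<in> {0..T}"
  shows "j \<le> 2 \<Longrightarrow> k \<le> 4 \<Longrightarrow> weak_L1 k (D j t) \<le> KB" "j \<le> 3 \<Longrightarrow> k \<le> 2 \<Longrightarrow> weak_L1 k (D j t) \<le> KB"
proof -
  show 1: "weak_L1 k (D j t) \<le> KB" if "j \<le> 2" "k \<le> 4" for j k
  proof -
    have "j = 0 \<or> j = 1 \<or> j = 2" using that by auto
    then show ?thesis using weak_L1_D_bounds(1,2)[OF t that(2)] weak_L1_D1_bound[OF t that(2)] KB_ge by auto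
  qed
  show "weak_L1 k (D j t) \<le> KB" if "j \<le> 3" "k \<le> 2" for j k
  proof (cases "j = 3")
    case True then show ?thesis using weak_L1_D_bounds(3)[OF t that(2)] KB_ge by auto
  qed (use 1[of j k] that in auto)
qed

text \<open>The mixed derivative of the solution, \<open>j\<close> times in \<open>t\<close> and \<open>i\<close> times in \<open>x\<close>.\<close>

definition fd :: "nat \<Rightarrow> nat \<Rightarrow> real \<Rightarrow> real \<Rightarrow> complex" where "fd j i t x = cd i (D j t) x"

abbreviation KF :: real where "KF \<equiv> sup_const a b C0 T"

lemma KF_pos: "KF > 0" using KB_ge ab by (auto simp: sup_const_def intro: add_pos_pos)

lemma fd_bound:
  assumes t: "t \<in> {0..T}" and x: "x \<in> {a..b}"
  shows "j \<le> 2 \<Longrightarrow> i \<le> 3 \<Longrightarrow> norm (fd j i t x) \<le> KF" "j \<le> 3 \<Longrightarrow> i \<le> 1 \<Longrightarrow> norm (fd j i t x) \<le> KF"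
proof -
  have *: "norm (fd j i t x) \<le> KF" if "D j t \<in> H m" "i < m" "weak_L1 i (D j t) \<le> KB" "weak_L1 (Suc i) (D j t) \<le> KB" for m i j
    unfolding fd_def sup_const_def
    by (rule order_trans[OF cd_bound_weak_L1[OF that(1,2) x]]) (use that ab in \<open>auto intro!: add_mono divide_right_mono\<close>)
  show "norm (fd j i t x) \<le> KF" if "j \<le> 2" "i \<le> 3"
    by (rule *[of _ 4]) (use that t D_in_sobolev(2) weak_L1_bounds(1)[OF t] in auto)
  show "norm (fd j i t x) \<le> KF" if "j \<le> 3" "i \<le> 1"
    by (rule *[of _ 2]) (use that t D_in_sobolev(3) weak_L1_bounds(2)[OF t] in auto)
qed

lemma fd_space_deriv:
  assumes t: "t \<in> {0..T}" and x: "x \<in> {a..b}"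
  shows "j \<le> 2 \<Longrightarrow> i \<le> 2 \<Longrightarrow> (fd j i t has_vector_derivative fd j (Suc i) t x) (at x within {a..b})"
    "j \<le> 3 \<Longrightarrow> i = 0 \<Longrightarrow> (fd j i t has_vector_derivative fd j (Suc i) t x) (at x within {a..b})"
  using cd_has_vector_derivative[OF D_in_sobolev(2)[of j t], of i x] cd_has_vector_derivative[OF D_in_sobolev(3)[of j t], of i x] t x
  unfolding fd_def[abs_def] by auto

lemma fd_time_deriv:
  assumes t: "t \<in> {0..T}" and x: "x \<in> {a..b}"
  shows "j \<le> 1 \<Longrightarrow> i \<le> 3 \<Longrightarrow> ((\<lambda>s. fd j i s x) has_vector_derivative fd (Suc j) i t x) (at t within {0..T})"
    "j \<le> 2 \<Longrightarrow> i \<le> 1 \<Longrightarrow> ((\<lambda>s. fd j i s x) has_vector_derivative fd (Suc j) i t x) (at t within {0..T})"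
  unfolding fd_def
proof -
  show "((\<lambda>s. cd i (D j s) x) has_vector_derivative cd i (D (Suc j) t) x) (at t within {0..T})" if "j \<le> 1" "i \<le> 3"
    by (rule cd_has_time_derivative[where m = 4]) (use that t x D_in_sobolev(2) D_time_deriv(1) in auto)
  show "((\<lambda>s. cd i (D j s) x) has_vector_derivative cd i (D (Suc j) t) x) (at t within {0..T})" if "j \<le> 2" "i \<le> 1"
    by (rule cd_has_time_derivative[where m = 2]) (use that t x D_in_sobolev(3) D_time_deriv(2) in auto)
qed

lemma solution_continuous_vanishing_at_ends:
  assumes t: "t \<in> {0..T}"
  shows "continuous_on {a..b} (u t)" "u t a = 0" "u t b = 0"
proof -
  have "ereal t < S" using TS t by (metis atLeastAtMost_iff ereal_less_eq(3) order_le_less_trans)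
  then show "continuous_on {a..b} (u t)" "u t a = 0" "u t b = 0"
    using sol t by (auto simp: RLogSE_solution_def)
qed

lemma u_eq_fd: "t \<in> {0..T} \<Longrightarrow> x \<in> {a..b} \<Longrightarrow> fd 0 0 t x = u t x"
  unfolding fd_def using cd_0_eq[OF D_in_sobolev(1), of t x] D0 solution_continuous_vanishing_at_ends(1) by auto

lemma initial_value: "x \<in> {a..b} \<Longrightarrow> u 0 x = u0 x"
  using sol by (auto simp: RLogSE_solution_def)

lemma log_nonlin_continuous_on: "continuous_on A g \<Longrightarrow> continuous_on A (\<lambda>x. log_nonlin \<epsilon> (g x))"
  unfolding log_nonlin_def
  by (intro continuous_intros) (use eps in \<open>auto simp: add_nonneg_eq_0_iff\<close>)

text \<open>Pairing with a test function is differentiable in time with derivative the pairing with \<open>D 1\<close>, so the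
  distributional equation becomes an identity of pairings; it holds almost everywhere, and everywhere by continuity.\<close>

lemma pde_interior:
  assumes t: "0 < t" "t < T" and x: "x \<in> {a..b}"
  shows "\<i> * fd 1 0 t x + fd 0 2 t x = log_nonlin \<epsilon> (u t x)"
proof -
  have tI: "t \<in> {0..T}" using t by auto
  have tS: "ereal t < S" using TS t by (metis ereal_less_eq(3) less_imp_le order_le_less_trans)
  have cu: "continuous_on {a..b} (\<lambda>x. log_nonlin \<epsilon> (u t x))"
    by (intro log_nonlin_continuous_on solution_continuous_vanishing_at_ends tI)
  have L2: "D 1 t \<in> L2_space a b" "wd 2 (u t) \<in> L2_space a b" "(\<lambda>x. log_nonlin \<epsilon> (u t x)) \<in> L2_space a b" "u t \<in> L2_space a b"
    using sobolev_imp_L2[OF D_in_sobolev(2)[of 1 t]] weak_deriv_spec(1)[OF D_in_sobolev(1)[OF tI]] D0 tI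
      continuous_imp_L2_space[OF cu] sobolev_imp_L2[OF D_in_sobolev(1)[OF tI]] by auto
  have "AE x in \<mu>. \<i> * D 1 t x + 1 * wd 2 (u t) x = log_nonlin \<epsilon> (u t x)"
  proof (rule AE_eqI_test_functions[OF L2_space_linear_combination[OF L2(1,2)] L2(3)])
    fix \<phi> assume \<phi>: "test_function a b \<phi>"
    obtain d where d: "((\<lambda>s. LINT x|\<mu>. complex_of_real (\<phi> x) * u s x) has_vector_derivative d) (at t)"
      and eq: "\<i> * d + (LINT x|\<mu>. complex_of_real ((deriv ^^ 2) \<phi> x) * u t x) = (LINT x|\<mu>. complex_of_real (\<phi> x) * log_nonlin \<epsilon> (u t x))"
      using sol \<phi> t tS unfolding RLogSE_solution_def by blast
    have "((\<lambda>s. LINT x|\<mu>. complex_of_real (\<phi> x) * D 0 s x) has_vector_derivative (LINT x|\<mu>. complex_of_real (\<phi> x) * D (Suc 0) t x)) (at t within {0..T})"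
      by (rule test_pairing_has_time_derivative[where m = 4]) (use \<phi> tI D_in_sobolev(2) D_time_deriv(1)[of 0] in auto)
    then have "((\<lambda>s. LINT x|\<mu>. complex_of_real (\<phi> x) * u s x) has_vector_derivative (LINT x|\<mu>. complex_of_real (\<phi> x) * D 1 t x)) (at t)"
      unfolding D0 using at_within_interior[of t "{0..T}"] t by simp
    then have dd: "d = (LINT x|\<mu>. complex_of_real (\<phi> x) * D 1 t x)"
      using d vector_derivative_unique_at by blast
    have "is_weak_deriv a b 2 (u t) (wd 2 (u t))" using weak_deriv_spec(2)[OF D_in_sobolev(1)[OF tI], of 2] D0 by simp
    then have w2: "(LINT x|\<mu>. complex_of_real ((deriv ^^ 2) \<phi> x) * u t x) = (LINT x|\<mu>. complex_of_real (\<phi> x) * wd 2 (u t) x)"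
      using \<phi> unfolding is_weak_deriv_def by simp
    have "(LINT x|\<mu>. complex_of_real (\<phi> x) * (\<i> * D 1 t x + 1 * wd 2 (u t) x)) =
        (LINT x|\<mu>. \<i> * (complex_of_real (\<phi> x) * D 1 t x) + complex_of_real (\<phi> x) * wd 2 (u t) x)"
      by (simp add: algebra_simps)
    also have "\<dots> = \<i> * (LINT x|\<mu>. complex_of_real (\<phi> x) * D 1 t x) + (LINT x|\<mu>. complex_of_real (\<phi> x) * wd 2 (u t) x)"
      using test_mult_has_integral(2)[OF L2(1) \<phi>] test_mult_has_integral(2)[OF L2(2) \<phi>] by simp
    finally show "(LINT x|\<mu>. complex_of_real (\<phi> x) * (\<i> * D 1 t x + 1 * wd 2 (u t) x)) = (LINT x|\<mu>. complex_of_real (\<phi> x) * log_nonlin \<epsilon> (u t x))"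
      using eq dd w2 by simp
  qed
  moreover have "AE x in \<mu>. cd 0 (D 1 t) x = D 1 t x"
  proof -
    have D1: "D 1 t \<in> H 4" using D_in_sobolev(2)[of 1 t] tI by simp
    have "is_weak_deriv a b 0 (D 1 t) (D 1 t)" by (simp add: is_weak_deriv_def)
    then have "AE x in \<mu>. wd 0 (D 1 t) x = D 1 t x"
      using is_weak_deriv_unique[OF weak_deriv_spec(2)[OF D1, of 0] _ weak_deriv_spec(1)[OF D1, of 0] L2(1)] by auto
    moreover have "AE x in \<mu>. cd 0 (D 1 t) x = wd 0 (D 1 t) x" using cd_spec(2)[OF D1, of 0] by simp
    ultimately show ?thesis by eventually_elim simp
  qed
  moreover have "AE x in \<mu>. cd 2 (u t) x = wd 2 (u t) x"
    using cd_spec(2)[OF D_in_sobolev(1)[OF tI], of 2] D0 by simp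
  ultimately have AE: "AE x in \<mu>. \<i> * fd 1 0 t x + fd 0 2 t x = log_nonlin \<epsilon> (u t x)"
    unfolding fd_def D0 by eventually_elim simp
  show ?thesis
  proof (rule continuous_AE_eq_imp_eq[OF _ cu AE x])
    have "continuous_on {a..b} (fd 1 0 t)" "continuous_on {a..b} (fd 0 2 t)"
      unfolding fd_def[abs_def] using cd_spec(1)[OF D_in_sobolev(2)[of 1 t], of 0] cd_spec(1)[OF D_in_sobolev(2)[of 0 t], of 2] tI by auto
    then show "continuous_on {a..b} (\<lambda>x. \<i> * fd 1 0 t x + fd 0 2 t x)" by (intro continuous_intros)
  qed
qed

lemma fd_time_continuous: "j \<le> 2 \<Longrightarrow> i < 4 \<Longrightarrow> x \<in> {a..b} \<Longrightarrow> continuous_on {0..T} (\<lambda>s. fd j i s x)"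
  unfolding fd_def by (rule cd_time_continuous_on[OF D_continuous(2)]) auto

lemma pde:
  assumes t: "t \<in> {0..T}" and x: "x \<in> {a..b}"
  shows "\<i> * fd 1 0 t x + fd 0 2 t x = log_nonlin \<epsilon> (u t x)"
proof -
  have cl: "closure {0<..<T} = {0..T}" using T by simp
  have "\<i> * fd 1 0 t x + fd 0 2 t x - log_nonlin \<epsilon> (fd 0 0 t x) = 0"
  proof (rule continuous_constant_on_closure[where S = "{0<..<T}" and x = t and a = 0 and
        f = "\<lambda>s. \<i> * fd 1 0 s x + fd 0 2 s x - log_nonlin \<epsilon> (fd 0 0 s x)"])
    show "continuous_on (closure {0<..<T}) (\<lambda>s. \<i> * fd 1 0 s x + fd 0 2 s x - log_nonlin \<epsilon> (fd 0 0 s x))"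
      unfolding cl by (intro continuous_intros log_nonlin_continuous_on fd_time_continuous x) auto
    show "t \<in> closure {0<..<T}" using t cl by simp
    show "\<i> * fd 1 0 s x + fd 0 2 s x - log_nonlin \<epsilon> (fd 0 0 s x) = 0" if "s \<in> {0<..<T}" for s
      using pde_interior[of s x] u_eq_fd[of s x] that x by auto
  qed
  then show ?thesis using u_eq_fd[OF t x] by simp
qed

text \<open>The second space derivative vanishes at the end points by the equation, since the solution and
  its time derivative do. This makes the time part of the residual compatible with the boundary conditions.\<close>

lemma fd_boundary:
  assumes t: "t \<in> {0..T}" and x: "x = a \<or> x = b"
  shows "fd 0 0 t x = 0" "fd 1 0 t x = 0" "fd 0 2 t x = 0"
proof -
  have xI: "x \<in> {a..b}" using x ab by auto
  have z: "fd 0 0 s x = 0" if "s \<in> {0..T}" for s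
    using u_eq_fd[OF that xI] solution_continuous_vanishing_at_ends(2,3)[OF that] x by auto
  show "fd 0 0 t x = 0" by (rule z[OF t])
  have "((\<lambda>s. fd 0 0 s x) has_vector_derivative fd (Suc 0) 0 t x) (at t within {0..T})"
    by (rule fd_time_deriv(1)[OF t xI]) auto
  moreover have "((\<lambda>s. fd 0 0 s x) has_vector_derivative 0) (at t within {0..T})"
    by (rule has_vector_derivative_transform[OF t z has_vector_derivative_const]) auto
  ultimately show d: "fd 1 0 t x = 0"
    using vector_derivative_unique_within_closed_interval[of 0 T t] T t by auto
  show "fd 0 2 t x = 0" using pde[OF t xI] d z[OF t] u_eq_fd[OF t xI] by (simp add: log_nonlin_def)
qed

lemma initial_velocity_eq:
  assumes x: "x \<in> {a..b}" shows "initial_velocity a b \<epsilon> u0 x = fd 1 0 0 x"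
proof -
  have t0: "0 \<in> {0..T}" using T by auto
  have u0: "u0 y = fd 0 0 0 y" if "y \<in> {a..b}" for y
    using u_eq_fd[OF t0 that] initial_value[OF that] by simp
  have v1: "vector_derivative u0 (at y within {a..b}) = fd 0 1 0 y" if y: "y \<in> {a..b}" for y
  proof -
    have "(fd 0 0 0 has_vector_derivative fd 0 (Suc 0) 0 y) (at y within {a..b})"
      by (rule fd_space_deriv(1)[OF t0 y]) auto
    then have "(u0 has_vector_derivative fd 0 1 0 y) (at y within {a..b})"
      by (intro has_vector_derivative_transform[OF y, where f = "fd 0 0 0" and g = u0]) (auto simp: u0)
    then show ?thesis by (rule vector_derivative_within_closed_interval[OF ab y])
  qed
  have "(fd 0 1 0 has_vector_derivative fd 0 (Suc 1) 0 x) (at x within {a..b})"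
    by (rule fd_space_deriv(1)[OF t0 x]) auto
  then have d2: "(fd 0 1 0 has_vector_derivative fd 0 2 0 x) (at x within {a..b})"
    by (simp only: Suc_1)
  have "((\<lambda>y. vector_derivative u0 (at y within {a..b})) has_vector_derivative fd 0 2 0 x) (at x within {a..b})"
    by (rule has_vector_derivative_transform[OF x v1 d2])
  then have "vector_derivative (\<lambda>y. vector_derivative u0 (at y within {a..b})) (at x within {a..b}) = fd 0 2 0 x"
    by (rule vector_derivative_within_closed_interval[OF ab x])
  moreover have "fd 0 2 0 x - log_nonlin \<epsilon> (u0 x) = - \<i> * fd 1 0 0 x"
    using pde[OF t0 x] initial_value[OF x] by (simp add: algebra_simps)
  ultimately show ?thesis by (simp add: initial_velocity_def)
qed

text \<open>A bound that holds almost everywhere on the space-time rectangle holds at points arbitrarily close to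
  \<open>(x, t)\<close>, and the solution is jointly continuous.\<close>

lemma norm_le_Linf_norm:
  assumes t: "t \<in> {0..T}" and x: "x \<in> {a..b}"
  shows "ereal (norm (u t x)) \<le> Linf_norm a b T u"
proof (rule ereal_le_epsilon2)
  fix e :: real assume e: "0 < e"
  define e' where "e' = e / 2"
  have e': "e' > 0" using e by (simp add: e'_def)
  obtain d where d: "d > 0" "\<And>s y. s \<in> {0..T} \<Longrightarrow> \<bar>s - t\<bar> < d \<Longrightarrow> y \<in> {a..b} \<Longrightarrow> norm (cd 0 (D 0 s) y - cd 0 (D 0 t) y) < e'"
    using cd_time_continuous_uniform[OF D_continuous(1) _ t e', of 0] by force
  obtain d' where d': "d' > 0" "\<And>y. y \<in> {a..b} \<Longrightarrow> dist y x < d' \<Longrightarrow> dist (u t y) (u t x) < e'"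
    using solution_continuous_vanishing_at_ends(1)[OF t] x e' unfolding continuous_on_iff by metis
  let ?R = "{max a (x - d')<..<min b (x + d')} \<times> {max 0 (t - d)<..<min T (t + d)}"
  have "\<exists>p\<in>?R. (\<lambda>(x, t). ereal (cmod (u t x))) p \<le> Linf_norm a b T u"
    unfolding Linf_norm_def
  proof (rule AE_imp_ex_in_open[OF esssup_AE])
    show "?R \<noteq> {}" using x t T ab d d' by (auto simp: max_def min_def)
    show "?R \<subseteq> {a<..<b} \<times> {0..T}" by auto
    show "{a<..<b} \<times> {0..T} \<in> sets lebesgue"
      by (intro sets_completionI_sets) (simp add: borel_Times)
    show "open ?R" by (intro open_Times) auto
  qed
  then obtain y s where p: "y \<in> {max a (x - d')<..<min b (x + d')}" "s \<in> {max 0 (t - d)<..<min T (t + d)}"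
    "ereal (cmod (u s y)) \<le> Linf_norm a b T u" by auto
  have y: "y \<in> {a..b}" "dist y x < d'" using p(1) by (auto simp: dist_real_def abs_less_iff)
  have s: "s \<in> {0..T}" "\<bar>s - t\<bar> < d" using p(2) by (auto simp: abs_less_iff)
  have "norm (u s y - u t y) < e'"
    using d(2)[OF s y(1)] u_eq_fd[OF s(1) y(1)] u_eq_fd[OF t y(1)] by (simp add: fd_def)
  moreover have "norm (u t y - u t x) < e'" using d'(2)[OF y] by (simp add: dist_norm)
  ultimately have "norm (u t x) \<le> norm (u s y) + e"
    using norm_triangle_ineq2[of "u t x" "u t y"] norm_triangle_ineq2[of "u t y" "u s y"]
    by (simp add: e'_def norm_minus_commute)
  then have "ereal (norm (u t x)) \<le> ereal (cmod (u s y)) + ereal e" by simp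
  also have "\<dots> \<le> Linf_norm a b T u + ereal e" using p(3) by (intro add_mono) auto
  finally show "ereal (norm (u t x)) \<le> Linf_norm a b T u + ereal e" .
qed

lemma weak_L1_4_increment:
  assumes "0 \<le> s" "s \<le> t" "t \<le> T"
  shows "weak_L1 4 (\<lambda>x. D 0 t x - D 0 s x) \<le> KB * (t - s)"
proof (rule weak_L1_increment_le[where G = "D 1" and m = 4 and T = T])
  show "sobolev_time_deriv a b 4 {0..T} (D 0) (D 1)" using D_time_deriv(1)[of 0] by simp
qed (use assms D_in_sobolev(2)[of 0] D_in_sobolev(2)[of 1] weak_L1_bounds(1)[of _ 1 4] in auto)

end

section \<open>Discrete norms and energy estimates\<close>

lemma disc_L2_norm_eq: "h \<ge> 0 \<Longrightarrow> disc_L2_norm h M v = sqrt h * L2_set (\<lambda>j. cmod (v j)) {1..M-1}"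
  by (simp add: disc_L2_norm_def L2_set_def real_sqrt_mult)

lemma disc_H1_seminorm_eq: "h \<ge> 0 \<Longrightarrow> disc_H1_seminorm h M v = sqrt h * L2_set (\<lambda>j. cmod (delta_xp h v j)) {..<M}"
  by (simp add: disc_H1_seminorm_def L2_set_def real_sqrt_mult)

lemma disc_L2_norm_nonneg: "h \<ge> 0 \<Longrightarrow> disc_L2_norm h M v \<ge> 0"
  by (auto simp: disc_L2_norm_def intro!: mult_nonneg_nonneg sum_nonneg)

lemma disc_H1_seminorm_nonneg: "h \<ge> 0 \<Longrightarrow> disc_H1_seminorm h M v \<ge> 0"
  by (auto simp: disc_H1_seminorm_def intro!: mult_nonneg_nonneg sum_nonneg)

lemma disc_L2_norm_mono:
  assumes "h \<ge> 0" and "\<And>j. j \<in> {1..M-1} \<Longrightarrow> cmod (v j) \<le> c1 * cmod (w j) + c2 * cmod (z j)" "c1 \<ge> 0" "c2 \<ge> 0"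
  shows "disc_L2_norm h M v \<le> c1 * disc_L2_norm h M w + c2 * disc_L2_norm h M z"
proof -
  have "L2_set (\<lambda>j. cmod (v j)) {1..M-1} \<le> L2_set (\<lambda>j. c1 * cmod (w j) + c2 * cmod (z j)) {1..M-1}"
    using assms by (intro L2_set_mono) auto
  also have "\<dots> \<le> L2_set (\<lambda>j. c1 * cmod (w j)) {1..M-1} + L2_set (\<lambda>j. c2 * cmod (z j)) {1..M-1}"
    by (rule L2_set_triangle_ineq)
  also have "\<dots> = c1 * L2_set (\<lambda>j. cmod (w j)) {1..M-1} + c2 * L2_set (\<lambda>j. cmod (z j)) {1..M-1}"
    using assms by (simp add: L2_set_right_distrib)
  finally have "sqrt h * L2_set (\<lambda>j. cmod (v j)) {1..M-1}
      \<le> sqrt h * (c1 * L2_set (\<lambda>j. cmod (w j)) {1..M-1} + c2 * L2_set (\<lambda>j. cmod (z j)) {1..M-1})"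
    using assms(1) by (intro mult_left_mono) auto
  then show ?thesis using assms(1) by (simp add: disc_L2_norm_eq algebra_simps)
qed

lemma disc_L2_norm_triangle:
  "h \<ge> 0 \<Longrightarrow> disc_L2_norm h M (\<lambda>j. v j + w j) \<le> disc_L2_norm h M v + disc_L2_norm h M w"
  using disc_L2_norm_mono[of h M "\<lambda>j. v j + w j" 1 v 1 w] by (simp add: norm_triangle_ineq)

lemma delta_xp_add: "delta_xp h (\<lambda>j. v j + w j) j = delta_xp h v j + delta_xp h w j"
  by (simp add: delta_xp_def add_divide_distrib diff_divide_distrib)

lemma disc_H1_seminorm_triangle:
  assumes h: "h \<ge> 0"
  shows "disc_H1_seminorm h M (\<lambda>j. v j + w j) \<le> disc_H1_seminorm h M v + disc_H1_seminorm h M w"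
proof -
  have "L2_set (\<lambda>j. cmod (delta_xp h (\<lambda>j. v j + w j) j)) {..<M} \<le> L2_set (\<lambda>j. cmod (delta_xp h v j) + cmod (delta_xp h w j)) {..<M}"
    by (intro L2_set_mono) (auto simp: delta_xp_add norm_triangle_ineq)
  also have "\<dots> \<le> L2_set (\<lambda>j. cmod (delta_xp h v j)) {..<M} + L2_set (\<lambda>j. cmod (delta_xp h w j)) {..<M}"
    by (rule L2_set_triangle_ineq)
  finally show ?thesis using h
    by (simp add: disc_H1_seminorm_eq distrib_left[symmetric] mult_left_mono)
qed

lemma norm_sum_mult_cnj_le:
  "cmod (\<Sum>j\<in>A. f j * cnj (g j)) \<le> L2_set (\<lambda>j. cmod (f j)) A * L2_set (\<lambda>j. cmod (g j)) A"
proof -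
  have "cmod (\<Sum>j\<in>A. f j * cnj (g j)) \<le> (\<Sum>j\<in>A. \<bar>cmod (f j)\<bar> * \<bar>cmod (g j)\<bar>)"
    by (rule order_trans[OF norm_sum]) (simp add: norm_mult)
  also have "\<dots> \<le> L2_set (\<lambda>j. cmod (f j)) A * L2_set (\<lambda>j. cmod (g j)) A" by (rule L2_set_mult_ineq)
  finally show ?thesis .
qed

lemma summation_by_parts_Suc:
  fixes X c :: "nat \<Rightarrow> complex"
  shows "(\<Sum>j<Suc n. (X (j + 1) - X j) * c j) = X (Suc n) * c n - X 0 * c 0 - (\<Sum>j=1..n. X j * (c j - c (j - 1)))"
proof (induction n)
  case (Suc n)
  have "(\<Sum>j<Suc (Suc n). (X (j + 1) - X j) * c j) = (\<Sum>j<Suc n. (X (j + 1) - X j) * c j) + (X (Suc (Suc n)) - X (Suc n)) * c (Suc n)"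
    by simp
  then show ?case unfolding Suc by (simp add: algebra_simps)
qed (simp add: algebra_simps)

lemma delta_xx_eq: "h \<noteq> 0 \<Longrightarrow> j \<ge> 1 \<Longrightarrow> delta_xx h W j = (delta_xp h W j - delta_xp h W (j - 1)) / complex_of_real h"
  by (simp add: delta_xx_def delta_xp_def power2_eq_square diff_divide_distrib[symmetric])

lemma discrete_integration_by_parts:
  assumes h: "h \<noteq> 0" and M: "M \<ge> 1" and X: "X 0 = 0" "X M = 0"
  shows "(\<Sum>j=1..M-1. X j * cnj (delta_xx h W j)) = - (\<Sum>j<M. delta_xp h X j * cnj (delta_xp h W j))"
proof -
  obtain n where n: "M = Suc n" using M by (cases M) auto
  let ?c = "\<lambda>j. cnj (delta_xp h W j)"
  have "(\<Sum>j<M. delta_xp h X j * cnj (delta_xp h W j)) = (\<Sum>j<M. (X (j + 1) - X j) * ?c j) / complex_of_real h"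
    by (simp add: delta_xp_def[of h X] sum_divide_distrib)
  also have "(\<Sum>j<M. (X (j + 1) - X j) * ?c j) = - (\<Sum>j=1..n. X j * (?c j - ?c (j - 1)))"
    unfolding n using summation_by_parts_Suc[of X ?c n] X n by simp
  also have "- (\<Sum>j=1..n. X j * (?c j - ?c (j - 1))) / complex_of_real h = - (\<Sum>j=1..M-1. X j * cnj (delta_xx h W j))"
    unfolding minus_divide_left[symmetric] sum_divide_distrib n
    using h by (auto intro!: sum.cong simp: delta_xx_eq)
  finally show ?thesis by simp
qed

lemma diff_squares_imp_le:
  fixes \<alpha> \<beta> r :: real
  assumes "\<alpha> \<ge> 0" "\<beta> \<ge> 0" "r \<ge> 0" "\<alpha>\<^sup>2 - \<beta>\<^sup>2 \<le> r * (\<alpha> + \<beta>)"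
  shows "\<alpha> \<le> \<beta> + r"
proof (cases "\<alpha> + \<beta> = 0")
  case False
  have "(\<alpha> - \<beta>) * (\<alpha> + \<beta>) \<le> r * (\<alpha> + \<beta>)" using assms(4) by (simp add: power2_eq_square algebra_simps)
  then have "\<alpha> - \<beta> \<le> r" using False assms by (simp add: mult_le_cancel_right)
  then show ?thesis by simp
qed (use assms in auto)

lemma Re_diff_mult_cnj_add: "Re ((z - w) * cnj (z + w)) = (cmod z)\<^sup>2 - (cmod w)\<^sup>2"
  unfolding cmod_power2 by (simp add: algebra_simps power2_eq_square)

lemma discrete_Schroedinger_step:
  assumes \<tau>: "\<tau> > 0"
    and eq: "\<i> * ((A j - B j) / complex_of_real (2 * \<tau>)) = - (1/2) * delta_xx h (\<lambda>l. A l + B l) j + R j"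
  shows "A j - B j = \<i> * complex_of_real \<tau> * delta_xx h (\<lambda>l. A l + B l) j - 2 * \<i> * complex_of_real \<tau> * R j"
proof -
  have "A j - B j = (- \<i> * complex_of_real (2 * \<tau>)) * (\<i> * ((A j - B j) / complex_of_real (2 * \<tau>)))" using \<tau> by simp
  also have "\<dots> = \<i> * complex_of_real \<tau> * delta_xx h (\<lambda>l. A l + B l) j - 2 * \<i> * complex_of_real \<tau> * R j"
    unfolding eq by (simp add: algebra_simps)
  finally show ?thesis .
qed

lemma eq_minus_diffI: "S = x + y \<Longrightarrow> S = - P \<Longrightarrow> P = - x - (y::complex)"
  by algebra

text \<open>Multiplication by the conjugate of \<open>W = A + B\<close> makes the difference operator contribute a real number
  times \<open>\<i>\<close>, which drops out of the real part; what remains is \<open>\<parallel>A\<parallel>\<^sup>2 - \<parallel>B\<parallel>\<^sup>2\<close> and the source.\<close>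

lemma discrete_Schroedinger_energy_L2:
  assumes h: "h > 0" and \<tau>: "\<tau> > 0" and M: "M \<ge> 1"
    and bd: "A 0 = 0" "A M = 0" "B 0 = 0" "B M = 0"
    and eq: "\<And>j. j \<in> {1..M-1} \<Longrightarrow> \<i> * ((A j - B j) / complex_of_real (2 * \<tau>)) = - (1/2) * delta_xx h (\<lambda>l. A l + B l) j + R j"
  shows "disc_L2_norm h M A \<le> disc_L2_norm h M B + 2 * \<tau> * disc_L2_norm h M R"
proof -
  define W where "W = (\<lambda>l. A l + B l)"
  have step: "A j - B j = \<i> * complex_of_real \<tau> * delta_xx h W j - 2 * \<i> * complex_of_real \<tau> * R j" if "j \<in> {1..M-1}" for j
    unfolding W_def by (rule discrete_Schroedinger_step[where A = A and B = B and R = R and j = j and h = h, OF \<tau> eq[OF that]])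
  have parts: "(\<Sum>j=1..M-1. delta_xx h W j * cnj (W j)) = - complex_of_real (\<Sum>j<M. (cmod (delta_xp h W j))\<^sup>2)"
  proof -
    have "(\<Sum>j=1..M-1. delta_xx h W j * cnj (W j)) = cnj (\<Sum>j=1..M-1. W j * cnj (delta_xx h W j))"
      by (simp add: mult.commute)
    also have "\<dots> = - cnj (\<Sum>j<M. delta_xp h W j * cnj (delta_xp h W j))"
      by (subst discrete_integration_by_parts) (use h M bd in \<open>auto simp: W_def\<close>)
    also have "(\<Sum>j<M. delta_xp h W j * cnj (delta_xp h W j)) = complex_of_real (\<Sum>j<M. (cmod (delta_xp h W j))\<^sup>2)"
      by (simp add: complex_norm_square[symmetric])
    finally show ?thesis by simp
  qed
  have "(\<Sum>j=1..M-1. (A j - B j) * cnj (W j)) = \<i> * complex_of_real \<tau> * (\<Sum>j=1..M-1. delta_xx h W j * cnj (W j)) - 2 * \<i> * complex_of_real \<tau> * (\<Sum>j=1..M-1. R j * cnj (W j))"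
    unfolding sum_distrib_left sum_subtractf[symmetric] by (intro sum.cong) (auto simp: step algebra_simps)
  then have "Re (\<Sum>j=1..M-1. (A j - B j) * cnj (W j)) = Re (- 2 * \<i> * complex_of_real \<tau> * (\<Sum>j=1..M-1. R j * cnj (W j)))"
    unfolding parts by simp
  also have "\<dots> \<le> cmod (- 2 * \<i> * complex_of_real \<tau> * (\<Sum>j=1..M-1. R j * cnj (W j)))" by (rule complex_Re_le_cmod)
  also have "\<dots> = 2 * \<tau> * cmod (\<Sum>j=1..M-1. R j * cnj (W j))" using \<tau> by (simp add: norm_mult)
  also have "\<dots> \<le> 2 * \<tau> * (L2_set (\<lambda>j. cmod (R j)) {1..M-1} * L2_set (\<lambda>j. cmod (W j)) {1..M-1})"
    using \<tau> by (intro mult_left_mono norm_sum_mult_cnj_le) auto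
  finally have 1: "Re (\<Sum>j=1..M-1. (A j - B j) * cnj (W j)) \<le> 2 * \<tau> * (L2_set (\<lambda>j. cmod (R j)) {1..M-1} * L2_set (\<lambda>j. cmod (W j)) {1..M-1})" .
  have sq: "(disc_L2_norm h M V)\<^sup>2 = h * (\<Sum>j=1..M-1. (cmod (V j))\<^sup>2)" for V
    using h by (simp add: disc_L2_norm_def sum_nonneg)
  have "(disc_L2_norm h M A)\<^sup>2 - (disc_L2_norm h M B)\<^sup>2 = h * Re (\<Sum>j=1..M-1. (A j - B j) * cnj (W j))"
    unfolding sq W_def Re_sum Re_diff_mult_cnj_add sum_subtractf by (simp add: algebra_simps)
  also have "\<dots> \<le> h * (2 * \<tau> * (L2_set (\<lambda>j. cmod (R j)) {1..M-1} * L2_set (\<lambda>j. cmod (W j)) {1..M-1}))"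
    using 1 h by (intro mult_left_mono) auto
  also have "\<dots> = 2 * \<tau> * disc_L2_norm h M R * disc_L2_norm h M W"
    using h real_sqrt_mult_self[of h] by (simp add: disc_L2_norm_eq algebra_simps)
  also have "\<dots> \<le> 2 * \<tau> * disc_L2_norm h M R * (disc_L2_norm h M A + disc_L2_norm h M B)"
    unfolding W_def using h \<tau> by (intro mult_left_mono disc_L2_norm_triangle mult_nonneg_nonneg disc_L2_norm_nonneg) auto
  finally show ?thesis
    using h \<tau> by (intro diff_squares_imp_le) (auto intro!: mult_nonneg_nonneg disc_L2_norm_nonneg)
qed

text \<open>The same argument with the conjugate of \<open>\<delta>\<^sub>x\<^sup>2 W\<close> as multiplier. Summation by parts moves one
  difference to \<open>R\<close>, which is where \<open>R 0 = R M = 0\<close> enters.\<close>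

lemma discrete_Schroedinger_energy_H1:
  assumes h: "h > 0" and \<tau>: "\<tau> > 0" and M: "M \<ge> 1"
    and bd: "A 0 = 0" "A M = 0" "B 0 = 0" "B M = 0" and R: "R 0 = 0" "R M = 0"
    and eq: "\<And>j. j \<in> {1..M-1} \<Longrightarrow> \<i> * ((A j - B j) / complex_of_real (2 * \<tau>)) = - (1/2) * delta_xx h (\<lambda>l. A l + B l) j + R j"
  shows "disc_H1_seminorm h M A \<le> disc_H1_seminorm h M B + 2 * \<tau> * disc_H1_seminorm h M R"
proof -
  define W where "W = (\<lambda>l. A l + B l)"
  have step: "A j - B j = \<i> * complex_of_real \<tau> * delta_xx h W j - 2 * \<i> * complex_of_real \<tau> * R j" if "j \<in> {1..M-1}" for j
    unfolding W_def by (rule discrete_Schroedinger_step[where A = A and B = B and R = R and j = j and h = h, OF \<tau> eq[OF that]])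
  have "(\<Sum>j=1..M-1. (A j - B j) * cnj (delta_xx h W j)) = \<i> * complex_of_real \<tau> * (\<Sum>j=1..M-1. delta_xx h W j * cnj (delta_xx h W j)) - 2 * \<i> * complex_of_real \<tau> * (\<Sum>j=1..M-1. R j * cnj (delta_xx h W j))"
    unfolding sum_distrib_left sum_subtractf[symmetric] by (intro sum.cong) (auto simp: step algebra_simps)
  also have "(\<Sum>j=1..M-1. delta_xx h W j * cnj (delta_xx h W j)) = complex_of_real (\<Sum>j=1..M-1. (cmod (delta_xx h W j))\<^sup>2)"
    by (simp add: complex_norm_square[symmetric])
  also have "(\<Sum>j=1..M-1. R j * cnj (delta_xx h W j)) = - (\<Sum>j<M. delta_xp h R j * cnj (delta_xp h W j))"
    using h by (intro discrete_integration_by_parts M R) auto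
  finally have "(\<Sum>j=1..M-1. (A j - B j) * cnj (delta_xx h W j)) = \<i> * complex_of_real \<tau> * complex_of_real (\<Sum>j=1..M-1. (cmod (delta_xx h W j))\<^sup>2) + 2 * \<i> * complex_of_real \<tau> * (\<Sum>j<M. delta_xp h R j * cnj (delta_xp h W j))"
    by simp
  moreover have "(\<Sum>j=1..M-1. (A j - B j) * cnj (delta_xx h W j)) = - (\<Sum>j<M. delta_xp h (\<lambda>j. A j - B j) j * cnj (delta_xp h W j))"
    by (intro discrete_integration_by_parts M) (use h bd in auto)
  ultimately have "(\<Sum>j<M. delta_xp h (\<lambda>j. A j - B j) j * cnj (delta_xp h W j)) = - (\<i> * complex_of_real \<tau> * complex_of_real (\<Sum>j=1..M-1. (cmod (delta_xx h W j))\<^sup>2)) - 2 * \<i> * complex_of_real \<tau> * (\<Sum>j<M. delta_xp h R j * cnj (delta_xp h W j))"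
    by (rule eq_minus_diffI)
  then have "Re (\<Sum>j<M. delta_xp h (\<lambda>j. A j - B j) j * cnj (delta_xp h W j)) = Re (- 2 * \<i> * complex_of_real \<tau> * (\<Sum>j<M. delta_xp h R j * cnj (delta_xp h W j)))"
    by simp
  also have "\<dots> \<le> cmod (- 2 * \<i> * complex_of_real \<tau> * (\<Sum>j<M. delta_xp h R j * cnj (delta_xp h W j)))" by (rule complex_Re_le_cmod)
  also have "\<dots> = 2 * \<tau> * cmod (\<Sum>j<M. delta_xp h R j * cnj (delta_xp h W j))" using \<tau> by (simp add: norm_mult)
  also have "\<dots> \<le> 2 * \<tau> * (L2_set (\<lambda>j. cmod (delta_xp h R j)) {..<M} * L2_set (\<lambda>j. cmod (delta_xp h W j)) {..<M})"
    using \<tau> by (intro mult_left_mono norm_sum_mult_cnj_le) auto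
  finally have 1: "Re (\<Sum>j<M. delta_xp h (\<lambda>j. A j - B j) j * cnj (delta_xp h W j)) \<le> 2 * \<tau> * (L2_set (\<lambda>j. cmod (delta_xp h R j)) {..<M} * L2_set (\<lambda>j. cmod (delta_xp h W j)) {..<M})" .
  have sq: "(disc_H1_seminorm h M V)\<^sup>2 = h * (\<Sum>j<M. (cmod (delta_xp h V j))\<^sup>2)" for V
    using h by (simp add: disc_H1_seminorm_def sum_nonneg)
  have dW: "delta_xp h W j = delta_xp h A j + delta_xp h B j" "delta_xp h (\<lambda>j. A j - B j) j = delta_xp h A j - delta_xp h B j" for j
    by (simp_all add: W_def delta_xp_def add_divide_distrib diff_divide_distrib)
  have "(disc_H1_seminorm h M A)\<^sup>2 - (disc_H1_seminorm h M B)\<^sup>2 = h * Re (\<Sum>j<M. delta_xp h (\<lambda>j. A j - B j) j * cnj (delta_xp h W j))"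
    unfolding sq dW Re_sum Re_diff_mult_cnj_add sum_subtractf by (simp add: algebra_simps)
  also have "\<dots> \<le> h * (2 * \<tau> * (L2_set (\<lambda>j. cmod (delta_xp h R j)) {..<M} * L2_set (\<lambda>j. cmod (delta_xp h W j)) {..<M}))"
    using 1 h by (intro mult_left_mono) auto
  also have "\<dots> = 2 * \<tau> * disc_H1_seminorm h M R * disc_H1_seminorm h M W"
  proof -
    have "h = sqrt h * sqrt h" using h by simp
    then show ?thesis using h by (simp add: disc_H1_seminorm_eq)
  qed
  also have "\<dots> \<le> 2 * \<tau> * disc_H1_seminorm h M R * (disc_H1_seminorm h M A + disc_H1_seminorm h M B)"
    unfolding W_def using h \<tau> by (intro mult_left_mono disc_H1_seminorm_triangle mult_nonneg_nonneg disc_H1_seminorm_nonneg) auto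
  finally show ?thesis
    using h \<tau> by (intro diff_squares_imp_le) (auto intro!: mult_nonneg_nonneg disc_H1_seminorm_nonneg)
qed

lemma disc_sup_le_H1_seminorm:
  assumes h: "h > 0" and v0: "v 0 = 0" and j: "j \<le> M"
  shows "cmod (v j) \<le> sqrt (real M * h) * disc_H1_seminorm h M v"
proof -
  have "v j = (\<Sum>i<j. v (Suc i) - v i)" using v0 by (simp add: sum_lessThan_telescope)
  also have "\<dots> = (\<Sum>i<j. complex_of_real h * delta_xp h v i)" using h by (simp add: delta_xp_def)
  finally have "cmod (v j) \<le> (\<Sum>i<j. h * cmod (delta_xp h v i))"
    using h by (simp add: order_trans[OF norm_sum] norm_mult)
  also have "\<dots> \<le> (\<Sum>i<M. h * cmod (delta_xp h v i))" using j h by (intro sum_mono2) auto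
  also have "\<dots> = (\<Sum>i<M. \<bar>h\<bar> * \<bar>cmod (delta_xp h v i)\<bar>)" using h by simp
  also have "\<dots> \<le> L2_set (\<lambda>i. h) {..<M} * L2_set (\<lambda>i. cmod (delta_xp h v i)) {..<M}"
    by (rule L2_set_mult_ineq)
  also have "L2_set (\<lambda>i. h) {..<M} = sqrt (real M * h) * sqrt h" using h by (simp add: L2_set_def real_sqrt_mult)
  finally show ?thesis using h by (simp add: disc_H1_seminorm_eq mult.assoc)
qed

lemma disc_L2_norm_le_sup:
  assumes h: "h > 0" and c: "c \<ge> 0" "\<And>j. j \<in> {1..M-1} \<Longrightarrow> cmod (v j) \<le> c"
  shows "disc_L2_norm h M v \<le> sqrt (real M * h) * c"
proof -
  have "h * (\<Sum>j=1..M-1. (cmod (v j))\<^sup>2) \<le> h * (\<Sum>j=1..M-1. c\<^sup>2)"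
    using h c by (intro mult_left_mono sum_mono power_mono) auto
  also have "\<dots> \<le> (real M * h) * c\<^sup>2" using h by (auto simp: algebra_simps intro!: mult_right_mono)
  finally have "disc_L2_norm h M v \<le> sqrt ((real M * h) * c\<^sup>2)" unfolding disc_L2_norm_def by (rule real_sqrt_le_mono)
  then show ?thesis using c by (simp add: real_sqrt_mult)
qed

lemma discrete_Poincare:
  assumes h: "h > 0" and v0: "v 0 = 0"
  shows "disc_L2_norm h M v \<le> (real M * h) * disc_H1_seminorm h M v"
proof -
  have "disc_L2_norm h M v \<le> sqrt (real M * h) * (sqrt (real M * h) * disc_H1_seminorm h M v)"
    by (rule disc_L2_norm_le_sup[OF h]) (use h disc_sup_le_H1_seminorm[OF h, of v _ M] v0 in \<open>auto intro!: mult_nonneg_nonneg disc_H1_seminorm_nonneg\<close>)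
  also have "\<dots> = (real M * h) * disc_H1_seminorm h M v" using h by (simp flip: mult.assoc)
  finally show ?thesis .
qed

lemma disc_H1_seminorm_le_sup:
  assumes h: "h > 0" and c: "c \<ge> 0" "\<And>j. j < M \<Longrightarrow> cmod (delta_xp h v j) \<le> c"
  shows "disc_H1_seminorm h M v \<le> sqrt (real M * h) * c"
proof -
  have "h * (\<Sum>j<M. (cmod (delta_xp h v j))\<^sup>2) \<le> h * (\<Sum>j<M. c\<^sup>2)"
    using h c by (intro mult_left_mono sum_mono power_mono) auto
  also have "\<dots> = (real M * h) * c\<^sup>2" by (simp add: algebra_simps)
  finally have "disc_H1_seminorm h M v \<le> sqrt ((real M * h) * c\<^sup>2)" unfolding disc_H1_seminorm_def by (rule real_sqrt_le_mono)
  then show ?thesis using c by (simp add: real_sqrt_mult)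
qed

text \<open>The form in which the nonlinearity is estimated: a difference quotient is bounded by a difference
  quotient of \<open>z\<close> and by values of \<open>w\<close> at both end points of the cell.\<close>

lemma disc_H1_seminorm_le_pointwise:
  assumes h: "h > 0" and bd: "w 0 = 0" "w M = 0" and c: "c1 \<ge> 0" "c2 \<ge> 0"
    and le: "\<And>j. j < M \<Longrightarrow> cmod (delta_xp h v j) \<le> c1 * cmod (delta_xp h z j) + c2 * (cmod (w j) + cmod (w (j + 1)))"
  shows "disc_H1_seminorm h M v \<le> c1 * disc_H1_seminorm h M z + 2 * c2 * disc_L2_norm h M w"
proof -
  have 1: "L2_set (\<lambda>j. cmod (w j)) {..<M} = L2_set (\<lambda>j. cmod (w j)) {1..M-1}"
    unfolding L2_set_def using bd by (intro arg_cong[where f = sqrt] sum.mono_neutral_right) (auto simp: Suc_le_eq neq0_conv[symmetric] simp del: neq0_conv intro!: gr0I)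
  have 2: "L2_set (\<lambda>j. cmod (w (j + 1))) {..<M} = L2_set (\<lambda>j. cmod (w j)) {1..M-1}"
  proof -
    have "(\<Sum>j<M. (cmod (w (j + 1)))\<^sup>2) = (\<Sum>j=1..M. (cmod (w j))\<^sup>2)"
      by (rule sum.reindex_bij_witness[of _ "\<lambda>j. j - 1" "\<lambda>j. j + 1"]) auto
    also have "\<dots> = (\<Sum>j=1..M-1. (cmod (w j))\<^sup>2)"
      using bd by (cases M) auto
    finally show ?thesis by (simp add: L2_set_def)
  qed
  have "L2_set (\<lambda>j. cmod (delta_xp h v j)) {..<M} \<le> L2_set (\<lambda>j. c1 * cmod (delta_xp h z j) + c2 * (cmod (w j) + cmod (w (j + 1)))) {..<M}"
    using le by (intro L2_set_mono) auto
  also have "\<dots> \<le> L2_set (\<lambda>j. c1 * cmod (delta_xp h z j)) {..<M} + L2_set (\<lambda>j. c2 * (cmod (w j) + cmod (w (j + 1)))) {..<M}"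
    by (rule L2_set_triangle_ineq)
  also have "\<dots> = c1 * L2_set (\<lambda>j. cmod (delta_xp h z j)) {..<M} + c2 * L2_set (\<lambda>j. cmod (w j) + cmod (w (j + 1))) {..<M}"
    using c by (simp add: L2_set_right_distrib)
  also have "\<dots> \<le> c1 * L2_set (\<lambda>j. cmod (delta_xp h z j)) {..<M} + c2 * (2 * L2_set (\<lambda>j. cmod (w j)) {1..M-1})"
    using L2_set_triangle_ineq[of "\<lambda>j. cmod (w j)" "\<lambda>j. cmod (w (j + 1))" "{..<M}"] c(2) unfolding 1 2
    by (intro add_left_mono mult_left_mono) auto
  finally have "sqrt h * L2_set (\<lambda>j. cmod (delta_xp h v j)) {..<M} \<le> sqrt h * (c1 * L2_set (\<lambda>j. cmod (delta_xp h z j)) {..<M} + c2 * (2 * L2_set (\<lambda>j. cmod (w j)) {1..M-1}))"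
    using h by (intro mult_left_mono) auto
  then show ?thesis using h by (simp add: disc_H1_seminorm_eq disc_L2_norm_eq algebra_simps)
qed

section \<open>The discrete Dirichlet problem and a discrete Gronwall inequality\<close>

text \<open>Up to an affine function, the solution of \<open>\<delta>\<^sub>x\<^sup>2 p = \<zeta>\<close>.\<close>

definition double_sum :: "real \<Rightarrow> (nat \<Rightarrow> complex) \<Rightarrow> nat \<Rightarrow> complex" where
  "double_sum h \<zeta> j = complex_of_real (h\<^sup>2) * (\<Sum>k<j. \<Sum>i=1..k. \<zeta> i)"

text \<open>The grid function with \<open>\<delta>\<^sub>x\<^sup>2 p = \<zeta>\<close> in the interior and zero boundary values. For
  \<open>\<zeta> = \<delta>\<^sub>x\<^sup>2 u - u\<^sub>x\<^sub>x\<close> it is the difference of \<open>u\<close> and its Ritz projection.\<close>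

definition ritz :: "real \<Rightarrow> nat \<Rightarrow> (nat \<Rightarrow> complex) \<Rightarrow> nat \<Rightarrow> complex" where
  "ritz h M \<zeta> j = double_sum h \<zeta> j - complex_of_real (real j / real M) * double_sum h \<zeta> M"

lemma ritz_boundary: "ritz h M \<zeta> 0 = 0" "M \<ge> 1 \<Longrightarrow> ritz h M \<zeta> M = 0"
  by (auto simp: ritz_def double_sum_def)

lemma delta_xp_ritz:
  assumes "h > 0"
  shows "delta_xp h (ritz h M \<zeta>) j = complex_of_real h * (\<Sum>i=1..j. \<zeta> i) - double_sum h \<zeta> M / complex_of_real (real M * h)"
  using assms by (simp add: delta_xp_def ritz_def double_sum_def power2_eq_square field_simps add_divide_distrib)

lemma delta_xx_ritz:
  assumes h: "h > 0" and j: "j \<ge> 1"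
  shows "delta_xx h (ritz h M \<zeta>) j = \<zeta> j"
proof -
  obtain n where "j = Suc n" using j by (cases j) auto
  then show ?thesis
    using h by (simp add: delta_xx_eq delta_xp_ritz[OF h] algebra_simps)
qed

lemma delta_xp_ritz_bound:
  assumes h: "h > 0" and j: "j < M"
  shows "cmod (delta_xp h (ritz h M \<zeta>) j) \<le> 2 * (h * (\<Sum>i=1..M-1. cmod (\<zeta> i)))"
proof -
  define Z where "Z = (\<Sum>i=1..M-1. cmod (\<zeta> i))"
  have Z: "cmod (\<Sum>i=1..k. \<zeta> i) \<le> Z" if "k < M" for k
  proof -
    have "cmod (\<Sum>i=1..k. \<zeta> i) \<le> (\<Sum>i=1..k. cmod (\<zeta> i))" by (rule norm_sum)
    also have "\<dots> \<le> Z" unfolding Z_def using that by (intro sum_mono2) auto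
    finally show ?thesis .
  qed
  have "cmod (double_sum h \<zeta> M) \<le> h\<^sup>2 * (\<Sum>k<M. Z)"
  proof -
    have "cmod (\<Sum>k<M. \<Sum>i=1..k. \<zeta> i) \<le> (\<Sum>k<M. Z)"
      by (intro order_trans[OF norm_sum] sum_mono Z) auto
    then show ?thesis
      unfolding double_sum_def norm_mult norm_of_real by (intro mult_mono) (auto intro!: sum_nonneg)
  qed
  then have "cmod (double_sum h \<zeta> M / complex_of_real (real M * h)) \<le> (h\<^sup>2 * (real M * Z)) / (real M * h)"
  proof -
    have "cmod (double_sum h \<zeta> M / complex_of_real (real M * h)) = cmod (double_sum h \<zeta> M) / (real M * h)"
      using h by (simp add: norm_divide norm_mult)
    also have "\<dots> \<le> (h\<^sup>2 * (\<Sum>k<M. Z)) / (real M * h)"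
      using \<open>cmod (double_sum h \<zeta> M) \<le> _\<close> h by (intro divide_right_mono) auto
    finally show ?thesis by simp
  qed
  also have "\<dots> = h * Z" using h j by (simp add: power2_eq_square)
  finally have 1: "cmod (double_sum h \<zeta> M / complex_of_real (real M * h)) \<le> h * Z" .
  have "cmod (complex_of_real h * (\<Sum>i=1..j. \<zeta> i)) \<le> h * Z" using h Z[OF j] by (simp add: norm_mult)
  then show ?thesis unfolding delta_xp_ritz[OF h] Z_def[symmetric]
    using norm_triangle_ineq4[of "complex_of_real h * (\<Sum>i=1..j. \<zeta> i)" "double_sum h \<zeta> M / complex_of_real (real M * h)"] 1 by linarith
qed

lemma ritz_diff: "ritz h M (\<lambda>i. \<zeta> i - \<xi> i) j = ritz h M \<zeta> j - ritz h M \<xi> j"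
  by (simp add: ritz_def double_sum_def sum_subtractf algebra_simps)

text \<open>The step may use the bound to be proved at level \<open>k\<close>: the Lipschitz constants of the nonlinearity
  are available only as long as the error is small. The shift by \<open>S\<close> absorbs the source
  because \<open>L \<ge> 1\<close>.\<close>

lemma two_step_Gronwall:
  fixes N :: "nat \<Rightarrow> real"
  assumes L: "L \<ge> 1" and \<tau>: "\<tau> \<ge> 0" and S: "S \<ge> 0" and m: "N 0 \<le> m" "1 \<le> K \<Longrightarrow> N 1 \<le> m" "m \<ge> 0"
    and step: "\<And>k. 1 \<le> k \<Longrightarrow> k + 1 \<le> K \<Longrightarrow> N k \<le> (m + S) * (1 + 2 * \<tau> * L) ^ k \<Longrightarrow> N (k + 1) \<le> N (k - 1) + 2 * \<tau> * (L * N k + S)"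
    and k: "k \<le> K"
  shows "N k \<le> (m + S) * (1 + 2 * \<tau> * L) ^ k"
proof -
  define q where "q = 1 + 2 * \<tau> * L"
  have q: "q \<ge> 1" using L \<tau> by (simp add: q_def)
  have "N k + S \<le> (m + S) * q ^ k" using k
  proof (induction k rule: less_induct)
    case (less k)
    consider "k = 0" | "k = 1" | n where "k = Suc (Suc n)" by (metis One_nat_def not0_implies_Suc)
    then show ?case
    proof cases
      case 1 then show ?thesis using m by simp
    next
      case 2
      have "(m + S) * 1 \<le> (m + S) * q" using q m S by (intro mult_left_mono) auto
      then show ?thesis using 2 m less.prems by simp
    next
      case 3
      have i1: "N (Suc n) + S \<le> (m + S) * q ^ Suc n" and i0: "N n + S \<le> (m + S) * q ^ n"
        using less.IH[of "Suc n"] less.IH[of n] less.prems 3 by auto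
      have "N k \<le> N n + 2 * \<tau> * (L * N (Suc n) + S)"
        using step[of "Suc n"] i1 S less.prems 3 unfolding q_def by auto
      also have "\<dots> \<le> N n + 2 * \<tau> * (L * (N (Suc n) + S))"
        using L S \<tau> mult_right_mono[of 1 L S] by (intro add_left_mono mult_left_mono) (auto simp: algebra_simps)
      finally have "N k + S \<le> (N n + S) + 2 * \<tau> * L * (N (Suc n) + S)" by (simp add: algebra_simps)
      also have "\<dots> \<le> (m + S) * q ^ n + 2 * \<tau> * L * ((m + S) * q ^ Suc n)"
        using i0 i1 L \<tau> by (intro add_mono mult_left_mono mult_nonneg_nonneg) auto
      also have "\<dots> \<le> (m + S) * q ^ Suc n + 2 * \<tau> * L * ((m + S) * q ^ Suc n)"
        using q m S by (intro add_right_mono mult_left_mono power_increasing) auto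
      also have "\<dots> = (m + S) * q ^ k" unfolding 3 by (simp add: q_def algebra_simps)
      finally show ?thesis .
    qed
  qed
  then show ?thesis using S by (simp add: q_def)
qed

section \<open>The logarithmic nonlinearity\<close>

text \<open>The real derivative of \<open>log_nonlin\<close>. At \<open>z = 0\<close> the second summand is \<open>0\<close> by the
  convention for division, which is the correct value there.\<close>

definition dlog_nonlin :: "real \<Rightarrow> complex \<Rightarrow> complex \<Rightarrow> complex" where
  "dlog_nonlin \<epsilon> z v = (2 * ln (\<epsilon> + norm z)) *\<^sub>R v + (2 * (z \<bullet> v) / (norm z * (\<epsilon> + norm z))) *\<^sub>R z"

lemma log_nonlin_eq: "\<epsilon> > 0 \<Longrightarrow> log_nonlin \<epsilon> z = (2 * ln (\<epsilon> + norm z)) *\<^sub>R z"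
  by (simp add: log_nonlin_def scaleR_conv_of_real ln_realpow add_pos_nonneg)

lemma ln_eps_add_Lipschitz:
  assumes "\<epsilon> > 0" "m \<ge> 0" "n \<ge> (0::real)"
  shows "\<bar>ln (\<epsilon> + m) - ln (\<epsilon> + n)\<bar> \<le> \<bar>m - n\<bar> / \<epsilon>"
proof -
  have *: "ln (\<epsilon> + p) - ln (\<epsilon> + q) \<le> \<bar>p - q\<bar> / \<epsilon>" if "p \<ge> 0" "q \<ge> 0" for p q
  proof -
    have "ln (\<epsilon> + p) - ln (\<epsilon> + q) \<le> ((\<epsilon> + p) - (\<epsilon> + q)) / (\<epsilon> + q)"
      by (rule ln_diff_le) (use that assms in auto)
    also have "\<dots> \<le> \<bar>p - q\<bar> / \<epsilon>" using that assms by (intro frac_le) auto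
    finally show ?thesis .
  qed
  show ?thesis using *[OF assms(2,3)] *[OF assms(3,2)] by (simp add: abs_le_iff abs_minus_commute)
qed

text \<open>At \<open>z = 0\<close> the norm is not differentiable, but the remainder is \<open>2 y\<close> times the increment
  \<open>ln (\<epsilon> + \<bar>y\<bar>) - ln \<epsilon>\<close>, which is at most \<open>\<bar>y\<bar> / \<epsilon>\<close>.\<close>

lemma log_nonlin_has_derivative:
  assumes eps: "\<epsilon> > 0" shows "(log_nonlin \<epsilon> has_derivative dlog_nonlin \<epsilon> z) (at z)"
proof (cases "z = 0")
  case False
  have p: "\<epsilon> + norm z > 0" using eps by (simp add: add_pos_nonneg)
  have "((\<lambda>z. (2 * ln (\<epsilon> + norm z)) *\<^sub>R z) has_derivative
     (\<lambda>v. (2 * ln (\<epsilon> + norm z)) *\<^sub>R v + (2 * (v \<bullet> sgn z * (inverse (\<epsilon> + norm z)))) *\<^sub>R z)) (at z)"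
    using False p by (auto intro!: derivative_eq_intros has_derivative_norm simp: field_simps)
  moreover have "(\<lambda>v. (2 * ln (\<epsilon> + norm z)) *\<^sub>R v + (2 * (v \<bullet> sgn z * (inverse (\<epsilon> + norm z)))) *\<^sub>R z) = dlog_nonlin \<epsilon> z"
    by (auto simp: dlog_nonlin_def sgn_div_norm inner_commute divide_inverse)
  moreover have "log_nonlin \<epsilon> = (\<lambda>z. (2 * ln (\<epsilon> + norm z)) *\<^sub>R z)" using eps by (auto simp: log_nonlin_eq)
  ultimately show ?thesis by simp
next
  case True
  have d: "dlog_nonlin \<epsilon> 0 = (\<lambda>v. (2 * ln \<epsilon>) *\<^sub>R v)" by (auto simp: dlog_nonlin_def)
  show ?thesis unfolding True has_derivative_at_within[symmetric] has_derivative_within d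
  proof (intro conjI bounded_linear_scaleR_right)
    show "((\<lambda>y. (1 / norm (y - 0)) *\<^sub>R (log_nonlin \<epsilon> y - (log_nonlin \<epsilon> 0 + (2 * ln \<epsilon>) *\<^sub>R (y - 0)))) \<longlongrightarrow> 0) (at 0)"
    proof (rule Lim_null_comparison)
      show "((\<lambda>y. 2 * (norm (y::complex) / \<epsilon>)) \<longlongrightarrow> 0) (at 0)"
        using eps by (auto intro!: tendsto_eq_intros)
      have "norm ((1 / norm (y - 0)) *\<^sub>R (log_nonlin \<epsilon> y - (log_nonlin \<epsilon> 0 + (2 * ln \<epsilon>) *\<^sub>R (y - 0)))) \<le> 2 * (norm y / \<epsilon>)" for y
      proof (cases "y = 0")
        case y: False
        have "log_nonlin \<epsilon> y - (log_nonlin \<epsilon> 0 + (2 * ln \<epsilon>) *\<^sub>R (y - 0)) = (2 * (ln (\<epsilon> + norm y) - ln (\<epsilon> + 0))) *\<^sub>R y"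
          by (simp add: log_nonlin_eq[OF eps] algebra_simps)
        then have "norm ((1 / norm (y - 0)) *\<^sub>R (log_nonlin \<epsilon> y - (log_nonlin \<epsilon> 0 + (2 * ln \<epsilon>) *\<^sub>R (y - 0)))) = 2 * \<bar>ln (\<epsilon> + norm y) - ln (\<epsilon> + 0)\<bar>"
          using y by (simp only: norm_scaleR abs_mult diff_0_right) simp
        then show ?thesis using ln_eps_add_Lipschitz[OF eps, of "norm y" 0] by simp
      qed (use eps in \<open>simp add: log_nonlin_def\<close>)
      then show "\<forall>\<^sub>F y in at 0. norm ((1 / norm (y - 0)) *\<^sub>R (log_nonlin \<epsilon> y - (log_nonlin \<epsilon> 0 + (2 * ln \<epsilon>) *\<^sub>R (y - 0)))) \<le> 2 * (norm y / \<epsilon>)"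
        by (intro always_eventually allI)
    qed
  qed
qed

text \<open>The Lipschitz constant of \<open>log_nonlin\<close> on the disc of radius \<open>B\<close>: logarithmic in \<open>\<epsilon>\<close>, so that the
  Gronwall factor is only \<open>exp (O(T \<bar>ln \<epsilon>\<bar>))\<close>.\<close>

definition lip_const :: "real \<Rightarrow> real \<Rightarrow> real" where
  "lip_const B \<epsilon> = 2 * \<bar>ln \<epsilon>\<bar> + 2 * ln (1 + B) + 2"

lemma dlog_nonlin_bound:
  assumes eps: "0 < \<epsilon>" "\<epsilon> \<le> 1" and z: "norm z \<le> B"
  shows "norm (dlog_nonlin \<epsilon> z v) \<le> lip_const B \<epsilon> * norm v"
proof -
  have p: "\<epsilon> + norm z > 0" using eps by (simp add: add_pos_nonneg)
  have "ln \<epsilon> \<le> ln (\<epsilon> + norm z)" using eps by (subst ln_le_cancel_iff) (auto intro: add_pos_nonneg)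
  moreover have "ln (\<epsilon> + norm z) \<le> ln (1 + B)" using p z eps by (subst ln_le_cancel_iff) auto
  moreover have "0 \<le> ln (1 + B)" using order_trans[OF norm_ge_zero z] by simp
  ultimately have 1: "\<bar>ln (\<epsilon> + norm z)\<bar> \<le> \<bar>ln \<epsilon>\<bar> + ln (1 + B)" by linarith
  have 2: "norm ((2 * (z \<bullet> v) / (norm z * (\<epsilon> + norm z))) *\<^sub>R z) \<le> 2 * norm v"
  proof (cases "z = 0")
    case False
    have "norm ((2 * (z \<bullet> v) / (norm z * (\<epsilon> + norm z))) *\<^sub>R z) = 2 * \<bar>z \<bullet> v\<bar> / (\<epsilon> + norm z)"
      using False p by (simp add: abs_mult)
    also have "\<dots> \<le> 2 * (norm z * norm v) / (\<epsilon> + norm z)"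
      using p by (intro divide_right_mono mult_left_mono Cauchy_Schwarz_ineq2) auto
    also have "\<dots> \<le> 2 * norm v"
      using p eps by (simp add: pos_divide_le_eq) (simp add: algebra_simps)
    finally show ?thesis .
  qed auto
  have "norm (dlog_nonlin \<epsilon> z v) \<le> norm ((2 * ln (\<epsilon> + norm z)) *\<^sub>R v) + norm ((2 * (z \<bullet> v) / (norm z * (\<epsilon> + norm z))) *\<^sub>R z)"
    unfolding dlog_nonlin_def by (rule norm_triangle_ineq)
  also have "\<dots> \<le> 2 * (\<bar>ln \<epsilon>\<bar> + ln (1 + B)) * norm v + 2 * norm v"
    using 1 2 by (intro add_mono) (auto simp: abs_mult intro!: mult_right_mono)
  finally show ?thesis by (simp add: lip_const_def algebra_simps)
qed

text \<open>Change the vector \<open>(z \<bullet> v) z\<close> first and the scalar factor second; with the point of larger norm in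
  the first place the quotients of norms that occur are bounded, and each part costs \<open>2 / \<epsilon>\<close>.\<close>

lemma radial_part_Lipschitz:
  fixes z w v :: complex
  assumes eps: "0 < \<epsilon>" and le: "norm w \<le> norm z"
  shows "norm (((z \<bullet> v) / (norm z * (\<epsilon> + norm z))) *\<^sub>R z - ((w \<bullet> v) / (norm w * (\<epsilon> + norm w))) *\<^sub>R w) \<le> 4 / \<epsilon> * norm (z - w) * norm v"
proof (cases "z = 0")
  case True then show ?thesis using le by simp
next
  case z: False
  define m n where "m = norm z" and "n = norm w"
  have m: "m > 0" "n \<ge> 0" "n \<le> m" using z le by (auto simp: m_def n_def)
  define r s where "r = 1 / (m * (\<epsilon> + m))" and "s = 1 / (n * (\<epsilon> + n))"
  have r: "r \<ge> 0" using m eps by (simp add: r_def)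
  have split: "((z \<bullet> v) / (norm z * (\<epsilon> + norm z))) *\<^sub>R z - ((w \<bullet> v) / (norm w * (\<epsilon> + norm w))) *\<^sub>R w
     = r *\<^sub>R (((z - w) \<bullet> v) *\<^sub>R z + (w \<bullet> v) *\<^sub>R (z - w)) + ((r - s) * (w \<bullet> v)) *\<^sub>R w"
    by (simp add: r_def s_def m_def n_def algebra_simps inner_diff_left divide_inverse scaleR_left_distrib scaleR_left_diff_distrib)
  have "norm (((z - w) \<bullet> v) *\<^sub>R z + (w \<bullet> v) *\<^sub>R (z - w)) \<le> \<bar>(z - w) \<bullet> v\<bar> * m + \<bar>w \<bullet> v\<bar> * norm (z - w)"
    by (rule order_trans[OF norm_triangle_ineq]) (simp add: m_def)
  also have "\<dots> \<le> (norm (z - w) * norm v) * m + (n * norm v) * norm (z - w)"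
    unfolding n_def using m by (intro add_mono mult_right_mono Cauchy_Schwarz_ineq2) auto
  also have "\<dots> \<le> (norm (z - w) * norm v) * m + (m * norm v) * norm (z - w)"
    using m by (intro add_left_mono mult_right_mono) auto
  finally have "r * norm (((z - w) \<bullet> v) *\<^sub>R z + (w \<bullet> v) *\<^sub>R (z - w)) \<le> r * (2 * m * (norm (z - w) * norm v))"
    using r by (intro mult_left_mono) (auto simp: algebra_simps)
  also have "\<dots> = 2 / (\<epsilon> + m) * (norm (z - w) * norm v)" using m by (simp add: r_def)
  also have "\<dots> \<le> 2 / \<epsilon> * (norm (z - w) * norm v)" using m eps by (intro mult_right_mono divide_left_mono) auto
  finally have 1: "norm (r *\<^sub>R (((z - w) \<bullet> v) *\<^sub>R z + (w \<bullet> v) *\<^sub>R (z - w))) \<le> 2 / \<epsilon> * (norm (z - w) * norm v)"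
    using r by simp
  have 2: "norm (((r - s) * (w \<bullet> v)) *\<^sub>R w) \<le> 2 / \<epsilon> * (norm (z - w) * norm v)"
  proof (cases "n = 0")
    case True then have "w = 0" by (simp add: n_def)
    then show ?thesis using eps by simp
  next
    case False
    then have n: "n > 0" using m by simp
    have e2: "\<epsilon> * \<epsilon> \<le> (\<epsilon> + n) * (\<epsilon> + m)" "\<epsilon> \<le> \<epsilon> + n" using n m eps by (auto intro!: mult_mono)
    have sr_eq: "s - r = (m - n) * (\<epsilon> + m + n) / (m * (\<epsilon> + m) * n * (\<epsilon> + n))"
      using m n eps by (simp add: r_def s_def divide_simps) (simp add: algebra_simps)
    have "(s - r) * n * n = (m - n) * ((\<epsilon> + m + n) / (\<epsilon> + m)) * (n / m) * (1 / (\<epsilon> + n))"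
      unfolding sr_eq using m n eps by (simp add: divide_simps)
    also have "\<dots> \<le> (m - n) * 2 * 1 * (1 / \<epsilon>)"
    proof (intro mult_mono)
      show "(\<epsilon> + m + n) / (\<epsilon> + m) \<le> 2" using m n eps by (simp add: divide_simps)
      show "n / m \<le> 1" using m n by simp
      show "1 / (\<epsilon> + n) \<le> 1 / \<epsilon>" using n eps by (intro divide_left_mono) auto
    qed (use m n eps in auto)
    also have "\<dots> \<le> norm (z - w) * 2 * 1 * (1 / \<epsilon>)"
      using norm_triangle_ineq2[of z w] eps by (intro mult_right_mono) (auto simp: m_def n_def)
    finally have snn: "(s - r) * n * n \<le> 2 / \<epsilon> * norm (z - w)" by (simp add: mult.commute)
    have sr: "r \<le> s" unfolding r_def s_def using m n eps by (intro divide_left_mono mult_mono mult_pos_pos) auto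
    have "norm (((r - s) * (w \<bullet> v)) *\<^sub>R w) = (s - r) * \<bar>w \<bullet> v\<bar> * n" using sr by (simp add: abs_mult n_def)
    also have "\<dots> \<le> (s - r) * (n * norm v) * n"
      unfolding n_def using sr by (intro mult_right_mono mult_left_mono Cauchy_Schwarz_ineq2) auto
    also have "\<dots> = ((s - r) * n * n) * norm v" by (simp add: algebra_simps)
    also have "\<dots> \<le> (2 / \<epsilon> * norm (z - w)) * norm v" by (intro mult_right_mono snn) auto
    finally show ?thesis by (simp add: mult.assoc)
  qed
  show ?thesis unfolding split
    by (rule order_trans[OF norm_triangle_ineq order_trans[OF add_mono[OF 1 2]]]) (simp add: field_simps)
qed

lemma dlog_nonlin_Lipschitz:
  assumes eps: "0 < \<epsilon>"
  shows "norm (dlog_nonlin \<epsilon> z v - dlog_nonlin \<epsilon> w v) \<le> 10 / \<epsilon> * norm (z - w) * norm v"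
proof -
  define G where "G z = ((z \<bullet> v) / (norm z * (\<epsilon> + norm z))) *\<^sub>R z" for z
  have G: "norm (G z - G w) \<le> 4 / \<epsilon> * norm (z - w) * norm v"
  proof (cases "norm w \<le> norm z")
    case True then show ?thesis unfolding G_def by (rule radial_part_Lipschitz[OF eps])
  next
    case False
    then have "norm (G w - G z) \<le> 4 / \<epsilon> * norm (w - z) * norm v" unfolding G_def by (intro radial_part_Lipschitz[OF eps]) auto
    then show ?thesis by (simp add: norm_minus_commute)
  qed
  have eq: "dlog_nonlin \<epsilon> z v - dlog_nonlin \<epsilon> w v = (2 * (ln (\<epsilon> + norm z) - ln (\<epsilon> + norm w))) *\<^sub>R v + 2 *\<^sub>R (G z - G w)"
    by (simp add: dlog_nonlin_def G_def algebra_simps)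
  have "\<bar>ln (\<epsilon> + norm z) - ln (\<epsilon> + norm w)\<bar> \<le> \<bar>norm z - norm w\<bar> / \<epsilon>"
    by (rule ln_eps_add_Lipschitz) (use eps in auto)
  also have "\<dots> \<le> norm (z - w) / \<epsilon>" using norm_triangle_ineq3 eps by (intro divide_right_mono) auto
  finally have l: "\<bar>ln (\<epsilon> + norm z) - ln (\<epsilon> + norm w)\<bar> \<le> norm (z - w) / \<epsilon>" .
  have "norm (dlog_nonlin \<epsilon> z v - dlog_nonlin \<epsilon> w v) \<le> 2 * \<bar>ln (\<epsilon> + norm z) - ln (\<epsilon> + norm w)\<bar> * norm v + 2 * norm (G z - G w)"
    unfolding eq by (rule order_trans[OF norm_triangle_ineq]) (simp only: norm_scaleR abs_mult abs_numeral order_refl)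
  also have "\<dots> \<le> 2 * (norm (z - w) / \<epsilon>) * norm v + 2 * (4 / \<epsilon> * norm (z - w) * norm v)"
    using l G by (intro add_mono mult_left_mono mult_right_mono) auto
  finally show ?thesis by (simp add: algebra_simps)
qed

lemma log_nonlin_path_derivative:
  assumes eps: "\<epsilon> > 0"
  shows "((\<lambda>s::real. log_nonlin \<epsilon> (p + s *\<^sub>R d)) has_vector_derivative dlog_nonlin \<epsilon> (p + s *\<^sub>R d) d) (at s within S)"
proof -
  have 1: "((\<lambda>s::real. p + s *\<^sub>R d) has_derivative (\<lambda>h. h *\<^sub>R d)) (at s within S)"
    by (auto intro!: derivative_eq_intros)
  have "((\<lambda>s::real. log_nonlin \<epsilon> (p + s *\<^sub>R d)) has_derivative (\<lambda>h. dlog_nonlin \<epsilon> (p + s *\<^sub>R d) (h *\<^sub>R d))) (at s within S)"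
    by (rule has_derivative_compose[OF 1 log_nonlin_has_derivative[OF eps]])
  moreover have "dlog_nonlin \<epsilon> z (h *\<^sub>R d) = h *\<^sub>R dlog_nonlin \<epsilon> z d" for h z
    using linear_scale[OF has_derivative_linear[OF log_nonlin_has_derivative[OF eps]]] .
  ultimately show ?thesis by (simp add: has_vector_derivative_def)
qed

lemma segment_in_ball:
  fixes c d :: complex
  assumes "norm c \<le> B" "norm d \<le> B" "s \<in> {0..1::real}"
  shows "norm (d + s *\<^sub>R (c - d)) \<le> B"
proof -
  have "norm (d + s *\<^sub>R (c - d)) = norm ((1 - s) *\<^sub>R d + s *\<^sub>R c)" by (simp add: algebra_simps)
  also have "\<dots> \<le> (1 - s) * norm d + s * norm c" using assms(3) by (intro norm_triangle_le) auto
  also have "\<dots> \<le> (1 - s) * B + s * B" using assms by (intro add_mono mult_left_mono) auto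
  finally show ?thesis by (simp add: algebra_simps)
qed

lemma log_nonlin_Lipschitz:
  assumes eps: "0 < \<epsilon>" "\<epsilon> \<le> 1" and B: "norm c \<le> B" "norm d \<le> B"
  shows "norm (log_nonlin \<epsilon> c - log_nonlin \<epsilon> d) \<le> lip_const B \<epsilon> * norm (c - d)"
proof -
  have "norm (log_nonlin \<epsilon> (d + 1 *\<^sub>R (c - d)) - log_nonlin \<epsilon> (d + 0 *\<^sub>R (c - d))) \<le> (lip_const B \<epsilon> * norm (c - d)) * (1 - 0)"
    by (rule vector_increment_le[where f' = "\<lambda>s. dlog_nonlin \<epsilon> (d + s *\<^sub>R (c - d)) (c - d)"])
       (auto intro!: log_nonlin_path_derivative dlog_nonlin_bound segment_in_ball eps B)
  then show ?thesis by simp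
qed

text \<open>The estimate behind the discrete \<open>H\<^sup>1\<close> bound: interpolate both pairs linearly and split the derivative of the
  difference into the variation of the derivative of \<open>log_nonlin\<close>, which costs \<open>1 / \<epsilon>\<close> but comes with the values of the
  error only, and the second difference itself, which comes with the logarithmic constant.\<close>

lemma log_nonlin_second_difference:
  assumes eps: "0 < \<epsilon>" "\<epsilon> \<le> 1" and B: "norm c \<le> B" "norm d \<le> B"
  shows "norm ((log_nonlin \<epsilon> p - log_nonlin \<epsilon> q) - (log_nonlin \<epsilon> c - log_nonlin \<epsilon> d))
     \<le> lip_const B \<epsilon> * norm ((p - q) - (c - d)) + 10 / \<epsilon> * (norm (p - c) + norm (q - d)) * norm (p - q)"
proof -
  define g where "g s = log_nonlin \<epsilon> (q + s *\<^sub>R (p - q)) - log_nonlin \<epsilon> (d + s *\<^sub>R (c - d))" for s :: real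
  define g' where "g' s = dlog_nonlin \<epsilon> (q + s *\<^sub>R (p - q)) (p - q) - dlog_nonlin \<epsilon> (d + s *\<^sub>R (c - d)) (c - d)" for s :: real
  define K where "K = lip_const B \<epsilon> * norm ((p - q) - (c - d)) + 10 / \<epsilon> * (norm (p - c) + norm (q - d)) * norm (p - q)"
  have "norm (g 1 - g 0) \<le> K * (1 - 0)"
  proof (rule vector_increment_le)
    show "(g has_vector_derivative g' s) (at s within {0..1})" for s
      unfolding g_def g'_def by (intro has_vector_derivative_diff log_nonlin_path_derivative eps)
    fix s :: real assume s: "s \<in> {0..1}"
    let ?P = "q + s *\<^sub>R (p - q)" and ?Q = "d + s *\<^sub>R (c - d)"
    have lin: "dlog_nonlin \<epsilon> ?Q (p - q) - dlog_nonlin \<epsilon> ?Q (c - d) = dlog_nonlin \<epsilon> ?Q ((p - q) - (c - d))"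
      by (rule linear_diff[OF has_derivative_linear[OF log_nonlin_has_derivative[OF eps(1)]], symmetric])
    have "g' s = (dlog_nonlin \<epsilon> ?P (p - q) - dlog_nonlin \<epsilon> ?Q (p - q)) + dlog_nonlin \<epsilon> ?Q ((p - q) - (c - d))"
      unfolding lin[symmetric] g'_def by simp
    then have "norm (g' s) \<le> 10 / \<epsilon> * norm (?P - ?Q) * norm (p - q) + lip_const B \<epsilon> * norm ((p - q) - (c - d))"
      using dlog_nonlin_Lipschitz[OF eps(1)] dlog_nonlin_bound[OF eps segment_in_ball[OF B s]]
      by (auto intro!: norm_triangle_le add_mono)
    moreover have "norm (?P - ?Q) \<le> norm (p - c) + norm (q - d)"
    proof -
      have "?P - ?Q = (1 - s) *\<^sub>R (q - d) + s *\<^sub>R (p - c)" by (simp add: algebra_simps)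
      then have "norm (?P - ?Q) \<le> (1 - s) * norm (q - d) + s * norm (p - c)" using s by (auto intro!: norm_triangle_le)
      also have "\<dots> \<le> 1 * norm (q - d) + 1 * norm (p - c)" using s by (intro add_mono mult_right_mono) auto
      finally show ?thesis by simp
    qed
    then have "10 / \<epsilon> * norm (?P - ?Q) * norm (p - q) \<le> 10 / \<epsilon> * (norm (p - c) + norm (q - d)) * norm (p - q)"
      using eps by (intro mult_right_mono mult_left_mono) auto
    ultimately show "norm (g' s) \<le> K" unfolding K_def by linarith
  qed auto
  moreover have "(log_nonlin \<epsilon> p - log_nonlin \<epsilon> q) - (log_nonlin \<epsilon> c - log_nonlin \<epsilon> d) = g 1 - g 0"
    by (simp add: g_def)
  ultimately show ?thesis by (simp only: K_def) simp
qed

section \<open>Errors of difference quotients\<close>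

lemma shift_right_derivative:
  fixes f :: "real \<Rightarrow> complex"
  assumes "(f has_vector_derivative f') (at (x + s) within S)" "\<And>s. s \<in> I \<Longrightarrow> x + s \<in> S"
  shows "((\<lambda>s. f (x + s)) has_vector_derivative f') (at s within I)"
proof -
  have "((\<lambda>s. x + s) has_vector_derivative 1) (at s within I)" by (auto intro!: derivative_eq_intros)
  moreover have "(f has_vector_derivative f') (at (x + s) within (\<lambda>s. x + s) ` I)"
    by (rule has_vector_derivative_within_subset[OF assms(1)]) (use assms(2) in auto)
  ultimately show ?thesis using vector_diff_chain_within[of "\<lambda>s. x + s" 1 s I f f'] by (simp add: o_def)
qed

lemma shift_left_derivative:
  fixes f :: "real \<Rightarrow> complex"
  assumes "(f has_vector_derivative f') (at (x - s) within S)" "\<And>s. s \<in> I \<Longrightarrow> x - s \<in> S"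
  shows "((\<lambda>s. f (x - s)) has_vector_derivative - f') (at s within I)"
proof -
  have "((\<lambda>s. x - s) has_vector_derivative -1) (at s within I)" by (auto intro!: derivative_eq_intros)
  moreover have "(f has_vector_derivative f') (at (x - s) within (\<lambda>s. x - s) ` I)"
    by (rule has_vector_derivative_within_subset[OF assms(1)]) (use assms(2) in auto)
  ultimately show ?thesis using vector_diff_chain_within[of "\<lambda>s. x - s" "-1" s I f f'] by (simp add: o_def)
qed

lemma norm_le_of_derivative_from_0:
  fixes p :: "real \<Rightarrow> complex"
  assumes p0: "p 0 = 0" and der: "\<And>s. s \<in> {0..h} \<Longrightarrow> (p has_vector_derivative p' s) (at s within {0..h})"
    and B: "\<And>s. s \<in> {0..h} \<Longrightarrow> norm (p' s) \<le> B" and s: "s \<in> {0..h}"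
  shows "norm (p s) \<le> B * h"
proof -
  have "norm (p s - p 0) \<le> B * (s - 0)"
  proof (rule vector_increment_le)
    show "(p has_vector_derivative p' y) (at y within {0..s})" if "y \<in> {0..s}" for y
      by (rule has_vector_derivative_within_subset[OF der]) (use that s in auto)
  qed (use s B in auto)
  also have "\<dots> \<le> B * h" using s order_trans[OF norm_ge_zero B[OF s]] by (intro mult_left_mono) auto
  finally show ?thesis using p0 by simp
qed

text \<open>Only the oscillation of the third derivative enters, so that a fourth derivative that is
  merely integrable suffices in the applications. The remainder as a function of the step, together with its first two derivatives,
  vanishes at \<open>0\<close>.\<close>

lemma second_difference_error:
  fixes y0 y1 y2 y3 :: "real \<Rightarrow> complex"
  assumes h: "h \<ge> 0" and x: "l \<le> x - h" "x + h \<le> r"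
    and d0: "\<And>z. z \<in> {l..r} \<Longrightarrow> (y0 has_vector_derivative y1 z) (at z within {l..r})"
    and d1: "\<And>z. z \<in> {l..r} \<Longrightarrow> (y1 has_vector_derivative y2 z) (at z within {l..r})"
    and d2: "\<And>z. z \<in> {l..r} \<Longrightarrow> (y2 has_vector_derivative y3 z) (at z within {l..r})"
    and A: "\<And>p q. x - h \<le> p \<Longrightarrow> p \<le> q \<Longrightarrow> q \<le> x + h \<Longrightarrow> norm (y3 q - y3 p) \<le> A"
  shows "norm (y0 (x + h) - 2 * y0 x + y0 (x - h) - complex_of_real (h\<^sup>2) * y2 x) \<le> h ^ 3 * A"
proof -
  have I: "x + s \<in> {l..r}" "x - s \<in> {l..r}" if "s \<in> {0..h}" for s using that x h by auto
  have sh: "(f has_vector_derivative f') (at (x + s) within {l..r}) \<Longrightarrow> ((\<lambda>s. f (x + s)) has_vector_derivative f') (at s within {0..h})"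
    "(f has_vector_derivative f') (at (x - s) within {l..r}) \<Longrightarrow> ((\<lambda>s. f (x - s)) has_vector_derivative - f') (at s within {0..h})"
    for f :: "real \<Rightarrow> complex" and f' s
    by (auto intro: shift_right_derivative shift_left_derivative I)
  have 2: "norm (y2 (x + s) + y2 (x - s) - 2 * y2 x) \<le> A * h" if "s \<in> {0..h}" for s
  proof (rule norm_le_of_derivative_from_0[OF _ _ _ that, where p = "\<lambda>s. y2 (x + s) + y2 (x - s) - 2 * y2 x" and p' = "\<lambda>s. y3 (x + s) - y3 (x - s)"])
    show "((\<lambda>s. y2 (x + s) + y2 (x - s) - 2 * y2 x) has_vector_derivative y3 (x + s) - y3 (x - s)) (at s within {0..h})" if "s \<in> {0..h}" for s
      using has_vector_derivative_diff[OF has_vector_derivative_add[OF sh(1)[OF d2[OF I(1)[OF that]]] sh(2)[OF d2[OF I(2)[OF that]]]] has_vector_derivative_const] by simp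
    show "norm (y3 (x + s) - y3 (x - s)) \<le> A" if "s \<in> {0..h}" for s using that by (intro A) auto
  qed auto
  have 1: "norm (y1 (x + s) - y1 (x - s) - complex_of_real (2 * s) * y2 x) \<le> (A * h) * h" if "s \<in> {0..h}" for s
  proof (rule norm_le_of_derivative_from_0[OF _ _ 2 that, where p = "\<lambda>s. y1 (x + s) - y1 (x - s) - complex_of_real (2 * s) * y2 x"])
    show "((\<lambda>s. y1 (x + s) - y1 (x - s) - complex_of_real (2 * s) * y2 x) has_vector_derivative y2 (x + s) + y2 (x - s) - 2 * y2 x) (at s within {0..h})" if s: "s \<in> {0..h}" for s
    proof -
      have "((\<lambda>s. complex_of_real (2 * s) * y2 x) has_vector_derivative 2 * y2 x) (at s within {0..h})"
        by (auto intro!: derivative_eq_intros)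
      from has_vector_derivative_diff[OF has_vector_derivative_diff[OF sh(1)[OF d1[OF I(1)[OF s]]] sh(2)[OF d1[OF I(2)[OF s]]]] this]
      show ?thesis by simp
    qed
  qed auto
  have "norm (y0 (x + h) + y0 (x - h) - 2 * y0 x - complex_of_real (h\<^sup>2) * y2 x) \<le> ((A * h) * h) * h"
  proof (rule norm_le_of_derivative_from_0[OF _ _ 1, where p = "\<lambda>s. y0 (x + s) + y0 (x - s) - 2 * y0 x - complex_of_real (s\<^sup>2) * y2 x"])
    show "((\<lambda>s. y0 (x + s) + y0 (x - s) - 2 * y0 x - complex_of_real (s\<^sup>2) * y2 x) has_vector_derivative y1 (x + s) - y1 (x - s) - complex_of_real (2 * s) * y2 x) (at s within {0..h})" if s: "s \<in> {0..h}" for s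
    proof -
      have "((\<lambda>s. (s\<^sup>2) *\<^sub>R y2 x) has_vector_derivative (2 * s) *\<^sub>R y2 x) (at s within {0..h})"
        unfolding has_vector_derivative_def by (auto intro!: derivative_eq_intros simp: algebra_simps)
      then have "((\<lambda>s. complex_of_real (s\<^sup>2) * y2 x) has_vector_derivative complex_of_real (2 * s) * y2 x) (at s within {0..h})"
        by (simp add: scaleR_conv_of_real)
      from has_vector_derivative_diff[OF has_vector_derivative_diff[OF has_vector_derivative_add[OF sh(1)[OF d0[OF I(1)[OF s]]] sh(2)[OF d0[OF I(2)[OF s]]]] has_vector_derivative_const] this]
      show ?thesis by simp
    qed
  qed (use h in auto)
  then show ?thesis by (simp add: algebra_simps power3_eq_cube)
qed

lemma average_error:
  fixes y0 y1 y2 :: "real \<Rightarrow> complex"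
  assumes h: "h \<ge> 0" and x: "l \<le> x - h" "x + h \<le> r"
    and d0: "\<And>z. z \<in> {l..r} \<Longrightarrow> (y0 has_vector_derivative y1 z) (at z within {l..r})"
    and d1: "\<And>z. z \<in> {l..r} \<Longrightarrow> (y1 has_vector_derivative y2 z) (at z within {l..r})"
    and B: "\<And>z. z \<in> {l..r} \<Longrightarrow> norm (y2 z) \<le> B"
  shows "norm (y0 (x + h) + y0 (x - h) - 2 * y0 x) \<le> 2 * B * h\<^sup>2"
proof -
  have I: "x + s \<in> {l..r}" "x - s \<in> {l..r}" if "s \<in> {0..h}" for s using that x h by auto
  have sh: "(f has_vector_derivative f') (at (x + s) within {l..r}) \<Longrightarrow> ((\<lambda>s. f (x + s)) has_vector_derivative f') (at s within {0..h})"
    "(f has_vector_derivative f') (at (x - s) within {l..r}) \<Longrightarrow> ((\<lambda>s. f (x - s)) has_vector_derivative - f') (at s within {0..h})"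
    for f :: "real \<Rightarrow> complex" and f' s
    by (auto intro: shift_right_derivative shift_left_derivative I)
  have 1: "norm (y1 (x + s) - y1 (x - s)) \<le> (2 * B) * h" if "s \<in> {0..h}" for s
  proof (rule norm_le_of_derivative_from_0[OF _ _ _ that, where p = "\<lambda>s. y1 (x + s) - y1 (x - s)" and p' = "\<lambda>s. y2 (x + s) + y2 (x - s)"])
    show "((\<lambda>s. y1 (x + s) - y1 (x - s)) has_vector_derivative y2 (x + s) + y2 (x - s)) (at s within {0..h})" if s: "s \<in> {0..h}" for s
      using has_vector_derivative_diff[OF sh(1)[OF d1[OF I(1)[OF s]]] sh(2)[OF d1[OF I(2)[OF s]]]] by simp
    show "norm (y2 (x + s) + y2 (x - s)) \<le> 2 * B" if "s \<in> {0..h}" for s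
      using norm_triangle_ineq[of "y2 (x + s)" "y2 (x - s)"] B[OF I(1)[OF that]] B[OF I(2)[OF that]] by simp
  qed auto
  have "norm (y0 (x + h) + y0 (x - h) - 2 * y0 x) \<le> ((2 * B) * h) * h"
  proof (rule norm_le_of_derivative_from_0[OF _ _ 1, where p = "\<lambda>s. y0 (x + s) + y0 (x - s) - 2 * y0 x"])
    show "((\<lambda>s. y0 (x + s) + y0 (x - s) - 2 * y0 x) has_vector_derivative y1 (x + s) - y1 (x - s)) (at s within {0..h})" if s: "s \<in> {0..h}" for s
      using has_vector_derivative_diff[OF has_vector_derivative_add[OF sh(1)[OF d0[OF I(1)[OF s]]] sh(2)[OF d0[OF I(2)[OF s]]]] has_vector_derivative_const] by simp
  qed (use h in auto)
  then show ?thesis by (simp add: algebra_simps power2_eq_square)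
qed

lemma central_difference_error:
  fixes y0 y1 y2 y3 :: "real \<Rightarrow> complex"
  assumes h: "h \<ge> 0" and x: "l \<le> x - h" "x + h \<le> r"
    and d0: "\<And>z. z \<in> {l..r} \<Longrightarrow> (y0 has_vector_derivative y1 z) (at z within {l..r})"
    and d1: "\<And>z. z \<in> {l..r} \<Longrightarrow> (y1 has_vector_derivative y2 z) (at z within {l..r})"
    and d2: "\<And>z. z \<in> {l..r} \<Longrightarrow> (y2 has_vector_derivative y3 z) (at z within {l..r})"
    and B: "\<And>z. z \<in> {l..r} \<Longrightarrow> norm (y3 z) \<le> B"
  shows "norm (y0 (x + h) - y0 (x - h) - complex_of_real (2 * h) * y1 x) \<le> 2 * B * h ^ 3"
proof -
  have I: "x + s \<in> {l..r}" "x - s \<in> {l..r}" if "s \<in> {0..h}" for s using that x h by auto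
  have sh: "(f has_vector_derivative f') (at (x + s) within {l..r}) \<Longrightarrow> ((\<lambda>s. f (x + s)) has_vector_derivative f') (at s within {0..h})"
    "(f has_vector_derivative f') (at (x - s) within {l..r}) \<Longrightarrow> ((\<lambda>s. f (x - s)) has_vector_derivative - f') (at s within {0..h})"
    for f :: "real \<Rightarrow> complex" and f' s
    by (auto intro: shift_right_derivative shift_left_derivative I)
  have B0: "B \<ge> 0" using order_trans[OF norm_ge_zero B[of x]] x h by auto
  have 1: "norm (y1 (x + s) + y1 (x - s) - 2 * y1 x) \<le> 2 * B * h\<^sup>2" if s: "s \<in> {0..h}" for s
  proof -
    have "norm (y1 (x + s) + y1 (x - s) - 2 * y1 x) \<le> 2 * B * s\<^sup>2"
      by (rule average_error[where l = l and r = r and ?y1.0 = y2 and ?y2.0 = y3]) (use s x d1 d2 B in auto)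
    also have "\<dots> \<le> 2 * B * h\<^sup>2" using s B0 by (intro mult_left_mono power_mono) auto
    finally show ?thesis .
  qed
  have "norm (y0 (x + h) - y0 (x - h) - complex_of_real (2 * h) * y1 x) \<le> (2 * B * h\<^sup>2) * h"
  proof (rule norm_le_of_derivative_from_0[OF _ _ 1, where p = "\<lambda>s. y0 (x + s) - y0 (x - s) - complex_of_real (2 * s) * y1 x"])
    show "((\<lambda>s. y0 (x + s) - y0 (x - s) - complex_of_real (2 * s) * y1 x) has_vector_derivative y1 (x + s) + y1 (x - s) - 2 * y1 x) (at s within {0..h})" if s: "s \<in> {0..h}" for s
    proof -
      have "((\<lambda>s. complex_of_real (2 * s) * y1 x) has_vector_derivative 2 * y1 x) (at s within {0..h})"
        by (auto intro!: derivative_eq_intros)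
      from has_vector_derivative_diff[OF has_vector_derivative_diff[OF sh(1)[OF d0[OF I(1)[OF s]]] sh(2)[OF d0[OF I(2)[OF s]]]] this]
      show ?thesis by simp
    qed
  qed (use h in auto)
  then show ?thesis by (simp add: algebra_simps power2_eq_square power3_eq_cube)
qed

lemma Taylor_1_error:
  fixes y0 y1 y2 :: "real \<Rightarrow> complex"
  assumes h: "h \<ge> 0" and x: "l \<le> x" "x + h \<le> r"
    and d0: "\<And>z. z \<in> {l..r} \<Longrightarrow> (y0 has_vector_derivative y1 z) (at z within {l..r})"
    and d1: "\<And>z. z \<in> {l..r} \<Longrightarrow> (y1 has_vector_derivative y2 z) (at z within {l..r})"
    and B: "\<And>z. z \<in> {l..r} \<Longrightarrow> norm (y2 z) \<le> B"
  shows "norm (y0 (x + h) - y0 x - complex_of_real h * y1 x) \<le> B * h\<^sup>2"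
proof -
  have I: "x + s \<in> {l..r}" if "s \<in> {0..h}" for s using that x h by auto
  have sh: "(f has_vector_derivative f') (at (x + s) within {l..r}) \<Longrightarrow> ((\<lambda>s. f (x + s)) has_vector_derivative f') (at s within {0..h})"
    for f :: "real \<Rightarrow> complex" and f' s
    by (auto intro: shift_right_derivative I)
  have 1: "norm (y1 (x + s) - y1 x) \<le> B * h" if "s \<in> {0..h}" for s
  proof (rule norm_le_of_derivative_from_0[OF _ _ _ that, where p = "\<lambda>s. y1 (x + s) - y1 x" and p' = "\<lambda>s. y2 (x + s)"])
    show "((\<lambda>s. y1 (x + s) - y1 x) has_vector_derivative y2 (x + s)) (at s within {0..h})" if s: "s \<in> {0..h}" for s
      using has_vector_derivative_diff[OF sh[OF d1[OF I[OF s]]] has_vector_derivative_const] by simp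
  qed (use B I in auto)
  have "norm (y0 (x + h) - y0 x - complex_of_real h * y1 x) \<le> (B * h) * h"
  proof (rule norm_le_of_derivative_from_0[OF _ _ 1, where p = "\<lambda>s. y0 (x + s) - y0 x - complex_of_real s * y1 x"])
    show "((\<lambda>s. y0 (x + s) - y0 x - complex_of_real s * y1 x) has_vector_derivative y1 (x + s) - y1 x) (at s within {0..h})" if s: "s \<in> {0..h}" for s
    proof -
      have "((\<lambda>s. complex_of_real s * y1 x) has_vector_derivative y1 x) (at s within {0..h})"
        by (auto intro!: derivative_eq_intros)
      from has_vector_derivative_diff[OF has_vector_derivative_diff[OF sh[OF d0[OF I[OF s]]] has_vector_derivative_const] this]
      show ?thesis by simp
    qed
  qed (use h in auto)
  then show ?thesis by (simp add: algebra_simps power2_eq_square)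
qed

lemma sum_wide_increments:
  fixes \<Phi> :: "nat \<Rightarrow> real"
  shows "(\<Sum>j=1..n. \<Phi> (j + 1) - \<Phi> (j - 1)) = \<Phi> (n + 1) + \<Phi> n - \<Phi> 1 - \<Phi> 0"
  by (induction n) auto

section \<open>The error equation of the scheme\<close>

text \<open>The number \<open>K\<close> of time steps is a parameter: the estimates are used with \<open>K\<close> the time level of interest.\<close>

locale SIFD_grid = log_evolution +
  fixes M :: nat and \<tau> :: real and K :: nat and U :: "nat \<Rightarrow> nat \<Rightarrow> complex"
  assumes M: "M \<ge> 1" and \<tau>: "\<tau> > 0" and K: "real K * \<tau> \<le> T" and SIFD: "SIFD_solution a b M \<tau> \<epsilon> u0 U"
begin

definition h where "h = grid_width a b M"
definition xg where "xg = grid_point a b M"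

lemma h_pos: "h > 0" using ab M by (simp add: h_def grid_width_def)

lemma Mh: "real M * h = b - a" using M by (simp add: h_def grid_width_def)

lemma xg_eq: "xg j = a + real j * h" by (simp add: xg_def grid_point_def h_def)

lemma xg_in: "j \<le> M \<Longrightarrow> xg j \<in> {a..b}"
  using h_pos Mh mult_right_mono[of "real j" "real M" h] by (auto simp: xg_eq)

lemma xg_ends: "xg 0 = a" "xg M = b" using Mh by (auto simp: xg_eq)

lemma tk_in: "k \<le> K \<Longrightarrow> real k * \<tau> \<in> {0..T}"
  using \<tau> order_trans[OF mult_right_mono[of "real k" "real K" \<tau>] K] by auto

lemma delta_xp_bound:
  assumes d: "\<And>x. x \<in> {a..b} \<Longrightarrow> (G has_vector_derivative G' x) (at x within {a..b})"
    and c: "\<And>x. x \<in> {a..b} \<Longrightarrow> norm (G' x) \<le> c" and j: "j < M"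
  shows "cmod (delta_xp h (\<lambda>j. G (xg j)) j) \<le> c"
proof -
  have le: "xg j \<le> xg (j + 1)" "{xg j..xg (j + 1)} \<subseteq> {a..b}"
    using h_pos xg_in[of j] xg_in[of "j + 1"] j by (auto simp: xg_eq)
  have "norm (G (xg (j + 1)) - G (xg j)) \<le> c * (xg (j + 1) - xg j)"
  proof (rule vector_increment_le[OF le(1)])
    show "(G has_vector_derivative G' y) (at y within {xg j..xg (j + 1)})" if "y \<in> {xg j..xg (j + 1)}" for y
      by (rule has_vector_derivative_within_subset[OF d le(2)]) (use that le in auto)
  qed (use le c in auto)
  also have "xg (j + 1) - xg j = h" by (simp add: xg_eq algebra_simps)
  finally show ?thesis using h_pos by (simp add: delta_xp_def norm_divide divide_le_eq)
qed

text \<open>The spatial truncation error of \<open>g\<close> at the interior grid points.\<close>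

definition trunc :: "(real \<Rightarrow> complex) \<Rightarrow> nat \<Rightarrow> complex" where
  "trunc g j = delta_xx h (\<lambda>l. cd 0 g (xg l)) j - cd 2 g (xg j)"

text \<open>An \<open>\<ell>\<^sup>1\<close> bound over the grid needs the fourth derivative only in \<open>L\<^sup>1\<close>, and this is what the
  corrector requires. Every cell is counted twice in the sum.\<close>

lemma trunc_sum_le:
  assumes g: "g \<in> H 4"
  shows "h * (\<Sum>j=1..M-1. cmod (trunc g j)) \<le> 2 * h\<^sup>2 * weak_L1 4 g"
proof -
  define \<Phi> where "\<Phi> j = integral {a..xg j} (\<lambda>x. norm (wd 4 g x))" for j
  have int: "(\<lambda>x. norm (wd 4 g x)) integrable_on {p..q}" if "a \<le> p" "q \<le> b" for p q
    by (rule weak_deriv_integrable(2)[OF g]) (use that in auto)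
  have \<Phi>_nonneg: "0 \<le> \<Phi> j" if "j \<le> M" for j
    unfolding \<Phi>_def by (rule Henstock_Kurzweil_Integration.integral_nonneg[OF int]) (use xg_in[OF that] in auto)
  have \<Phi>_le: "\<Phi> j \<le> weak_L1 4 g" if "j \<le> M" for j
    unfolding \<Phi>_def weak_L1_def by (rule integral_subset_le) (use xg_in[OF that] in \<open>auto intro!: int\<close>)
  have one: "cmod (trunc g j) \<le> h * (\<Phi> (j + 1) - \<Phi> (j - 1))" if j: "j \<in> {1..M-1}" for j
  proof -
    have x1: "xg (j + 1) = xg j + h" by (simp add: xg_eq algebra_simps)
    have x2: "xg (j - 1) = xg j - h" using j by (cases j) (auto simp: xg_eq algebra_simps)
    have in1: "xg (j + 1) \<in> {a..b}" "xg (j - 1) \<in> {a..b}"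
      by (rule xg_in; use j in auto)+
    define A where "A = \<Phi> (j + 1) - \<Phi> (j - 1)"
    have A: "A = integral {xg (j - 1)..xg (j + 1)} (\<lambda>x. norm (wd 4 g x))"
      unfolding A_def \<Phi>_def
      using Henstock_Kurzweil_Integration.integral_combine[of a "xg (j - 1)" "xg (j + 1)" "\<lambda>x. norm (wd 4 g x)"] in1 x1 x2 h_pos int
      by auto
    have err: "norm (cd 0 g (xg j + h) - 2 * cd 0 g (xg j) + cd 0 g (xg j - h) - complex_of_real (h\<^sup>2) * cd 2 g (xg j)) \<le> h ^ 3 * A"
    proof (rule second_difference_error[where l = a and r = b and ?y1.0 = "cd 1 g" and ?y3.0 = "cd 3 g"])
      show "h \<ge> 0" "a \<le> xg j - h" "xg j + h \<le> b" using h_pos in1 x1 x2 by auto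
      show "(cd 0 g has_vector_derivative cd 1 g z) (at z within {a..b})" if "z \<in> {a..b}" for z
        using cd_has_vector_derivative[OF g, of 0 z] that by simp
      show "(cd 1 g has_vector_derivative cd 2 g z) (at z within {a..b})" if "z \<in> {a..b}" for z
        using cd_has_vector_derivative[OF g, of 1 z] that by (simp add: Suc_1[symmetric])
      show "(cd 2 g has_vector_derivative cd 3 g z) (at z within {a..b})" if "z \<in> {a..b}" for z
        using cd_has_vector_derivative[OF g, of 2 z] that by (simp add: eval_nat_numeral)
      fix p q assume pq: "xg j - h \<le> p" "p \<le> q" "q \<le> xg j + h"
      have pa: "a \<le> p" and qb: "q \<le> b" using pq in1 x1 x2 by auto
      have "cd 3 g q - cd 3 g p = integral {p..q} (wd 4 g)"
        using cd_diff_eq_integral[OF g _ pa pq(2) qb, of 3] by simp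
      moreover have "norm (integral {p..q} (wd 4 g)) \<le> integral {p..q} (\<lambda>x. norm (wd 4 g x))"
        by (rule integral_norm_bound_integral[OF weak_deriv_integrable(1)[OF g] int[OF pa qb]]) (use pa qb in auto)
      ultimately have "norm (cd 3 g q - cd 3 g p) \<le> integral {p..q} (\<lambda>x. norm (wd 4 g x))" by simp
      also have "\<dots> \<le> A" unfolding A
        by (rule integral_subset_le) (use pq x1 x2 pa qb in1 in \<open>auto intro!: int\<close>)
      finally show "norm (cd 3 g q - cd 3 g p) \<le> A" .
    qed
    have "trunc g j = (cd 0 g (xg j + h) - 2 * cd 0 g (xg j) + cd 0 g (xg j - h) - complex_of_real (h\<^sup>2) * cd 2 g (xg j)) / complex_of_real (h\<^sup>2)"
      using h_pos by (simp add: trunc_def delta_xx_def x1[simplified] x2[simplified] diff_divide_distrib)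
    then have "cmod (trunc g j) \<le> (h ^ 3 * A) / h\<^sup>2"
      using err by (simp add: norm_divide norm_power divide_right_mono)
    also have "\<dots> = h * A" using h_pos by (simp add: power2_eq_square power3_eq_cube)
    finally show ?thesis by (simp add: A_def)
  qed
  have "(\<Sum>j=1..M-1. cmod (trunc g j)) \<le> (\<Sum>j=1..M-1. h * (\<Phi> (j + 1) - \<Phi> (j - 1)))"
    by (rule sum_mono[OF one])
  also have "\<dots> = h * (\<Phi> (M - 1 + 1) + \<Phi> (M - 1) - \<Phi> 1 - \<Phi> 0)"
    unfolding sum_distrib_left[symmetric] sum_wide_increments ..
  also have "\<dots> \<le> h * (weak_L1 4 g + weak_L1 4 g)"
    using h_pos \<Phi>_le[of M] \<Phi>_le[of "M - 1"] \<Phi>_nonneg[of 1] \<Phi>_nonneg[of 0] M by (intro mult_left_mono) auto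
  finally have "(\<Sum>j=1..M-1. cmod (trunc g j)) \<le> h * (weak_L1 4 g + weak_L1 4 g)" .
  then have "h * (\<Sum>j=1..M-1. cmod (trunc g j)) \<le> h * (h * (weak_L1 4 g + weak_L1 4 g))"
    using h_pos by (intro mult_left_mono) auto
  then show ?thesis by (simp add: power2_eq_square)
qed

end

lemma delta_xx_add: "delta_xx h (\<lambda>l. f l + g l) j = delta_xx h f j + delta_xx h g j"
  and delta_xx_diff: "delta_xx h (\<lambda>l. f l - g l) j = delta_xx h f j - delta_xx h g j"
  by (simp_all add: delta_xx_def add_divide_distrib diff_divide_distrib algebra_simps)

context SIFD_grid
begin

abbreviation tk :: "nat \<Rightarrow> real" where "tk k \<equiv> real k * \<tau>"

definition ug where "ug k j = fd 0 0 (tk k) (xg j)"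
definition eta where "eta k = ritz h M (trunc (D 0 (tk k)))"
definition err where "err k j = ug k j - U k j"
definition theta where "theta k j = err k j - eta k j"

lemma D0_H4: "k \<le> K \<Longrightarrow> D 0 (tk k) \<in> H 4"
  using D_in_sobolev(2)[of 0] tk_in by auto

lemma delta_xp_eta_bound:
  assumes k: "k \<le> K" and j: "j < M"
  shows "cmod (delta_xp h (eta k) j) \<le> 4 * KB * h\<^sup>2"
proof -
  have "cmod (delta_xp h (eta k) j) \<le> 2 * (h * (\<Sum>i=1..M-1. cmod (trunc (D 0 (tk k)) i)))"
    unfolding eta_def by (rule delta_xp_ritz_bound[OF h_pos j])
  also have "\<dots> \<le> 2 * (2 * h\<^sup>2 * weak_L1 4 (D 0 (tk k)))"
    by (intro mult_left_mono trunc_sum_le D0_H4 k) auto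
  also have "\<dots> \<le> 2 * (2 * h\<^sup>2 * KB)"
    by (intro mult_left_mono weak_L1_bounds(1) tk_in k) auto
  finally show ?thesis by (simp add: mult_ac)
qed

text \<open>The corrector depends linearly on \<open>u\<close>, so that its time increment is the corrector of the time increment of \<open>u\<close>,
  whose fourth derivative is of size \<open>\<tau>\<close> in \<open>L\<^sup>1\<close>.\<close>

lemma delta_xp_eta_increment_bound:
  assumes k: "1 \<le> k" "k + 1 \<le> K" and j: "j < M"
  shows "cmod (delta_xp h (\<lambda>j. eta (k + 1) j - eta (k - 1) j) j) \<le> 8 * KB * h\<^sup>2 * \<tau>"
proof -
  let ?p = "D 0 (tk (k + 1))" and ?m = "D 0 (tk (k - 1))"
  have H4: "?p \<in> H 4" "?m \<in> H 4" by (rule D0_H4; use k in simp)+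
  have tr: "trunc ?p i - trunc ?m i = trunc (\<lambda>x. ?p x - ?m x) i" if i: "i \<in> {1..M-1}" for i
  proof -
    have I: "xg i \<in> {a..b}" "xg (i + 1) \<in> {a..b}" "xg (i - 1) \<in> {a..b}"
      by (rule xg_in; use i in auto)+
    show ?thesis unfolding trunc_def delta_xx_def
      using cd_diff[OF H4, of 0] cd_diff[OF H4, of 2] I
      by (simp add: add_divide_distrib diff_divide_distrib)
  qed
  have "(\<lambda>j. eta (k + 1) j - eta (k - 1) j) = ritz h M (\<lambda>i. trunc ?p i - trunc ?m i)"
    by (auto simp: eta_def ritz_diff)
  then have "cmod (delta_xp h (\<lambda>j. eta (k + 1) j - eta (k - 1) j) j) \<le> 2 * (h * (\<Sum>i=1..M-1. cmod (trunc ?p i - trunc ?m i)))"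
    using delta_xp_ritz_bound[OF h_pos j, of "\<lambda>i. trunc ?p i - trunc ?m i"] by simp
  also have "(\<Sum>i=1..M-1. cmod (trunc ?p i - trunc ?m i)) = (\<Sum>i=1..M-1. cmod (trunc (\<lambda>x. ?p x - ?m x) i))"
    by (intro sum.cong refl) (simp only: tr)
  also have "2 * (h * (\<Sum>i=1..M-1. cmod (trunc (\<lambda>x. ?p x - ?m x) i))) \<le> 2 * (2 * h\<^sup>2 * weak_L1 4 (\<lambda>x. ?p x - ?m x))"
    by (intro mult_left_mono trunc_sum_le sobolev_diff H4) auto
  also have "\<dots> \<le> 2 * (2 * h\<^sup>2 * (KB * (tk (k + 1) - tk (k - 1))))"
    by (intro mult_left_mono weak_L1_4_increment) (use tk_in[of "k + 1"] k \<tau> in auto)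
  also have "tk (k + 1) - tk (k - 1) = 2 * \<tau>" using k by (simp add: algebra_simps of_nat_diff)
  finally show ?thesis by (simp add: mult_ac)
qed

lemma delta_xx_eta:
  assumes j: "j \<in> {1..M-1}"
  shows "delta_xx h (eta k) j = delta_xx h (ug k) j - fd 0 2 (tk k) (xg j)"
  using delta_xx_ritz[OF h_pos, of j M "trunc (D 0 (tk k))"] j
  by (simp add: eta_def trunc_def ug_def[abs_def] fd_def)

lemma grid_functions_vanish_at_ends:
  assumes k: "k \<le> K" and j: "j = 0 \<or> j = M"
  shows "ug k j = 0" "U k j = 0" "eta k j = 0" "err k j = 0" "theta k j = 0"
proof -
  show 1: "ug k j = 0" using fd_boundary(1)[OF tk_in[OF k], of "xg j"] j xg_ends by (auto simp: ug_def)
  show 2: "U k j = 0" using SIFD j unfolding SIFD_solution_def by blast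
  show 3: "eta k j = 0" using j ritz_boundary M by (auto simp: eta_def)
  show 4: "err k j = 0" using 1 2 by (simp add: err_def)
  show "theta k j = 0" using 3 4 by (simp add: theta_def)
qed

text \<open>The parts of the residual: time discretization, averaging of the second space derivative in
  time, time difference of the corrector, and difference of the nonlinear terms.\<close>

definition res_t where
  "res_t k j = \<i> * ((ug (k + 1) j - ug (k - 1) j) / complex_of_real (2 * \<tau>) - fd 1 0 (tk k) (xg j))"
definition res_x where
  "res_x k j = (fd 0 2 (tk (k + 1)) (xg j) + fd 0 2 (tk (k - 1)) (xg j)) / 2 - fd 0 2 (tk k) (xg j)"
definition res_eta where
  "res_eta k j = (- \<i> / complex_of_real (2 * \<tau>)) * (eta (k + 1) j - eta (k - 1) j)"
definition res_lin where "res_lin k j = res_t k j + res_x k j + res_eta k j"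
definition res_nonlin where "res_nonlin k j = log_nonlin \<epsilon> (ug k j) - log_nonlin \<epsilon> (U k j)"

text \<open>Since \<open>\<delta>\<^sub>x\<^sup>2 \<theta> = u\<^sub>x\<^sub>x - \<delta>\<^sub>x\<^sup>2 U\<close>, the spatial truncation error has disappeared from the equation.\<close>

lemma theta_scheme:
  assumes k: "1 \<le> k" "k + 1 \<le> K" and j: "j \<in> {1..M-1}"
  shows "\<i> * ((theta (k + 1) j - theta (k - 1) j) / complex_of_real (2 * \<tau>)) =
     - (1/2) * delta_xx h (\<lambda>l. theta (k + 1) l + theta (k - 1) l) j + (res_lin k j + res_nonlin k j)"
proof -
  have j': "xg j \<in> {a..b}" by (rule xg_in) (use j in auto)
  have kK: "k \<le> K" using k by simp
  define A1 A2 A3 where "A1 = (ug (k + 1) j - ug (k - 1) j) / complex_of_real (2 * \<tau>)"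
    and "A2 = (U (k + 1) j - U (k - 1) j) / complex_of_real (2 * \<tau>)"
    and "A3 = (eta (k + 1) j - eta (k - 1) j) / complex_of_real (2 * \<tau>)"
  define V where "V k = fd 0 2 (tk k) (xg j)" for k
  define DU where "DU k = delta_xx h (U k) j" for k
  have scheme: "\<i> * A2 = - (1/2) * (DU (k + 1) + DU (k - 1)) + log_nonlin \<epsilon> (U k j)"
    using SIFD k j unfolding SIFD_solution_def A2_def DU_def delta_tc_def h_def[symmetric]
    by (auto simp: delta_xx_add)
  have pde': "\<i> * fd 1 0 (tk k) (xg j) + V k = log_nonlin \<epsilon> (ug k j)"
    unfolding V_def ug_def using pde[OF tk_in[OF kK] j'] u_eq_fd[OF tk_in[OF kK] j'] by simp
  have dth: "delta_xx h (theta k) j = V k - DU k" for k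
    unfolding theta_def[abs_def] err_def delta_xx_diff delta_xx_eta[OF j] V_def DU_def by simp
  have "(theta (k + 1) j - theta (k - 1) j) / complex_of_real (2 * \<tau>) = A1 - A2 - A3"
    unfolding A1_def A2_def A3_def theta_def err_def diff_divide_distrib by simp
  moreover have "res_lin k j = \<i> * (A1 - fd 1 0 (tk k) (xg j)) + ((V (k + 1) + V (k - 1)) / 2 - V k) - \<i> * A3"
    unfolding res_lin_def res_t_def res_x_def res_eta_def A1_def A3_def V_def by simp
  moreover have "delta_xx h (\<lambda>l. theta (k + 1) l + theta (k - 1) l) j = V (k + 1) - DU (k + 1) + (V (k - 1) - DU (k - 1))"
    unfolding delta_xx_add dth ..
  moreover have "\<i> * (A1 - A2 - A3) = - (1/2) * (V (k + 1) - DU (k + 1) + (V (k - 1) - DU (k - 1))) +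
     (\<i> * (A1 - fd 1 0 (tk k) (xg j)) + ((V (k + 1) + V (k - 1)) / 2 - V k) - \<i> * A3 + res_nonlin k j)"
    unfolding res_nonlin_def pde'[symmetric] using scheme by (simp add: algebra_simps add_divide_distrib diff_divide_distrib)
  ultimately show ?thesis by simp
qed

lemma res_boundary:
  assumes k: "1 \<le> k" "k + 1 \<le> K" and j: "j = 0 \<or> j = M"
  shows "res_lin k j = 0" "res_nonlin k j = 0"
proof -
  have x: "xg j = a \<or> xg j = b" using j xg_ends by auto
  have t: "tk k \<in> {0..T}" "tk (k + 1) \<in> {0..T}" "tk (k - 1) \<in> {0..T}" by (rule tk_in; use k in simp)+
  show "res_lin k j = 0"
    using grid_functions_vanish_at_ends(1,3)[OF _ j, of "k + 1"] grid_functions_vanish_at_ends(1,3)[OF _ j, of "k - 1"] k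
      fd_boundary[OF t(1) x] fd_boundary[OF t(2) x] fd_boundary[OF t(3) x]
    by (simp add: res_lin_def res_t_def res_x_def res_eta_def)
  show "res_nonlin k j = 0" using grid_functions_vanish_at_ends(1,2)[OF _ j, of k] k by (simp add: res_nonlin_def)
qed

lemma delta_xp_scale: "delta_xp h (\<lambda>j. c * f j) j = c * delta_xp h f j"
  by (simp add: delta_xp_def algebra_simps)

lemma delta_xp_res_lin_bound:
  assumes k: "1 \<le> k" "k + 1 \<le> K" and j: "j < M"
  shows "cmod (delta_xp h (res_lin k) j) \<le> (2 * KF + 4 * KB) * (h\<^sup>2 + \<tau>\<^sup>2)"
proof -
  let ?t = "tk k"
  have t: "tk k \<in> {0..T}" "tk (k + 1) \<in> {0..T}" "tk (k - 1) \<in> {0..T}" by (rule tk_in; use k in simp)+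
  have tp: "tk (k + 1) = ?t + \<tau>" "tk (k - 1) = ?t - \<tau>" using k by (auto simp: algebra_simps of_nat_diff)
  have ts: "\<tau> \<ge> 0" "0 \<le> ?t - \<tau>" "?t + \<tau> \<le> T" using \<tau> t(2,3)[unfolded tp] by auto
  have 1: "cmod (delta_xp h (res_t k) j) \<le> KF * \<tau>\<^sup>2"
  proof -
    let ?G = "\<lambda>i x. \<i> * ((fd 0 i (tk (k + 1)) x - fd 0 i (tk (k - 1)) x) / complex_of_real (2 * \<tau>) - fd 1 i ?t x)"
    have eq: "res_t k = (\<lambda>j. ?G 0 (xg j))" by (auto simp: res_t_def ug_def)
    show ?thesis unfolding eq
    proof (rule delta_xp_bound[OF _ _ j, where G = "?G 0" and G' = "?G 1"])
      fix x assume x: "x \<in> {a..b}"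
      have d: "(fd i 0 s has_vector_derivative fd i 1 s x) (at x within {a..b})" if "i \<le> 1" "s \<in> {0..T}" for i s
        using fd_space_deriv(1)[OF that(2) x, of i 0] that by simp
      have dd: "((\<lambda>x. c * f x) has_vector_derivative c * f') (at x within {a..b})" if "(f has_vector_derivative f') (at x within {a..b})" for c f' :: complex and f
        using bounded_linear.has_vector_derivative[OF bounded_linear_mult_right that] .
      have "(?G 0 has_vector_derivative \<i> * ((1 / complex_of_real (2 * \<tau>)) * (fd 0 1 (tk (k + 1)) x - fd 0 1 (tk (k - 1)) x) - fd 1 1 ?t x)) (at x within {a..b})"
        using dd[OF has_vector_derivative_diff[OF dd[OF has_vector_derivative_diff[OF d[of 0, OF _ t(2)] d[of 0, OF _ t(3)]], of "1 / complex_of_real (2 * \<tau>)"] d[of 1, OF _ t(1)]], of "\<i>"]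
        by simp
      then show "(?G 0 has_vector_derivative ?G 1 x) (at x within {a..b})" by simp
      have "norm (fd 0 1 (?t + \<tau>) x - fd 0 1 (?t - \<tau>) x - complex_of_real (2 * \<tau>) * fd 1 1 ?t x) \<le> 2 * KF * \<tau> ^ 3"
      proof (rule central_difference_error[OF ts, where ?y0.0 = "\<lambda>s. fd 0 1 s x" and ?y1.0 = "\<lambda>s. fd 1 1 s x" and ?y2.0 = "\<lambda>s. fd 2 1 s x" and ?y3.0 = "\<lambda>s. fd 3 1 s x"])
        fix z assume z: "z \<in> {0..T}"
        show "((\<lambda>s. fd 0 1 s x) has_vector_derivative fd 1 1 z x) (at z within {0..T})"
          using fd_time_deriv(2)[OF z x, of 0 1] by simp
        show "((\<lambda>s. fd 1 1 s x) has_vector_derivative fd 2 1 z x) (at z within {0..T})"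
          using fd_time_deriv(2)[OF z x, of 1 1] by (simp add: Suc_1[symmetric])
        show "((\<lambda>s. fd 2 1 s x) has_vector_derivative fd 3 1 z x) (at z within {0..T})"
          using fd_time_deriv(2)[OF z x, of 2 1] by (simp add: eval_nat_numeral)
        show "norm (fd 3 1 z x) \<le> KF" using fd_bound(2)[OF z x] by simp
      qed
      moreover have "?G 1 x = \<i> * ((fd 0 1 (?t + \<tau>) x - fd 0 1 (?t - \<tau>) x - complex_of_real (2 * \<tau>) * fd 1 1 ?t x) / complex_of_real (2 * \<tau>))"
        unfolding tp using \<tau> by (simp add: diff_divide_distrib)
      ultimately have "norm (?G 1 x) \<le> (2 * KF * \<tau> ^ 3) / (2 * \<tau>)"
        using \<tau> divide_right_mono[of _ "2 * KF * \<tau> ^ 3" "2 * \<tau>"] by (simp add: norm_mult norm_divide)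
      also have "\<dots> = KF * \<tau>\<^sup>2" using \<tau> by (simp add: power2_eq_square power3_eq_cube)
      finally show "norm (?G 1 x) \<le> KF * \<tau>\<^sup>2" .
    qed
  qed
  have 2: "cmod (delta_xp h (res_x k) j) \<le> KF * \<tau>\<^sup>2"
  proof -
    let ?G = "\<lambda>i x. (1/2) * (fd 0 i (tk (k + 1)) x + fd 0 i (tk (k - 1)) x) - fd 0 i ?t x"
    have eq: "res_x k = (\<lambda>j. ?G 2 (xg j))" by (auto simp: res_x_def)
    show ?thesis unfolding eq
    proof (rule delta_xp_bound[OF _ _ j, where G = "?G 2" and G' = "?G 3"])
      fix x assume x: "x \<in> {a..b}"
      have d: "(fd 0 2 s has_vector_derivative fd 0 3 s x) (at x within {a..b})" if "s \<in> {0..T}" for s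
        using fd_space_deriv(1)[OF that(1) x, of 0 2] by (simp add: eval_nat_numeral)
      have dd: "((\<lambda>x. c * f x) has_vector_derivative c * f') (at x within {a..b})" if "(f has_vector_derivative f') (at x within {a..b})" for c f' :: complex and f
        using bounded_linear.has_vector_derivative[OF bounded_linear_mult_right that] .
      show "(?G 2 has_vector_derivative ?G 3 x) (at x within {a..b})"
        by (intro has_vector_derivative_diff dd has_vector_derivative_add d t)
      have avg: "norm (fd 0 3 (?t + \<tau>) x + fd 0 3 (?t - \<tau>) x - 2 * fd 0 3 ?t x) \<le> 2 * KF * \<tau>\<^sup>2"
      proof (rule average_error[OF ts, where ?y0.0 = "\<lambda>s. fd 0 3 s x" and ?y1.0 = "\<lambda>s. fd 1 3 s x" and ?y2.0 = "\<lambda>s. fd 2 3 s x"])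
        fix z assume z: "z \<in> {0..T}"
        show "((\<lambda>s. fd 0 3 s x) has_vector_derivative fd 1 3 z x) (at z within {0..T})"
          using fd_time_deriv(1)[OF z x, of 0 3] by simp
        show "((\<lambda>s. fd 1 3 s x) has_vector_derivative fd 2 3 z x) (at z within {0..T})"
          using fd_time_deriv(1)[OF z x, of 1 3] by (simp add: Suc_1[symmetric])
        show "norm (fd 2 3 z x) \<le> KF" using fd_bound(1)[OF z x] by simp
      qed
      have eq3: "?G 3 x = (1/2) * (fd 0 3 (?t + \<tau>) x + fd 0 3 (?t - \<tau>) x - 2 * fd 0 3 ?t x)"
        unfolding tp by (simp add: algebra_simps)
      show "norm (?G 3 x) \<le> KF * \<tau>\<^sup>2"
        by (subst eq3) (use avg in \<open>simp add: norm_mult norm_divide\<close>)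
    qed
  qed
  have 3: "cmod (delta_xp h (res_eta k) j) \<le> 4 * KB * h\<^sup>2"
  proof -
    have "delta_xp h (res_eta k) j = (- \<i> / complex_of_real (2 * \<tau>)) * delta_xp h (\<lambda>j. eta (k + 1) j - eta (k - 1) j) j"
      unfolding res_eta_def[abs_def] delta_xp_scale ..
    then have "cmod (delta_xp h (res_eta k) j) = cmod (delta_xp h (\<lambda>j. eta (k + 1) j - eta (k - 1) j) j) / (2 * \<tau>)"
      using \<tau> by (simp add: norm_mult norm_divide)
    also have "\<dots> \<le> (8 * KB * h\<^sup>2 * \<tau>) / (2 * \<tau>)"
      using \<tau> by (intro divide_right_mono delta_xp_eta_increment_bound k j) auto
    finally show ?thesis using \<tau> by simp
  qed
  have "cmod (delta_xp h (res_lin k) j) \<le> cmod (delta_xp h (res_t k) j) + cmod (delta_xp h (res_x k) j) + cmod (delta_xp h (res_eta k) j)"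
    unfolding res_lin_def[abs_def] delta_xp_add by (intro norm_triangle_le add_mono norm_triangle_ineq order_refl)
  also have "\<dots> \<le> KF * \<tau>\<^sup>2 + KF * \<tau>\<^sup>2 + 4 * KB * h\<^sup>2" using 1 2 3 by (intro add_mono)
  also have "\<dots> \<le> (2 * KF + 4 * KB) * (h\<^sup>2 + \<tau>\<^sup>2)" using KF_pos KB_ge(2) by (simp add: algebra_simps)
  finally show ?thesis .
qed

lemma initial_error_bound:
  assumes K1: "1 \<le> K" and j: "j < M"
  shows "cmod (delta_xp h (err 1) j) \<le> KF * \<tau>\<^sup>2"
proof -
  have t: "(0::real) \<in> {0..T}" "\<tau> \<in> {0..T}" using tk_in[of 0] tk_in[of 1] K1 by auto
  let ?G = "\<lambda>i x. fd 0 i \<tau> x - fd 0 i 0 x - complex_of_real \<tau> * fd 1 i 0 x"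
  have U1: "U 1 l = fd 0 0 0 (xg l) + complex_of_real \<tau> * fd 1 0 0 (xg l)" if l: "l \<le> M" for l
  proof -
    have "U 1 l = U 0 l + complex_of_real \<tau> * initial_velocity a b \<epsilon> u0 (xg l)" "U 0 l = u0 (xg l)"
      using SIFD l by (auto simp: SIFD_solution_def xg_def)
    then show ?thesis using initial_velocity_eq[OF xg_in[OF l]] u_eq_fd[OF t(1) xg_in[OF l]] initial_value[OF xg_in[OF l]] by simp
  qed
  have e: "err 1 l = ?G 0 (xg l)" if "l \<le> M" for l
    using U1[OF that] by (simp add: err_def ug_def)
  have "delta_xp h (err 1) j = delta_xp h (\<lambda>l. ?G 0 (xg l)) j"
    unfolding delta_xp_def using e[of j] e[of "j + 1"] j by simp
  also have "cmod \<dots> \<le> KF * \<tau>\<^sup>2"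
  proof (rule delta_xp_bound[OF _ _ j, where G = "?G 0" and G' = "?G 1"])
    fix x assume x: "x \<in> {a..b}"
    have d: "(fd i 0 s has_vector_derivative fd i 1 s x) (at x within {a..b})" if "i \<le> 1" "s \<in> {0..T}" for i s
      using fd_space_deriv(1)[OF that(2) x, of i 0] that by simp
    have dd: "((\<lambda>x. c * f x) has_vector_derivative c * f') (at x within {a..b})" if "(f has_vector_derivative f') (at x within {a..b})" for c f' :: complex and f
      using bounded_linear.has_vector_derivative[OF bounded_linear_mult_right that] .
    show "(?G 0 has_vector_derivative ?G 1 x) (at x within {a..b})"
      by (intro has_vector_derivative_diff dd d t) auto
    have "norm (fd 0 1 (0 + \<tau>) x - fd 0 1 0 x - complex_of_real \<tau> * fd 1 1 0 x) \<le> KF * \<tau>\<^sup>2"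
    proof (rule Taylor_1_error[where l = 0 and r = T and ?y0.0 = "\<lambda>s. fd 0 1 s x" and ?y1.0 = "\<lambda>s. fd 1 1 s x" and ?y2.0 = "\<lambda>s. fd 2 1 s x"])
      fix z assume z: "z \<in> {0..T}"
      show "((\<lambda>s. fd 0 1 s x) has_vector_derivative fd 1 1 z x) (at z within {0..T})"
        using fd_time_deriv(2)[OF z x, of 0 1] by simp
      show "((\<lambda>s. fd 1 1 s x) has_vector_derivative fd 2 1 z x) (at z within {0..T})"
        using fd_time_deriv(2)[OF z x, of 1 1] by (simp add: Suc_1[symmetric])
      show "norm (fd 2 1 z x) \<le> KF" using fd_bound(2)[OF z x] by simp
    qed (use t in auto)
    then show "norm (?G 1 x) \<le> KF * \<tau>\<^sup>2" by simp
  qed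
  finally show ?thesis .
qed

lemma err_0: "j \<le> M \<Longrightarrow> err 0 j = 0"
  using SIFD u_eq_fd[OF tk_in[of 0] xg_in] initial_value[OF xg_in]
  by (auto simp: err_def ug_def SIFD_solution_def xg_def)

end

section \<open>The error estimate\<close>

context SIFD_grid
begin

text \<open>The weight \<open>1 / \<epsilon>\<close> lets the term \<open>(1 / \<epsilon>) \<parallel>err\<parallel>\<close> in the \<open>H\<^sup>1\<close> estimate of the nonlinearity be absorbed with
  a constant independent of \<open>\<epsilon>\<close>.\<close>

definition wnorm :: "(nat \<Rightarrow> complex) \<Rightarrow> real" where
  "wnorm z = disc_H1_seminorm h M z + disc_L2_norm h M z / \<epsilon>"

lemma wnorm_triangle: "wnorm (\<lambda>j. z j + w j) \<le> wnorm z + wnorm w"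
proof -
  have "disc_L2_norm h M (\<lambda>j. z j + w j) / \<epsilon> \<le> (disc_L2_norm h M z + disc_L2_norm h M w) / \<epsilon>"
    using h_pos eps by (intro divide_right_mono disc_L2_norm_triangle) auto
  then show ?thesis using disc_H1_seminorm_triangle[of h M z w] h_pos by (simp add: wnorm_def add_divide_distrib)
qed

text \<open>The factor between a pointwise bound on the difference quotients and \<open>wnorm\<close>.\<close>

definition wscale :: real where "wscale = sqrt (b - a) * (1 + (b - a) / \<epsilon>)"

lemma wscale_nonneg: "wscale \<ge> 0" using ab eps by (simp add: wscale_def)

lemma wnorm_le_pointwise:
  assumes z0: "z 0 = 0" and c: "c \<ge> 0" "\<And>j. j < M \<Longrightarrow> cmod (delta_xp h z j) \<le> c"
  shows "wnorm z \<le> wscale * c"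
proof -
  have 1: "disc_H1_seminorm h M z \<le> sqrt (b - a) * c"
    using disc_H1_seminorm_le_sup[where M = M, OF h_pos c] Mh by simp
  have "disc_L2_norm h M z \<le> (b - a) * disc_H1_seminorm h M z"
    using discrete_Poincare[where v = z and M = M, OF h_pos z0] Mh by simp
  also have "\<dots> \<le> (b - a) * (sqrt (b - a) * c)" using 1 ab by (intro mult_left_mono) auto
  finally have "disc_L2_norm h M z / \<epsilon> \<le> ((b - a) * (sqrt (b - a) * c)) / \<epsilon>" using eps by (intro divide_right_mono) auto
  then show ?thesis using 1 by (simp add: wnorm_def wscale_def algebra_simps)
qed

lemma wnorm_eta: "k \<le> K \<Longrightarrow> wnorm (eta k) \<le> wscale * (4 * KB * h\<^sup>2)"
  using KB_ge(2) by (intro wnorm_le_pointwise delta_xp_eta_bound) (auto simp: eta_def ritz_boundary)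

lemma wnorm_res_lin:
  assumes "1 \<le> k" "k + 1 \<le> K"
  shows "wnorm (res_lin k) \<le> wscale * ((2 * KF + 4 * KB) * (h\<^sup>2 + \<tau>\<^sup>2))"
  using KB_ge(2) KF_pos by (intro wnorm_le_pointwise delta_xp_res_lin_bound assms res_boundary(1)) (auto intro!: mult_nonneg_nonneg)

text \<open>The rate in the Gronwall argument: the Lipschitz constant on the disc of radius \<open>KF + 1\<close>, which contains the values of
  both the exact and the numerical solution, and the contribution of the second differences.\<close>

definition growth :: real where "growth = lip_const (KF + 1) \<epsilon> + 20 * KF"

lemma lip_const_ge: "lip_const (KF + 1) \<epsilon> \<ge> 2"
  using KF_pos by (auto simp: lip_const_def)

lemma growth_ge: "growth \<ge> 1" using lip_const_ge KF_pos by (simp add: growth_def)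

lemma delta_xp_ug_bound:
  assumes k: "k \<le> K" and j: "j < M" shows "cmod (delta_xp h (ug k) j) \<le> KF"
proof -
  have "cmod (delta_xp h (\<lambda>j. fd 0 0 (tk k) (xg j)) j) \<le> KF"
  proof (rule delta_xp_bound[OF _ _ j])
    fix x assume x: "x \<in> {a..b}"
    show "(fd 0 0 (tk k) has_vector_derivative fd 0 1 (tk k) x) (at x within {a..b})"
      using fd_space_deriv(1)[OF tk_in[OF k] x, of 0 0] by simp
    show "norm (fd 0 1 (tk k) x) \<le> KF" by (rule fd_bound(1)[OF tk_in[OF k] x]) auto
  qed
  then show ?thesis by (simp add: ug_def[abs_def])
qed

lemma wnorm_res_nonlin:
  assumes eps1: "\<epsilon> \<le> 1" and k: "k \<le> K" and U: "\<And>j. j \<le> M \<Longrightarrow> norm (U k j) \<le> KF + 1"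
  shows "wnorm (res_nonlin k) \<le> growth * wnorm (err k)"
proof -
  let ?L = "lip_const (KF + 1) \<epsilon>"
  have ug: "norm (ug k j) \<le> KF + 1" if "j \<le> M" for j
    using fd_bound(1)[OF tk_in[OF k] xg_in[OF that], of 0 0] by (simp add: ug_def)
  have L2: "disc_L2_norm h M (res_nonlin k) \<le> ?L * disc_L2_norm h M (err k) + 0 * disc_L2_norm h M (err k)"
  proof (rule disc_L2_norm_mono)
    show "cmod (res_nonlin k j) \<le> ?L * cmod (err k j) + 0 * cmod (err k j)" if "j \<in> {1..M-1}" for j
      using log_nonlin_Lipschitz[OF eps eps1 ug[of j] U[of j]] that by (auto simp: res_nonlin_def err_def)
  qed (use h_pos lip_const_ge in auto)
  have H1: "disc_H1_seminorm h M (res_nonlin k) \<le> ?L * disc_H1_seminorm h M (err k) + 2 * (10 / \<epsilon> * KF) * disc_L2_norm h M (err k)"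
  proof (rule disc_H1_seminorm_le_pointwise[OF h_pos])
    show "err k 0 = 0" "err k M = 0" using grid_functions_vanish_at_ends(4)[OF k] by auto
    show "?L \<ge> 0" "10 / \<epsilon> * KF \<ge> 0" using lip_const_ge KF_pos eps by auto
    fix j assume j: "j < M"
    have du: "norm (ug k (j + 1) - ug k j) \<le> KF * h"
      using delta_xp_ug_bound[OF k j] h_pos by (simp add: delta_xp_def norm_divide divide_le_eq)
    have "norm (res_nonlin k (j + 1) - res_nonlin k j) =
      norm ((log_nonlin \<epsilon> (ug k (j + 1)) - log_nonlin \<epsilon> (ug k j)) - (log_nonlin \<epsilon> (U k (j + 1)) - log_nonlin \<epsilon> (U k j)))"
      by (simp add: res_nonlin_def algebra_simps)
    also have "\<dots> \<le> ?L * norm ((ug k (j + 1) - ug k j) - (U k (j + 1) - U k j))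
        + 10 / \<epsilon> * (norm (ug k (j + 1) - U k (j + 1)) + norm (ug k j - U k j)) * norm (ug k (j + 1) - ug k j)"
      by (rule log_nonlin_second_difference[OF eps eps1]) (use U j in auto)
    also have "\<dots> \<le> ?L * norm (err k (j + 1) - err k j) + 10 / \<epsilon> * (norm (err k (j + 1)) + norm (err k j)) * (KF * h)"
    proof -
      have "norm ((ug k (j + 1) - ug k j) - (U k (j + 1) - U k j)) = norm (err k (j + 1) - err k j)"
        by (simp add: err_def algebra_simps)
      then show ?thesis
        unfolding err_def[symmetric] using du eps lip_const_ge by (intro add_mono mult_left_mono) auto
    qed
    finally have "norm (res_nonlin k (j + 1) - res_nonlin k j) / h \<le>
        (?L * norm (err k (j + 1) - err k j) + 10 / \<epsilon> * (norm (err k (j + 1)) + norm (err k j)) * (KF * h)) / h"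
      using h_pos by (intro divide_right_mono) auto
    also have "\<dots> = ?L * (norm (err k (j + 1) - err k j) / h) + 10 / \<epsilon> * KF * (norm (err k j) + norm (err k (j + 1)))"
      using h_pos eps by (simp add: field_simps)
    finally show "cmod (delta_xp h (res_nonlin k) j) \<le> ?L * cmod (delta_xp h (err k) j) + 10 / \<epsilon> * KF * (cmod (err k j) + cmod (err k (j + 1)))"
      using h_pos by (simp add: delta_xp_def norm_divide)
  qed
  have "wnorm (res_nonlin k) \<le> (?L * disc_H1_seminorm h M (err k) + 2 * (10 / \<epsilon> * KF) * disc_L2_norm h M (err k)) + (?L * disc_L2_norm h M (err k)) / \<epsilon>"
    unfolding wnorm_def using H1 L2 eps by (intro add_mono divide_right_mono) auto
  also have "\<dots> = growth * wnorm (err k) - 20 * KF * disc_H1_seminorm h M (err k)"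
    using eps by (simp add: wnorm_def growth_def field_simps)
  also have "\<dots> \<le> growth * wnorm (err k)"
    using KF_pos disc_H1_seminorm_nonneg[of h M "err k"] h_pos by simp
  finally show ?thesis .
qed

lemma wnorm_theta_step:
  assumes k: "1 \<le> k" "k + 1 \<le> K"
  shows "wnorm (theta (k + 1)) \<le> wnorm (theta (k - 1)) + 2 * \<tau> * wnorm (\<lambda>j. res_lin k j + res_nonlin k j)"
proof -
  let ?R = "\<lambda>j. res_lin k j + res_nonlin k j"
  have bd: "theta (k + 1) 0 = 0" "theta (k + 1) M = 0" "theta (k - 1) 0 = 0" "theta (k - 1) M = 0"
    by (rule grid_functions_vanish_at_ends(5); use k in simp)+
  have R: "?R 0 = 0" "?R M = 0" using res_boundary[OF k] by auto
  note eq = theta_scheme[OF k]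
  have H1: "disc_H1_seminorm h M (theta (k + 1)) \<le> disc_H1_seminorm h M (theta (k - 1)) + 2 * \<tau> * disc_H1_seminorm h M ?R"
    by (rule discrete_Schroedinger_energy_H1[OF h_pos \<tau> M bd R eq])
  have "disc_L2_norm h M (theta (k + 1)) \<le> disc_L2_norm h M (theta (k - 1)) + 2 * \<tau> * disc_L2_norm h M ?R"
    by (rule discrete_Schroedinger_energy_L2[OF h_pos \<tau> M bd eq])
  then have "disc_L2_norm h M (theta (k + 1)) / \<epsilon> \<le> (disc_L2_norm h M (theta (k - 1)) + 2 * \<tau> * disc_L2_norm h M ?R) / \<epsilon>"
    using eps by (intro divide_right_mono) auto
  then show ?thesis using H1 by (simp add: wnorm_def add_divide_distrib algebra_simps)
qed

lemma err_sup_le_wnorm: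
  assumes k: "k \<le> K" and j: "j \<le> M" shows "cmod (err k j) \<le> sqrt (b - a) * wnorm (err k)"
proof -
  have "cmod (err k j) \<le> sqrt (b - a) * disc_H1_seminorm h M (err k)"
    using disc_sup_le_H1_seminorm[where v = "err k", OF h_pos grid_functions_vanish_at_ends(4)[OF k, of 0] j] Mh by simp
  also have "\<dots> \<le> sqrt (b - a) * wnorm (err k)"
    using ab eps disc_L2_norm_nonneg[of h M "err k"] h_pos by (intro mult_left_mono) (auto simp: wnorm_def)
  finally show ?thesis .
qed

definition err_bound :: real where
  "err_bound = (16 * KB + 3 * KF) * growth * wscale * exp (2 * growth * T) * (h\<^sup>2 + \<tau>\<^sup>2)"

text \<open>The smallness assumption is used at level \<open>k\<close> to bound \<open>U\<close> by \<open>KF + 1\<close> there, which makes the recursion from levels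
  \<open>k - 1\<close> and \<open>k\<close> to \<open>k + 1\<close> available.\<close>

theorem err_estimate:
  assumes eps1: "\<epsilon> \<le> 1" and small: "sqrt (b - a) * err_bound \<le> 1" and k: "k \<le> K"
  shows "wnorm (err k) \<le> err_bound" "\<And>j. j \<le> M \<Longrightarrow> cmod (err k j) \<le> 1"
proof -
  define P where "P = wscale * (h\<^sup>2 + \<tau>\<^sup>2)"
  define G where "G = growth"
  define m where "m = (4 * KB + KF) * P"
  define S where "S = (G * (4 * KB) + 2 * KF + 4 * KB) * P"
  have G: "G \<ge> 1" using growth_ge by (simp add: G_def)
  have KBp: "KB > 0" by (rule KB_ge(2))
  have P: "P \<ge> 0" using wscale_nonneg by (simp add: P_def)
  have m0: "m \<ge> 0" using P KBp KF_pos by (simp add: m_def)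
  have S0: "S \<ge> 0" using P KBp KF_pos G by (simp add: S_def)
  have etaP: "wnorm (eta k) \<le> 4 * KB * P" if "k \<le> K" for k
  proof -
    have "wscale * (4 * KB * h\<^sup>2) \<le> wscale * (4 * KB * (h\<^sup>2 + \<tau>\<^sup>2))"
      using wscale_nonneg KBp by (intro mult_left_mono) auto
    then show ?thesis using wnorm_eta[OF that] by (simp add: P_def mult_ac)
  qed
  have err_le: "wnorm (err k) \<le> wnorm (theta k) + 4 * KB * P" if "k \<le> K" for k
    using wnorm_triangle[of "theta k" "eta k"] etaP[OF that] by (simp add: theta_def)
  have pw: "(1 + 2 * \<tau> * G) ^ k \<le> exp (2 * G * T)" if k: "k \<le> K" for k
  proof -
    have "(1 + 2 * \<tau> * G) ^ k \<le> exp (2 * \<tau> * G) ^ k"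
      using \<tau> G by (intro power_mono exp_ge_add_one_self) auto
    also have "\<dots> = exp (2 * G * tk k)" by (simp add: exp_of_nat_mult[symmetric] mult_ac)
    also have "\<dots> \<le> exp (2 * G * T)" using tk_in[OF k] G by simp
    finally show ?thesis .
  qed
  have mS: "m + S + 4 * KB * P \<le> (16 * KB + 3 * KF) * G * P"
  proof -
    have "(12 * KB + 3 * KF) * P \<le> G * ((12 * KB + 3 * KF) * P)"
      using G KBp KF_pos P mult_right_mono[of 1 G "(12 * KB + 3 * KF) * P"] by simp
    then show ?thesis by (simp add: m_def S_def algebra_simps)
  qed
  have exp1: "1 \<le> exp (2 * G * T)" using G T by simp
  have conv: "wnorm (err k) \<le> err_bound" if k: "k \<le> K" and N: "wnorm (theta k) \<le> (m + S) * (1 + 2 * \<tau> * G) ^ k" for k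
  proof -
    have "wnorm (theta k) \<le> (m + S) * exp (2 * G * T)"
      using N mult_left_mono[OF pw[OF k], of "m + S"] m0 S0 by linarith
    moreover have "4 * KB * P * 1 \<le> 4 * KB * P * exp (2 * G * T)"
      using exp1 KBp P by (intro mult_left_mono) auto
    ultimately have "wnorm (err k) \<le> (m + S + 4 * KB * P) * exp (2 * G * T)"
      using err_le[OF k] by (simp add: algebra_simps)
    also have "\<dots> \<le> ((16 * KB + 3 * KF) * G * P) * exp (2 * G * T)" using mS by (intro mult_right_mono) auto
    finally show ?thesis by (simp add: err_bound_def P_def G_def mult_ac)
  qed
  have sup1: "cmod (err k j) \<le> 1" if k: "k \<le> K" and j: "j \<le> M" and N: "wnorm (theta k) \<le> (m + S) * (1 + 2 * \<tau> * G) ^ k" for k j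
  proof -
    have "cmod (err k j) \<le> sqrt (b - a) * wnorm (err k)" by (rule err_sup_le_wnorm[OF k j])
    also have "\<dots> \<le> sqrt (b - a) * err_bound" using ab conv[OF k N] by (intro mult_left_mono) auto
    finally show ?thesis using small by simp
  qed
  have th_init: "wnorm (theta i) \<le> m" if i: "i \<le> K" "i = 0 \<or> i = 1" for i
  proof -
    have "wnorm (theta i) \<le> wscale * (4 * KB * h\<^sup>2 + KF * \<tau>\<^sup>2)"
    proof (rule wnorm_le_pointwise)
      show "theta i 0 = 0" by (rule grid_functions_vanish_at_ends(5)) (use i in auto)
      show "0 \<le> 4 * KB * h\<^sup>2 + KF * \<tau>\<^sup>2" using KBp KF_pos by simp
      fix j assume j: "j < M"
      have e: "cmod (delta_xp h (err i) j) \<le> KF * \<tau>\<^sup>2"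
        using i(2)
      proof
        assume "i = 0"
        then have "delta_xp h (err i) j = 0" using err_0[of j] err_0[of "j + 1"] j by (simp add: delta_xp_def)
        then show ?thesis using KF_pos by simp
      qed (use initial_error_bound[OF _ j] i in auto)
      have "delta_xp h (theta i) j = delta_xp h (err i) j - delta_xp h (eta i) j"
        by (simp add: theta_def delta_xp_def diff_divide_distrib)
      then have "cmod (delta_xp h (theta i) j) \<le> cmod (delta_xp h (err i) j) + cmod (delta_xp h (eta i) j)"
        by (simp add: norm_triangle_ineq4)
      then show "cmod (delta_xp h (theta i) j) \<le> 4 * KB * h\<^sup>2 + KF * \<tau>\<^sup>2"
        using e delta_xp_eta_bound[OF i(1) j] by simp
    qed
    also have "\<dots> \<le> wscale * ((4 * KB + KF) * (h\<^sup>2 + \<tau>\<^sup>2))"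
      using wscale_nonneg KBp KF_pos by (intro mult_left_mono) (auto simp: algebra_simps)
    finally show ?thesis by (simp add: m_def P_def mult_ac)
  qed
  \<comment> \<open>the bound at level \<open>k\<close> controls \<open>U k\<close>, hence the nonlinear residual at that level\<close>
  have gron: "wnorm (theta k) \<le> (m + S) * (1 + 2 * \<tau> * G) ^ k" if "k \<le> K" for k
  proof (rule two_step_Gronwall[where N = "\<lambda>k. wnorm (theta k)" and K = K, OF G less_imp_le[OF \<tau>] S0 _ _ m0 _ that])
    show "wnorm (theta 0) \<le> m" by (rule th_init) auto
    show "wnorm (theta 1) \<le> m" if "1 \<le> K" by (rule th_init) (use that in auto)
    fix k assume k1: "1 \<le> k" "k + 1 \<le> K" and N: "wnorm (theta k) \<le> (m + S) * (1 + 2 * \<tau> * G) ^ k"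
    have kK: "k \<le> K" using k1 by simp
    have U: "norm (U k j) \<le> KF + 1" if j: "j \<le> M" for j
    proof -
      have "norm (ug k j) \<le> KF" using fd_bound(1)[OF tk_in[OF kK] xg_in[OF j], of 0 0] by (simp add: ug_def)
      moreover have "norm (U k j) \<le> norm (ug k j) + norm (err k j)"
        using norm_triangle_ineq4[of "ug k j" "err k j"] by (simp add: err_def)
      ultimately show ?thesis using sup1[OF kK j N] by simp
    qed
    have "wnorm (\<lambda>j. res_lin k j + res_nonlin k j) \<le> wnorm (res_lin k) + wnorm (res_nonlin k)"
      by (rule wnorm_triangle)
    also have "\<dots> \<le> wscale * ((2 * KF + 4 * KB) * (h\<^sup>2 + \<tau>\<^sup>2)) + G * wnorm (err k)"
      unfolding G_def by (intro add_mono wnorm_res_lin wnorm_res_nonlin eps1 kK k1 U)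
    also have "\<dots> \<le> wscale * ((2 * KF + 4 * KB) * (h\<^sup>2 + \<tau>\<^sup>2)) + G * (wnorm (theta k) + 4 * KB * P)"
      using G err_le[OF kK] by (intro add_left_mono mult_left_mono) auto
    also have "\<dots> = G * wnorm (theta k) + S" by (simp add: S_def P_def algebra_simps)
    finally have "wnorm (\<lambda>j. res_lin k j + res_nonlin k j) \<le> G * wnorm (theta k) + S" .
    then have "2 * \<tau> * wnorm (\<lambda>j. res_lin k j + res_nonlin k j) \<le> 2 * \<tau> * (G * wnorm (theta k) + S)"
      using \<tau> by (intro mult_left_mono) auto
    then show "wnorm (theta (k + 1)) \<le> wnorm (theta (k - 1)) + 2 * \<tau> * (G * wnorm (theta k) + S)"
      using wnorm_theta_step[OF k1] by linarith
  qed
  show "wnorm (err k) \<le> err_bound" by (rule conv[OF k gron[OF k]])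
  show "\<And>j. j \<le> M \<Longrightarrow> cmod (err k j) \<le> 1" by (rule sup1[OF k _ gron[OF k]])
qed

lemma disc_norms_le_wnorm:
  assumes eps1: "\<epsilon> \<le> 1"
  shows "disc_L2_norm h M z \<le> wnorm z" "disc_H1_norm h M z \<le> wnorm z"
proof -
  have n: "disc_L2_norm h M z \<ge> 0" "disc_H1_seminorm h M z \<ge> 0"
    using h_pos by (auto intro: disc_L2_norm_nonneg disc_H1_seminorm_nonneg)
  have "disc_L2_norm h M z \<le> disc_L2_norm h M z / \<epsilon>"
    using n(1) eps eps1 mult_left_mono[of \<epsilon> 1 "disc_L2_norm h M z"] by (simp add: le_divide_eq)
  then have s: "disc_L2_norm h M z + disc_H1_seminorm h M z \<le> wnorm z" by (simp add: wnorm_def)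
  then show "disc_L2_norm h M z \<le> wnorm z" using n by simp
  show "disc_H1_norm h M z \<le> wnorm z"
    unfolding disc_H1_norm_def using sqrt_sum_squares_le_sum[OF n] s by linarith
qed

end

section \<open>Choice of the thresholds\<close>

text \<open>The square of the logarithm wins over the growth rate, the prefactors and \<open>1 / \<epsilon>\<close>.\<close>

lemma eventually_small_epsilon:
  fixes Q c L T \<epsilon>0 :: real
  assumes "T > 0" "Q > 0" "c > 0" "L > 0" "\<epsilon>0 > 0"
  shows "\<exists>\<epsilon>1>0. \<epsilon>1 \<le> \<epsilon>0 \<and> \<epsilon>1 \<le> 1 \<and> (\<forall>\<epsilon>\<in>{0<..\<epsilon>1}. 2 * sqrt L * \<epsilon> \<le> 1 \<and>
      Q * (2 * \<bar>ln \<epsilon>\<bar> + c) * (1 + L / \<epsilon>) * exp (2 * (2 * \<bar>ln \<epsilon>\<bar> + c) * T) \<le> exp (T * \<bar>ln \<epsilon>\<bar>\<^sup>2))"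
proof -
  have "eventually (\<lambda>\<epsilon>::real. Q * (2 * \<bar>ln \<epsilon>\<bar> + c) * (1 + L / \<epsilon>) * exp (2 * (2 * \<bar>ln \<epsilon>\<bar> + c) * T) \<le> exp (T * \<bar>ln \<epsilon>\<bar>\<^sup>2)) (at_right 0)"
    using assms by real_asymp
  then obtain d where d: "d > 0" "\<And>\<epsilon>. 0 < \<epsilon> \<Longrightarrow> \<epsilon> < d \<Longrightarrow>
     Q * (2 * \<bar>ln \<epsilon>\<bar> + c) * (1 + L / \<epsilon>) * exp (2 * (2 * \<bar>ln \<epsilon>\<bar> + c) * T) \<le> exp (T * \<bar>ln \<epsilon>\<bar>\<^sup>2)"
    by (auto simp: eventually_at_right_field)
  define e where "e = min (min \<epsilon>0 1) (min (d / 2) (1 / (2 * sqrt L)))"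
  have "1 / (2 * sqrt L) > 0" using assms by simp
  then have e: "e > 0" "e \<le> \<epsilon>0" "e \<le> 1" "e < d" "e \<le> 1 / (2 * sqrt L)"
    unfolding e_def using assms d(1) by linarith+
  show ?thesis
  proof (intro exI[of _ e] conjI ballI e)
    fix \<epsilon> assume \<epsilon>: "\<epsilon> \<in> {0<..e}"
    have "2 * sqrt L * \<epsilon> \<le> 2 * sqrt L * (1 / (2 * sqrt L))"
      using e(5) \<epsilon> assms by (intro mult_left_mono) auto
    then show "2 * sqrt L * \<epsilon> \<le> 1" using assms by simp
    show "Q * (2 * \<bar>ln \<epsilon>\<bar> + c) * (1 + L / \<epsilon>) * exp (2 * (2 * \<bar>ln \<epsilon>\<bar> + c) * T) \<le> exp (T * \<bar>ln \<epsilon>\<bar>\<^sup>2)"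
      by (rule d(2)) (use \<epsilon> e in auto)
  qed
qed

lemma comparable_on_refl: "comparable_on E A A"
  unfolding comparable_on_def by (rule exI[of _ 1], simp, rule exI[of _ 1], simp)

text \<open>All four functions of \<open>\<epsilon>\<close> can be taken equal to the expressions they are compared with. For given \<open>\<epsilon>\<close> and
  time level \<open>k\<close>, the estimate is applied with \<open>k\<close> as the number of steps.\<close>

theorem theorem3p1:
  fixes a b C0 :: real
  assumes "a < b" and "C0 > 0"
  shows "\<exists>C>0. \<forall>(T::real) (\<epsilon>0::real) (u0 :: real \<Rightarrow> complex) (u :: real \<Rightarrow> real \<Rightarrow> real \<Rightarrow> complex).
    0 < T \<and> 0 < \<epsilon>0 \<and>
    (\<forall>\<epsilon>\<in>{0..\<epsilon>0}.
       RLogSE_solution a b \<epsilon> u0 (max_existence_time a b \<epsilon> u0) (u \<epsilon>) \<and>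
       ereal T < max_existence_time a b \<epsilon> u0 \<and>
       assumption_A a b T C0 (u \<epsilon>))
    \<longrightarrow>
    (\<exists>\<epsilon>1\<in>{0<..\<epsilon>0}. \<exists>h0 \<tau>0 C1 C2 :: real \<Rightarrow> real.
       comparable_on {0<..\<epsilon>1} h0 (\<lambda>\<epsilon>. sqrt \<epsilon> * exp (- C * T * \<bar>ln \<epsilon>\<bar>\<^sup>2)) \<and>
       comparable_on {0<..\<epsilon>1} \<tau>0 (\<lambda>\<epsilon>. sqrt \<epsilon> * exp (- C * T * \<bar>ln \<epsilon>\<bar>\<^sup>2)) \<and>
       comparable_on {0<..\<epsilon>1} C1 (\<lambda>\<epsilon>. exp (C * T * \<bar>ln \<epsilon>\<bar>\<^sup>2)) \<and>
       comparable_on {0<..\<epsilon>1} C2 (\<lambda>\<epsilon>. 1 / \<epsilon> * exp (C * T * \<bar>ln \<epsilon>\<bar>\<^sup>2)) \<and>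
       (\<forall>\<epsilon>\<in>{0<..\<epsilon>1}. 0 < h0 \<epsilon> \<and> 0 < \<tau>0 \<epsilon> \<and>
         (\<forall>(M::nat) (\<tau>::real) (h::real) (U :: nat \<Rightarrow> nat \<Rightarrow> complex).
            M \<ge> 1 \<and> h = grid_width a b M \<and> h \<le> h0 \<epsilon> \<and>
            0 < \<tau> \<and> \<tau> \<le> \<tau>0 \<epsilon> \<and> T / \<tau> \<in> \<int> \<and>
            SIFD_solution a b M \<tau> \<epsilon> u0 U \<and> stability_condition M \<tau> \<epsilon> T U
            \<longrightarrow>
            (\<forall>k. real k \<le> T / \<tau> \<longrightarrow>
               (let e = (\<lambda>j. u \<epsilon> (real k * \<tau>) (grid_point a b M j) - U k j) in
                  disc_L2_norm h M e \<le> C1 \<epsilon> * (h\<^sup>2 + \<tau>\<^sup>2) \<and>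
                  disc_H1_norm h M e \<le> C2 \<epsilon> * (h\<^sup>2 + \<tau>\<^sup>2) \<and>
                  ereal (disc_sup_norm M (U k)) \<le> Linf_norm a b T (u \<epsilon>) + 1)))))"
proof (intro exI[of _ "1::real"] conjI allI impI zero_less_one)
  fix T \<epsilon>0 :: real and u0 :: "real \<Rightarrow> complex" and u :: "real \<Rightarrow> real \<Rightarrow> real \<Rightarrow> complex"
  assume A: "0 < T \<and> 0 < \<epsilon>0 \<and>
    (\<forall>\<epsilon>\<in>{0..\<epsilon>0}.
       RLogSE_solution a b \<epsilon> u0 (max_existence_time a b \<epsilon> u0) (u \<epsilon>) \<and>
       ereal T < max_existence_time a b \<epsilon> u0 \<and>
       assumption_A a b T C0 (u \<epsilon>))"
  then have T: "0 < T" and \<epsilon>0: "0 < \<epsilon>0" by auto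
  define KB KF where "KB = weak_L1_const a b C0 T" and "KF = sup_const a b C0 T"
  have KB: "KB > 0" unfolding KB_def weak_L1_const_def using assms T by (auto intro!: mult_pos_pos add_pos_pos)
  have KF: "KF > 0" unfolding KF_def sup_const_def KB_def[symmetric] using assms KB by (auto intro!: add_pos_pos)
  \<comment> \<open>\<open>growth\<close> is \<open>2 \<bar>ln \<epsilon>\<bar> + c\<close>\<close>
  define c where "c = 2 * ln (1 + (KF + 1)) + 2 + 20 * KF"
  have c: "c > 0" using KF by (auto simp: c_def intro!: add_nonneg_pos)
  define Q where "Q = (16 * KB + 3 * KF) * sqrt (b - a)"
  have Q: "Q > 0" using KB KF assms by (auto simp: Q_def intro!: mult_pos_pos add_pos_pos)
  obtain \<epsilon>1 where \<epsilon>1: "\<epsilon>1 > 0" "\<epsilon>1 \<le> \<epsilon>0" "\<epsilon>1 \<le> 1" and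
    small: "\<And>\<epsilon>. \<epsilon> \<in> {0<..\<epsilon>1} \<Longrightarrow> 2 * sqrt (b - a) * \<epsilon> \<le> 1"
    "\<And>\<epsilon>. \<epsilon> \<in> {0<..\<epsilon>1} \<Longrightarrow> Q * (2 * \<bar>ln \<epsilon>\<bar> + c) * (1 + (b - a) / \<epsilon>) * exp (2 * (2 * \<bar>ln \<epsilon>\<bar> + c) * T) \<le> exp (T * \<bar>ln \<epsilon>\<bar>\<^sup>2)"
    using eventually_small_epsilon[OF T Q c _ \<epsilon>0, of "b - a"] assms(1) by (metis diff_gt_0_iff_gt)
  let ?h0 = "\<lambda>\<epsilon>::real. sqrt \<epsilon> * exp (- 1 * T * \<bar>ln \<epsilon>\<bar>\<^sup>2)"
  let ?C1 = "\<lambda>\<epsilon>::real. exp (1 * T * \<bar>ln \<epsilon>\<bar>\<^sup>2)"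
  let ?C2 = "\<lambda>\<epsilon>::real. 1 / \<epsilon> * exp (1 * T * \<bar>ln \<epsilon>\<bar>\<^sup>2)"
  have main: "disc_L2_norm h M e \<le> ?C1 \<epsilon> * (h\<^sup>2 + \<tau>\<^sup>2) \<and> disc_H1_norm h M e \<le> ?C2 \<epsilon> * (h\<^sup>2 + \<tau>\<^sup>2) \<and>
       ereal (disc_sup_norm M (U k)) \<le> Linf_norm a b T (u \<epsilon>) + 1"
    if \<epsilon>: "\<epsilon> \<in> {0<..\<epsilon>1}" and M: "M \<ge> 1" and h: "h = grid_width a b M" "h \<le> ?h0 \<epsilon>" and \<tau>: "0 < \<tau>" "\<tau> \<le> ?h0 \<epsilon>"
      and U: "SIFD_solution a b M \<tau> \<epsilon> u0 U" and k: "real k \<le> T / \<tau>"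
      and e: "e = (\<lambda>j. u \<epsilon> (real k * \<tau>) (grid_point a b M j) - U k j)"
    for \<epsilon> M h \<tau> U k e
  proof -
    have eI: "\<epsilon> \<in> {0..\<epsilon>0}" "0 < \<epsilon>" "\<epsilon> \<le> 1" using \<epsilon> \<epsilon>1 by auto
    obtain D where D: "D 0 = u \<epsilon>" "sobolev_Cn a b 0 5 {0..T} D" "sobolev_Cn a b 2 4 {0..T} D" "sobolev_Cn a b 3 2 {0..T} D"
      "Linf_sobolev_norm a b 5 T (D 0) + Linf_sobolev_norm a b 4 T (D 2) + Linf_sobolev_norm a b 2 T (D 3) \<le> ereal C0"
      using A eI(1) unfolding assumption_A_def by blast
    have kT: "real k * \<tau> \<le> T" using k \<tau> by (simp add: field_simps)
    interpret G: SIFD_grid a b T C0 \<epsilon> "max_existence_time a b \<epsilon> u0" u0 "u \<epsilon>" D M \<tau> k U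
      using A eI D assms M \<tau> kT U by unfold_locales auto
    have hG: "G.h = h" using h by (simp add: G.h_def)
    have hp: "h > 0" using G.h_pos hG by simp
    have growth: "G.growth = 2 * \<bar>ln \<epsilon>\<bar> + c"
      by (simp add: G.growth_def lip_const_def c_def KF_def)
    have eb: "G.err_bound \<le> ?C1 \<epsilon> * (h\<^sup>2 + \<tau>\<^sup>2)"
    proof -
      have "G.err_bound = (Q * (2 * \<bar>ln \<epsilon>\<bar> + c) * (1 + (b - a) / \<epsilon>) * exp (2 * (2 * \<bar>ln \<epsilon>\<bar> + c) * T)) * (h\<^sup>2 + \<tau>\<^sup>2)"
        unfolding G.err_bound_def G.wscale_def growth hG Q_def KB_def KF_def by (simp add: mult_ac)
      also have "\<dots> \<le> exp (T * \<bar>ln \<epsilon>\<bar>\<^sup>2) * (h\<^sup>2 + \<tau>\<^sup>2)"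
        using small(2)[OF \<epsilon>] by (intro mult_right_mono) auto
      finally show ?thesis by simp
    qed
    have sq: "(?h0 \<epsilon>)\<^sup>2 = \<epsilon> * (exp (- (T * \<bar>ln \<epsilon>\<bar>\<^sup>2)))\<^sup>2" using eI by (simp add: power_mult_distrib)
    \<comment> \<open>one factor \<open>exp (- T \<bar>ln \<epsilon>\<bar>\<^sup>2)\<close> cancels the growth, the factor \<open>\<epsilon>\<close> makes the rest small\<close>
    have hs: "h\<^sup>2 + \<tau>\<^sup>2 \<le> 2 * \<epsilon> * (exp (- (T * \<bar>ln \<epsilon>\<bar>\<^sup>2)))\<^sup>2"
      using power_mono[OF h(2), of 2] power_mono[OF \<tau>(2), of 2] hp \<tau> sq by linarith
    have "sqrt (b - a) * G.err_bound \<le> sqrt (b - a) * (?C1 \<epsilon> * (2 * \<epsilon> * (exp (- (T * \<bar>ln \<epsilon>\<bar>\<^sup>2)))\<^sup>2))"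
      using eb hs assms by (intro mult_left_mono order_trans[OF eb]) auto
    also have "\<dots> = (2 * sqrt (b - a) * \<epsilon>) * exp (- (T * \<bar>ln \<epsilon>\<bar>\<^sup>2))"
      by (simp add: exp_minus power2_eq_square)
    also have "\<dots> \<le> 1 * 1"
      using small(1)[OF \<epsilon>] T by (intro mult_mono) auto
    finally have sm: "sqrt (b - a) * G.err_bound \<le> 1" by simp
    note est = G.err_estimate[OF eI(3) sm order_refl]
    have tk: "real k * \<tau> \<in> {0..T}" by (rule G.tk_in) simp
    have err_eq: "G.err k j = e j" if "j \<le> M" for j
      using G.u_eq_fd[OF tk G.xg_in[OF that]] by (simp add: G.err_def G.ug_def e G.xg_def)
    have n1: "disc_L2_norm h M e = disc_L2_norm h M (G.err k)"
      unfolding disc_L2_norm_def using err_eq by (intro arg_cong[where f = sqrt] arg_cong2[where f = "(*)"] sum.cong refl) auto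
    have n2: "disc_H1_seminorm h M e = disc_H1_seminorm h M (G.err k)"
      unfolding disc_H1_seminorm_def delta_xp_def using err_eq
      by (intro arg_cong[where f = sqrt] arg_cong2[where f = "(*)"] sum.cong refl) auto
    have n3: "disc_H1_norm h M e = disc_H1_norm h M (G.err k)"
      unfolding disc_H1_norm_def n1 n2 ..
    have 1: "disc_L2_norm h M e \<le> ?C1 \<epsilon> * (h\<^sup>2 + \<tau>\<^sup>2)" "disc_H1_norm h M e \<le> ?C1 \<epsilon> * (h\<^sup>2 + \<tau>\<^sup>2)"
      using G.disc_norms_le_wnorm[OF eI(3), of "G.err k"] est(1) eb unfolding n1 n3 hG by auto
    have "?C1 \<epsilon> \<le> ?C2 \<epsilon>" using eI by (simp add: field_simps)
    then have "?C1 \<epsilon> * (h\<^sup>2 + \<tau>\<^sup>2) \<le> ?C2 \<epsilon> * (h\<^sup>2 + \<tau>\<^sup>2)" by (intro mult_right_mono) auto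
    then have 2: "disc_H1_norm h M e \<le> ?C2 \<epsilon> * (h\<^sup>2 + \<tau>\<^sup>2)" using 1(2) by linarith
    have 3: "ereal (disc_sup_norm M (U k)) \<le> Linf_norm a b T (u \<epsilon>) + 1"
    proof -
      have "disc_sup_norm M (U k) \<in> (\<lambda>j. cmod (U k j)) ` {0..M}"
        unfolding disc_sup_norm_def by (rule Max_in) auto
      then obtain j where j: "j \<le> M" "disc_sup_norm M (U k) = cmod (U k j)" by auto
      have "cmod (U k j) \<le> cmod (u \<epsilon> (real k * \<tau>) (G.xg j)) + cmod (G.err k j)"
        using norm_triangle_ineq4[of "u \<epsilon> (real k * \<tau>) (G.xg j)" "e j"] err_eq[OF j(1)]
        by (simp add: e G.xg_def)
      also have "\<dots> \<le> cmod (u \<epsilon> (real k * \<tau>) (G.xg j)) + 1" using est(2)[OF j(1)] by simp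
      finally have "ereal (cmod (U k j)) \<le> ereal (cmod (u \<epsilon> (real k * \<tau>) (G.xg j))) + 1"
        by (simp add: one_ereal_def)
      also have "\<dots> \<le> Linf_norm a b T (u \<epsilon>) + 1"
        by (intro add_right_mono G.norm_le_Linf_norm tk G.xg_in j)
      finally show ?thesis using j(2) by simp
    qed
    show ?thesis using 1(1) 2 3 by blast
  qed
  show "\<exists>\<epsilon>1\<in>{0<..\<epsilon>0}. \<exists>h0 \<tau>0 C1 C2 :: real \<Rightarrow> real.
       comparable_on {0<..\<epsilon>1} h0 (\<lambda>\<epsilon>. sqrt \<epsilon> * exp (- 1 * T * \<bar>ln \<epsilon>\<bar>\<^sup>2)) \<and>
       comparable_on {0<..\<epsilon>1} \<tau>0 (\<lambda>\<epsilon>. sqrt \<epsilon> * exp (- 1 * T * \<bar>ln \<epsilon>\<bar>\<^sup>2)) \<and>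
       comparable_on {0<..\<epsilon>1} C1 (\<lambda>\<epsilon>. exp (1 * T * \<bar>ln \<epsilon>\<bar>\<^sup>2)) \<and>
       comparable_on {0<..\<epsilon>1} C2 (\<lambda>\<epsilon>. 1 / \<epsilon> * exp (1 * T * \<bar>ln \<epsilon>\<bar>\<^sup>2)) \<and>
       (\<forall>\<epsilon>\<in>{0<..\<epsilon>1}. 0 < h0 \<epsilon> \<and> 0 < \<tau>0 \<epsilon> \<and>
         (\<forall>(M::nat) (\<tau>::real) (h::real) (U :: nat \<Rightarrow> nat \<Rightarrow> complex).
            M \<ge> 1 \<and> h = grid_width a b M \<and> h \<le> h0 \<epsilon> \<and>
            0 < \<tau> \<and> \<tau> \<le> \<tau>0 \<epsilon> \<and> T / \<tau> \<in> \<int> \<and>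
            SIFD_solution a b M \<tau> \<epsilon> u0 U \<and> stability_condition M \<tau> \<epsilon> T U
            \<longrightarrow>
            (\<forall>k. real k \<le> T / \<tau> \<longrightarrow>
               (let e = (\<lambda>j. u \<epsilon> (real k * \<tau>) (grid_point a b M j) - U k j) in
                  disc_L2_norm h M e \<le> C1 \<epsilon> * (h\<^sup>2 + \<tau>\<^sup>2) \<and>
                  disc_H1_norm h M e \<le> C2 \<epsilon> * (h\<^sup>2 + \<tau>\<^sup>2) \<and>
                  ereal (disc_sup_norm M (U k)) \<le> Linf_norm a b T (u \<epsilon>) + 1))))"
  proof (rule bexI[of _ \<epsilon>1], rule exI[of _ ?h0], rule exI[of _ ?h0], rule exI[of _ ?C1], rule exI[of _ ?C2],
      intro conjI comparable_on_refl ballI allI impI)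
    fix \<epsilon> assume \<epsilon>: "\<epsilon> \<in> {0<..\<epsilon>1}"
    then show "0 < ?h0 \<epsilon>" "0 < ?h0 \<epsilon>" by auto
    fix M :: nat and \<tau> h :: real and U :: "nat \<Rightarrow> nat \<Rightarrow> complex" and k :: nat
    assume H: "M \<ge> 1 \<and> h = grid_width a b M \<and> h \<le> ?h0 \<epsilon> \<and>
            0 < \<tau> \<and> \<tau> \<le> ?h0 \<epsilon> \<and> T / \<tau> \<in> \<int> \<and>
            SIFD_solution a b M \<tau> \<epsilon> u0 U \<and> stability_condition M \<tau> \<epsilon> T U" and k: "real k \<le> T / \<tau>"
    show "let e = (\<lambda>j. u \<epsilon> (real k * \<tau>) (grid_point a b M j) - U k j) in
                  disc_L2_norm h M e \<le> ?C1 \<epsilon> * (h\<^sup>2 + \<tau>\<^sup>2) \<and>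
                  disc_H1_norm h M e \<le> ?C2 \<epsilon> * (h\<^sup>2 + \<tau>\<^sup>2) \<and>
                  ereal (disc_sup_norm M (U k)) \<le> Linf_norm a b T (u \<epsilon>) + 1"
      unfolding Let_def by (rule main[OF \<epsilon> _ _ _ _ _ _ k refl]) (use H in auto)
  qed (use \<epsilon>1 in auto)
qed

end
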